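(* Let $k>-\frac12$ and let $1\le\alpha,p,q\le\infty$ with $q\le\alpha\le p$. Then $\bigl((L^q,L^p)^\alpha(\mu),\|\cdot\|_{q,p,\alpha}\bigr)$ is a complex Banach space.
   Context: Fix $k>-\frac12$ and let $d\mu(x)=(2^{k+1}\Gamma(k+1))^{-1}|x|^{2k+1}dx$ on $\mathbb R$. $L^p(\mu)$ is the Lebesgue space with norm $\|\cdot\|_p$; $L^0(\mu)$ is the space of ($\mu$-a.e. classes of) complex-valued $\mu$-measurable functions on $\mathbb R$. $\chi_A$ is the characteristic function of $A$. For $r>0$, $B_r=B(0,r)=(-r,r)$, and for $x\ne0$, $B(x,r)=\{y\in\mathbb R:\max\{0,|x|-r\}<|y|<|x|+r\}$. Dunkl translation. Let $j_k(z)=\Gamma(k+1)\sum_{n\ge0}\frac{(-1)^nz^{2n}}{n!\,2^{2n}\Gamma(n+k+1)}$ and let $E_k(\lambda x)=j_k(i\lambda x)+\frac{\lambda x}{2(k+1)}j_{k+1}(i\lambda x)$ be the Dunkl kernel. The Dunkl transform is $\mathcal F_kf(\lambda)=\int_{\mathbb R}E_k(-i\lambda x)f(x)\,d\mu(x)$ for $f\in L^1(\mu)$, extended uniquely to an isometric isomorphism of $L^2(\mu)$. For $y\in\mathbb R$ the translation $\tau_y$ is defined on $L^2(\mu)$ by $\mathcal F_k(\tau_yf)(x)=E_k(ixy)\mathcal F_k(f)(x)$, and it extends to a bounded operator on every $L^p(\mu)$, $1\le p\le\infty$. One has $\int(\tau_yf)\,g\,d\mu=\int f\,(\tau_{-y}g)\,d\mu$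 on $L^2(\mu)$, and $\tau_{-y}\chi_{B_r}$ is nonnegative and supported in the closure of $B(y,r)$. Integrals of translates of general functions are understood through this duality: $\int_{\mathbb R}(\tau_y|f|^q)\chi_{B_r}\,d\mu:=\int_{\mathbb R}|f|^q\,\tau_{-y}\chi_{B_r}\,d\mu$. Norms. For $1\le q,p\le\infty$, $r>0$, $f\in L^0(\mu)$, ${}_r\|f\|_{q,p}$ is the $L^p(\mu)$-norm in the variable $y$ of $\bigl[\int_{\mathbb R}(\tau_y|f|^q)(x)\chi_{B_r}(x)\,d\mu(x)\bigr]^{1/q}$ if $q<\infty$, and of $\|f\chi_{B(y,r)}\|_\infty$ if $q=\infty$. For $1\le q\le\alpha\le p\le\infty$, $$\|f\|_{q,p,\alpha}=\sup_{r>0}\mu(B_r)^{\frac1\alpha-\frac1q-\frac1p}\;{}_r\|f\|_{q,p},\qquad (L^q,L^p)^\alpha(\mu)=\{f\in L^0(\mu):\|f\|_{q,p,\alpha}<\infty\}.$$ *)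

theory Defs
  imports "HOL-Probability.Essential_Supremum" "HOL-Algebra.Module"
begin

section \<open>Complex Banach spaces on an explicit carrier\<close>

definition complex_ring :: "complex ring" where
  "complex_ring = \<lparr>carrier = UNIV, mult = (*), one = 1, zero = 0, add = (+)\<rparr>"

text \<open>The locale \<^locale>\<open>Metric_space\<close> asks for a distance that is nonnegative and symmetric on the
  whole type, so the distance is set to \<open>0\<close> outside the carrier.\<close>

definition complex_banach_space :: "(complex, 'v) module \<Rightarrow> ('v \<Rightarrow> real) \<Rightarrow> bool" where
  "complex_banach_space V N \<longleftrightarrow>
     module complex_ring V \<and>
     (\<forall>u\<in>carrier V. 0 \<le> N u) \<and>
     (\<forall>u\<in>carrier V. N u = 0 \<longleftrightarrow> u = \<zero>\<^bsub>V\<^esub>) \<and>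
     (\<forall>c. \<forall>u\<in>carrier V. N (c \<odot>\<^bsub>V\<^esub> u) = cmod c * N u) \<and>
     (\<forall>u\<in>carrier V. \<forall>v\<in>carrier V. N (u \<oplus>\<^bsub>V\<^esub> v) \<le> N u + N v) \<and>
     Metric_space.mcomplete (carrier V)
       (\<lambda>u v. if u \<in> carrier V \<and> v \<in> carrier V then N (u \<ominus>\<^bsub>V\<^esub> v) else 0)"


section \<open>The measure, Lebesgue norms and the space of measurable functions modulo null sets\<close>

text \<open>The density is taken with respect to the completed Lebesgue measure, so that measurability
  with respect to \<open>dunkl_measure k\<close> is Lebesgue measurability.\<close>

definition dunkl_measure :: "real \<Rightarrow> real measure" where
  "dunkl_measure k =
     density lebesgue (\<lambda>x. ennreal (\<bar>x\<bar> powr (2 * k + 1) / (2 powr (k + 1) * Gamma (k + 1))))"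

text \<open>Used for positive exponents only.\<close>

definition ennreal_powr :: "ennreal \<Rightarrow> real \<Rightarrow> ennreal" where
  "ennreal_powr x a = (if x = \<infinity> then \<infinity> else ennreal (enn2real x powr a))"

text \<open>Exponents are elements of \<^typ>\<open>ennreal\<close>; \<open>recip p\<close> is $1/p$ with $1/\infty = 0$.\<close>

definition recip :: "ennreal \<Rightarrow> real" where
  "recip p = enn2real (inverse p)"

definition Lp_norm :: "real measure \<Rightarrow> ennreal \<Rightarrow> (real \<Rightarrow> ennreal) \<Rightarrow> ennreal" where
  "Lp_norm M p g =
     (if p = \<infinity> then esssup M g
      else ennreal_powr (\<integral>\<^sup>+x. ennreal_powr (g x) (enn2real p) \<partial>M) (recip p))"

definition Lp :: "real measure \<Rightarrow> ennreal \<Rightarrow> (real \<Rightarrow> complex) set" where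
  "Lp M p = {f \<in> borel_measurable M. Lp_norm M p (\<lambda>x. ennreal (cmod (f x))) < \<infinity>}"

definition ae_class :: "real measure \<Rightarrow> (real \<Rightarrow> complex) \<Rightarrow> (real \<Rightarrow> complex) set" where
  "ae_class M f = {g \<in> borel_measurable M. AE x in M. g x = f x}"

definition L0 :: "real measure \<Rightarrow> (real \<Rightarrow> complex) set set" where
  "L0 M = ae_class M ` borel_measurable M"

definition rep :: "(real \<Rightarrow> complex) set \<Rightarrow> real \<Rightarrow> complex" where
  "rep F = (SOME f. f \<in> F)"


section \<open>The Dunkl transform and the Dunkl translation\<close>

definition bessel_j :: "real \<Rightarrow> complex \<Rightarrow> complex" where
  "bessel_j k z = of_real (Gamma (k + 1)) *
     (\<Sum>n. (-1) ^ n * z ^ (2 * n) / of_real (fact n * 2 ^ (2 * n) * Gamma (real n + k + 1)))"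

definition dunkl_kernel :: "real \<Rightarrow> complex \<Rightarrow> complex" where
  "dunkl_kernel k z =
     bessel_j k (\<i> * z) + z / of_real (2 * (k + 1)) * bessel_j (k + 1) (\<i> * z)"

definition dunkl_transform_L1 :: "real \<Rightarrow> (real \<Rightarrow> complex) \<Rightarrow> real \<Rightarrow> complex" where
  "dunkl_transform_L1 k f l =
     (LINT x|dunkl_measure k. dunkl_kernel k (- \<i> * of_real (l * x)) * f x)"

text \<open>The predicate says that \<open>T\<close> induces an isometric isomorphism of $L^2(\mu)$ onto itself that
  agrees with the integral formula on $L^1(\mu) \cap L^2(\mu)$.  By density, such a \<open>T\<close> is unique
  on $L^2(\mu)$ up to null sets.\<close>

definition is_dunkl_L2_extension ::
  "real \<Rightarrow> ((real \<Rightarrow> complex) \<Rightarrow> real \<Rightarrow> complex) \<Rightarrow> bool" where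
  "is_dunkl_L2_extension k T \<longleftrightarrow>
     (let M = dunkl_measure k; L2 = Lp M 2;
          norm2 = (\<lambda>f. Lp_norm M 2 (\<lambda>x. ennreal (cmod (f x)))) in
      (\<forall>f\<in>L2. T f \<in> L2) \<and>
      (\<forall>f\<in>L2. \<forall>g\<in>L2. AE x in M. T (\<lambda>t. f t + g t) x = T f x + T g x) \<and>
      (\<forall>c. \<forall>f\<in>L2. AE x in M. T (\<lambda>t. c * f t) x = c * T f x) \<and>
      (\<forall>f\<in>L2. norm2 (T f) = norm2 f) \<and>
      (\<forall>g\<in>L2. \<exists>f\<in>L2. AE x in M. T f x = g x) \<and>
      (\<forall>f\<in>Lp M 1 \<inter> L2. AE x in M. T f x = dunkl_transform_L1 k f x))"

definition dunkl_transform :: "real \<Rightarrow> (real \<Rightarrow> complex) \<Rightarrow> real \<Rightarrow> complex" where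
  "dunkl_transform k = (SOME T. is_dunkl_L2_extension k T)"

text \<open>Translation on $L^2(\mu)$; the result is a representative of its class.\<close>

definition dunkl_translation ::
  "real \<Rightarrow> real \<Rightarrow> (real \<Rightarrow> complex) \<Rightarrow> real \<Rightarrow> complex" where
  "dunkl_translation k y f =
     (SOME g. g \<in> Lp (dunkl_measure k) 2 \<and>
        (AE x in dunkl_measure k.
           dunkl_transform k g x =
             dunkl_kernel k (\<i> * of_real (x * y)) * dunkl_transform k f x))"


section \<open>The spaces $(L^q, L^p)^\alpha(\mu)$\<close>

definition dunkl_ball :: "real \<Rightarrow> real \<Rightarrow> real set" where
  "dunkl_ball x r =
     (if x = 0 then {-r<..<r} else {y. max 0 (\<bar>x\<bar> - r) < \<bar>y\<bar> \<and> \<bar>y\<bar> < \<bar>x\<bar> + r})"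

text \<open>\<open>translated_mass k q r f y\<close> is $\int (\tau_y |f|^q) \chi_{B_r} \, d\mu$, understood by duality as
  $\int |f|^q \, \tau_{-y} \chi_{B_r} \, d\mu$.  The function $\tau_{-y} \chi_{B_r}$ is real and
  nonnegative almost everywhere, so \<open>ennreal (Re _)\<close> only changes its type.\<close>

definition translated_mass :: "real \<Rightarrow> real \<Rightarrow> real \<Rightarrow> (real \<Rightarrow> complex) \<Rightarrow> real \<Rightarrow> ennreal" where
  "translated_mass k q r f y =
     (\<integral>\<^sup>+x. ennreal (cmod (f x) powr q) *
           ennreal (Re (dunkl_translation k (- y) (indicator (dunkl_ball 0 r)) x))
      \<partial>dunkl_measure k)"

definition local_norm :: "real \<Rightarrow> ennreal \<Rightarrow> real \<Rightarrow> (real \<Rightarrow> complex) \<Rightarrow> real \<Rightarrow> ennreal" where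
  "local_norm k q r f y =
     (if q = \<infinity> then
        esssup (dunkl_measure k) (\<lambda>x. ennreal (cmod (f x * indicator (dunkl_ball y r) x)))
      else ennreal_powr (translated_mass k (enn2real q) r f y) (recip q))"

definition amalgam_norm ::
  "real \<Rightarrow> ennreal \<Rightarrow> ennreal \<Rightarrow> real \<Rightarrow> (real \<Rightarrow> complex) \<Rightarrow> ennreal" where
  "amalgam_norm k q p r f = Lp_norm (dunkl_measure k) p (local_norm k q r f)"

definition fofana_norm ::
  "real \<Rightarrow> ennreal \<Rightarrow> ennreal \<Rightarrow> ennreal \<Rightarrow> (real \<Rightarrow> complex) \<Rightarrow> ennreal" where
  "fofana_norm k q p \<alpha> f =
     (SUP r\<in>{0<..}.
        ennreal (measure (dunkl_measure k) (dunkl_ball 0 r) powr (recip \<alpha> - recip q - recip p))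
        * amalgam_norm k q p r f)"

definition fofana_space ::
  "real \<Rightarrow> ennreal \<Rightarrow> ennreal \<Rightarrow> ennreal \<Rightarrow> (complex, (real \<Rightarrow> complex) set) module" where
  "fofana_space k q p \<alpha> =
     (let M = dunkl_measure k in
      \<lparr>carrier = {F \<in> L0 M. fofana_norm k q p \<alpha> (rep F) < \<infinity>},
       mult = undefined, one = undefined,
       zero = ae_class M (\<lambda>x. 0),
       add = (\<lambda>F G. ae_class M (\<lambda>x. rep F x + rep G x)),
       smult = (\<lambda>c F. ae_class M (\<lambda>x. c * rep F x))\<rparr>)"

end

theory Submission
  imports Defs
begin

text \<open>
  Two things make the spaces complete: an abstract argument for norms on function spaces, and enough
  knowledge of the translates \<open>\<tau>\<^sub>-\<^sub>y \<chi>\<close> of the balls to see that the argument applies.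

  Call a norm on measurable $[0, \<infinity>]$-valued functions a function norm if it is monotone, homogeneous,
  subadditive, definite and continuous along increasing sequences.  The classes of complex functions
  whose modulus has finite norm then form a Banach space by the Riesz--Fischer argument
  (\<open>complex_banach_space_V\<close>).  Minkowski's inequality makes every \<open>L\<^sup>p\<close> norm a function norm.  The Fofana norm is a
  supremum over \<open>r\<close> of \<open>L\<^sup>p\<close> norms in \<open>y\<close> of \<open>L\<^sup>q\<close> norms in \<open>x\<close>, the latter with respect to a density \<open>K y\<close>:
  the indicator of \<open>B(y, r)\<close> if \<open>q = \<infinity>\<close>, and \<open>\<tau>\<^sub>-\<^sub>y \<chi>\<close> with \<open>\<chi>\<close> the indicator of \<open>B(0, r)\<close> if \<open>q < \<infinity>\<close>.  By
  \<open>function_norm_SUP_mixed_norm\<close> such a supremum is a function norm as soon as \<open>y \<mapsto> \<integral> g K y d\<mu>\<close> is measurable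
  for every \<open>g \<ge> 0\<close>, and only null functions \<open>g\<close> have \<open>\<integral> g K y d\<mu> = 0\<close> for almost all \<open>y\<close> and all \<open>r\<close>.

  For the balls both conditions are elementary.  For the translates they follow from the continuity of
  \<open>y \<mapsto> \<tau>\<^sub>-\<^sub>y \<chi>\<close> into \<open>L\<^sup>2\<close>: pairings with square-integrable functions are continuous in \<open>y\<close>, general ones are
  suprema of those, and a continuous pairing that vanishes almost everywhere vanishes at \<open>y = 0\<close>, where the
  translate is \<open>\<chi>\<close> itself (\<open>translation_window_total\<close>).

  The continuity comes from the definition of \<open>\<tau>\<close> on the transform side, once the kernel is known to be
  bounded by \<open>1\<close> on the imaginary axis (\<open>cmod_dunkl_kernel_imaginary_le_1\<close>, an energy argument for the
  differential equations of the kernel) and the transform to extend to an isometry of \<open>L\<^sup>2\<close> onto itself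
  (\<open>Plancherel\<close>).  For the latter, the functions \<open>exp (- t x\<^sup>2)\<close> and \<open>x exp (- t x\<^sup>2)\<close> are transformed into
  multiples of the same functions with \<open>1 / (4 t)\<close> in place of \<open>t\<close>, so on their span the isometry is a
  comparison of explicit inner products; the span is dense by the Weierstrass theorem in the variable
  \<open>exp (- x\<^sup>2)\<close> (\<open>gauss_span_dense\<close>); and the extension agrees with the integral on \<open>L\<^sup>1 \<inter> L\<^sup>2\<close> because the
  kernel is symmetric (\<open>F_duality\<close>).
\<close>

section \<open>Minkowski's inequality and function norms\<close>

lemma ennreal_powr_0 [simp]: "ennreal_powr 0 a = 0"
  by (simp add: ennreal_powr_def)

lemma ennreal_powr_ennreal: "0 \<le> x \<Longrightarrow> ennreal_powr (ennreal x) a = ennreal (x powr a)"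
  by (simp add: ennreal_powr_def)

lemma ennreal_powr_1: "ennreal_powr x 1 = x"
  by (cases x) (auto simp: ennreal_powr_def)

lemma ennreal_powr_mono:
  assumes "0 < a" "x \<le> y" shows "ennreal_powr x a \<le> ennreal_powr y a"
  using assms by (cases x; cases y) (auto simp: ennreal_powr_def top_unique intro!: ennreal_leI powr_mono2)

lemma ennreal_powr_powr:
  assumes "0 < a" shows "ennreal_powr (ennreal_powr x a) b = ennreal_powr x (a * b)"
  by (cases x) (auto simp: ennreal_powr_def powr_powr)

lemma ennreal_powr_mult:
  assumes "0 < a" shows "ennreal_powr (x * y) a = ennreal_powr x a * ennreal_powr y a"
proof -
  have [simp]: "ennreal_powr \<infinity> a = \<infinity>" "ennreal_powr top_class.top a = top_class.top" by (simp_all add: ennreal_powr_def)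
  show ?thesis
  proof (cases "x = 0 \<or> y = 0")
    case False
    have pos: "ennreal_powr z a \<noteq> 0" if "z \<noteq> 0" for z
      using that by (cases z) (auto simp: ennreal_powr_def)
    show ?thesis
      using False pos[of x] pos[of y]
      by (cases x; cases y)
        (auto simp: ennreal_powr_ennreal powr_mult ennreal_mult'' ennreal_mult_top ennreal_top_mult
           simp flip: ennreal_mult'')
  qed auto
qed

text \<open>The power maps with exponents \<open>a\<close> and \<open>1 / a\<close> are mutually inverse order isomorphisms.  Phrasing this as
  a Galois connection gives the commutation with suprema at once.\<close>

lemma ennreal_powr_le_iff:
  assumes "0 < a" shows "ennreal_powr x a \<le> c \<longleftrightarrow> x \<le> ennreal_powr c (1 / a)"
proof
  assume "ennreal_powr x a \<le> c"
  then have "ennreal_powr (ennreal_powr x a) (1 / a) \<le> ennreal_powr c (1 / a)"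
    using assms by (intro ennreal_powr_mono) auto
  then show "x \<le> ennreal_powr c (1 / a)"
    using assms by (simp add: ennreal_powr_powr ennreal_powr_1)
next
  assume "x \<le> ennreal_powr c (1 / a)"
  then have "ennreal_powr x a \<le> ennreal_powr (ennreal_powr c (1 / a)) a"
    using assms by (intro ennreal_powr_mono) auto
  then show "ennreal_powr x a \<le> c"
    using assms by (simp add: ennreal_powr_powr ennreal_powr_1)
qed

lemma ennreal_powr_eq_0_iff:
  assumes "0 < a" shows "ennreal_powr x a = 0 \<longleftrightarrow> x = 0"
  using ennreal_powr_le_iff[OF assms, of x 0] by simp

lemma ennreal_powr_SUP:
  assumes "0 < a" shows "ennreal_powr (SUP i\<in>I. f i) a = (SUP i\<in>I. ennreal_powr (f i) a)"
proof (rule antisym)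
  show "ennreal_powr (SUP i\<in>I. f i) a \<le> (SUP i\<in>I. ennreal_powr (f i) a)"
    by (subst ennreal_powr_le_iff[OF assms], rule SUP_least, subst ennreal_powr_le_iff[OF assms, symmetric])
       (rule SUP_upper)
  show "(SUP i\<in>I. ennreal_powr (f i) a) \<le> ennreal_powr (SUP i\<in>I. f i) a"
    using assms by (intro SUP_least ennreal_powr_mono SUP_upper) auto
qed

lemma borel_measurable_ennreal_powr [measurable]:
  assumes [measurable]: "f \<in> borel_measurable M"
  shows "(\<lambda>x. ennreal_powr (f x) a) \<in> borel_measurable M"
  unfolding ennreal_powr_def by measurable

text \<open>Convexity of \<open>t \<mapsto> t powr p\<close>, applied to \<open>x + y = l * (x / l) + (1 - l) * (y / (1 - l))\<close>.  Once it
  is integrated, the right choice of \<open>l\<close> gives Minkowski's inequality.\<close>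

lemma ennreal_powr_add_le:
  assumes p: "1 \<le> p" and l: "0 < l" "l < 1"
  shows "ennreal_powr (x + y) p
    \<le> ennreal (l powr (1 - p)) * ennreal_powr x p + ennreal ((1 - l) powr (1 - p)) * ennreal_powr y p"
proof (cases "x = \<infinity> \<or> y = \<infinity>")
  case True
  then show ?thesis using l by (auto simp: ennreal_powr_def ennreal_mult_top)
next
  case False
  then obtain a b where ab: "x = ennreal a" "y = ennreal b" "0 \<le> a" "0 \<le> b"
    by (cases x; cases y) auto
  have one: "1 \<le> t powr (1 - p)" if "0 < t" "t < 1" for t
    using powr_mono2'[of "1 - p" t 1] that p by simp
  have "(a + b) powr p \<le> l powr (1 - p) * a powr p + (1 - l) powr (1 - p) * b powr p"
  proof (cases "a = 0 \<or> b = 0")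
    case True
    then show ?thesis
      using mult_right_mono[OF one[of l], of "a powr p"] mult_right_mono[OF one[of "1 - l"], of "b powr p"] l p
      by auto
  next
    case False
    have "(l * (a / l) + (1 - l) * (b / (1 - l))) powr p \<le> l * (a / l) powr p + (1 - l) * (b / (1 - l)) powr p"
      using convex_onD[OF powr_convex[OF p], of "1 - l" "a / l" "b / (1 - l)"] l ab False by (simp add: algebra_simps)
    also have "l * (a / l) powr p = l powr (1 - p) * a powr p"
      using l ab by (simp add: powr_divide powr_diff)
    also have "(1 - l) * (b / (1 - l)) powr p = (1 - l) powr (1 - p) * b powr p"
      using l ab by (simp add: powr_divide powr_diff)
    finally show ?thesis using l by simp
  qed
  then show ?thesis
    using ab l by (simp add: ennreal_powr_ennreal flip: ennreal_plus ennreal_mult'' )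
qed

text \<open>A norm on functions with values in $[0, \<infinity>]$, in the sense of Banach function spaces: a norm of a
  complex function is then the norm of its modulus.  Working with extended values makes countable
  sums of moduli available, and \<open>norm_SUP_le\<close> is the Fatou property that controls them.\<close>

locale function_seminorm =
  fixes M :: "real measure" and N :: "(real \<Rightarrow> ennreal) \<Rightarrow> ennreal"
  assumes norm_mono: "f \<in> borel_measurable M \<Longrightarrow> g \<in> borel_measurable M \<Longrightarrow>
      AE x in M. f x \<le> g x \<Longrightarrow> N f \<le> N g"
    and norm_cmult: "f \<in> borel_measurable M \<Longrightarrow> N (\<lambda>x. ennreal c * f x) = ennreal c * N f"
    and norm_triangle: "f \<in> borel_measurable M \<Longrightarrow> g \<in> borel_measurable M \<Longrightarrow>
      N (\<lambda>x. f x + g x) \<le> N f + N g"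
    and norm_SUP_le: "(\<And>n. h n \<in> borel_measurable M) \<Longrightarrow> incseq h \<Longrightarrow>
      N (\<lambda>x. SUP n::nat. h n x) \<le> (SUP n. N (h n))"

locale function_norm = function_seminorm +
  assumes norm_definite: "f \<in> borel_measurable M \<Longrightarrow> N f = 0 \<Longrightarrow> AE x in M. f x = 0"

context
  fixes p :: ennreal assumes p: "1 \<le> p" "p \<noteq> \<infinity>"
begin

lemma exponent: "1 \<le> enn2real p" "0 < recip p" "recip p = 1 / enn2real p"
proof -
  show *: "1 \<le> enn2real p"
    using p by (cases p) (auto simp: ennreal_ge_1)
  then show "recip p = 1 / enn2real p"
    using p by (cases p) (auto simp: recip_def inverse_ennreal inverse_eq_divide)
  then show "0 < recip p" using * by simp
qed

end

lemma Lp_norm_infinity: "Lp_norm M top_class.top g = esssup M g"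
  by (simp add: Lp_norm_def)

lemma Lp_norm_finite_le_iff:
  assumes "1 \<le> p" "p \<noteq> \<infinity>"
  shows "Lp_norm M p g \<le> c \<longleftrightarrow>
    (\<integral>\<^sup>+x. ennreal_powr (g x) (enn2real p) \<partial>M) \<le> ennreal_powr c (enn2real p)"
  using ennreal_powr_le_iff[of "recip p"] exponent[OF assms] assms by (simp add: Lp_norm_def)

lemma esssup_le_iff:
  fixes g :: "real \<Rightarrow> ennreal"
  assumes "g \<in> borel_measurable M"
  shows "esssup M g \<le> c \<longleftrightarrow> (AE x in M. g x \<le> c)"
  using esssup_AE[of g M] esssup_I[OF assms, of c] by (auto elim!: eventually_mono)

lemma Lp_norm_triangle:
  assumes p: "1 \<le> p" and [measurable]: "f \<in> borel_measurable M" "g \<in> borel_measurable M"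
  shows "Lp_norm M p (\<lambda>x. f x + g x) \<le> Lp_norm M p f + Lp_norm M p g"
proof (cases "p = \<infinity>")
  case True
  have "AE x in M. f x + g x \<le> esssup M f + esssup M g"
    using esssup_AE[of f M] esssup_AE[of g M] by (eventually_elim) (rule add_mono)
  then show ?thesis by (simp add: True Lp_norm_infinity esssup_le_iff)
next
  case False
  note e = exponent[OF p False]
  let ?p = "enn2real p" and ?I = "\<lambda>h. \<integral>\<^sup>+x. ennreal_powr (h x) (enn2real p) \<partial>M"
  have I: "?I h = ennreal_powr (Lp_norm M p h) ?p" for h
    using e False by (simp add: Lp_norm_def ennreal_powr_powr ennreal_powr_1)
  \<comment> \<open>Strictly positive upper bounds \<open>a\<close>, \<open>b\<close> replace the norms themselves, so that a vanishing norm
    needs no separate treatment.\<close>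
  have key: "Lp_norm M p (\<lambda>x. f x + g x) \<le> ennreal (a + b)"
    if a: "0 < a" "Lp_norm M p f \<le> ennreal a" and b: "0 < b" "Lp_norm M p g \<le> ennreal b" for a b
  proof -
    \<comment> \<open>the weight for which the two terms of the convexity bound become \<open>l\<close> and \<open>1 - l\<close> times \<open>(a + b) powr p\<close>\<close>
    define l where "l = a / (a + b)"
    have l: "0 < l" "l < 1" "1 - l = b / (a + b)"
      using a b by (auto simp: l_def field_simps)
    have "?I (\<lambda>x. f x + g x) \<le> (\<integral>\<^sup>+x. ennreal (l powr (1 - ?p)) * ennreal_powr (f x) ?p
        + ennreal ((1 - l) powr (1 - ?p)) * ennreal_powr (g x) ?p \<partial>M)"
      using e l by (intro nn_integral_mono ennreal_powr_add_le) auto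
    also have "\<dots> = ennreal (l powr (1 - ?p)) * ?I f + ennreal ((1 - l) powr (1 - ?p)) * ?I g"
      by (simp add: nn_integral_add nn_integral_cmult)
    also have "\<dots> \<le> ennreal (l powr (1 - ?p)) * ennreal (a powr ?p)
        + ennreal ((1 - l) powr (1 - ?p)) * ennreal (b powr ?p)"
      unfolding I using a b e ennreal_powr_mono[OF _ a(2), of ?p] ennreal_powr_mono[OF _ b(2), of ?p]
      by (intro add_mono mult_left_mono) (auto simp: ennreal_powr_ennreal)
    also have "\<dots> = ennreal (l powr (1 - ?p) * a powr ?p + (1 - l) powr (1 - ?p) * b powr ?p)"
      by (simp flip: ennreal_plus ennreal_mult'')
    also have "l powr (1 - ?p) * a powr ?p = l * (a + b) powr ?p"
      unfolding l_def using a b by (simp add: powr_divide powr_diff)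
    also have "(1 - l) powr (1 - ?p) * b powr ?p = (1 - l) * (a + b) powr ?p"
      unfolding l(3) using a b by (simp add: powr_divide powr_diff)
    also have "l * (a + b) powr ?p + (1 - l) * (a + b) powr ?p = (a + b) powr ?p"
      by (simp add: algebra_simps)
    finally show ?thesis
      using a b by (subst Lp_norm_finite_le_iff[OF p False])
        (simp add: ennreal_powr_ennreal del: ennreal_plus)
  qed
  show ?thesis
  proof (rule ennreal_le_epsilon)
    fix e :: real assume fin: "Lp_norm M p f + Lp_norm M p g < top_class.top" and e: "0 < e"
    then obtain a b where ab: "Lp_norm M p f = ennreal a" "Lp_norm M p g = ennreal b" "0 \<le> a" "0 \<le> b"
      by (cases "Lp_norm M p f"; cases "Lp_norm M p g") auto
    have "Lp_norm M p (\<lambda>x. f x + g x) \<le> ennreal ((a + e / 2) + (b + e / 2))"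
      using ab e by (intro key) (auto intro!: ennreal_leI)
    also have "\<dots> = Lp_norm M p f + Lp_norm M p g + ennreal e"
      using ab e by (simp flip: ennreal_plus add: algebra_simps)
    finally show "Lp_norm M p (\<lambda>x. f x + g x) \<le> Lp_norm M p f + Lp_norm M p g + ennreal e" .
  qed
qed

lemma Lp_norm_mono_AE:
  assumes p: "1 \<le> p" and f: "f \<in> borel_measurable M" and le: "AE x in M. f x \<le> g x"
  shows "Lp_norm M p f \<le> Lp_norm M p g"
proof (cases "p = \<infinity>")
  case True then show ?thesis using esssup_AE_mono[OF f le] by (simp add: Lp_norm_infinity)
next
  case False
  show ?thesis
    using False exponent[OF p False] le
    by (auto simp: Lp_norm_def intro!: ennreal_powr_mono nn_integral_mono_AE elim!: eventually_mono)
qed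

lemma Lp_norm_cmult:
  assumes p: "1 \<le> p" and [measurable]: "f \<in> borel_measurable M"
  shows "Lp_norm M p (\<lambda>x. ennreal c * f x) = ennreal c * Lp_norm M p f"
proof (cases "p = \<infinity>")
  case True
  have 0: "esssup M (\<lambda>x. 0) = (0::ennreal)"
    using esssup_le_iff[of "\<lambda>x. 0" M 0] by simp
  have le: "esssup M (\<lambda>x. ennreal c * f x) \<le> ennreal c * esssup M f" for c and f :: "real \<Rightarrow> ennreal"
    using esssup_AE[of f M]
    by (cases "f \<in> borel_measurable M")
      (auto simp: esssup_le_iff esssup_non_measurable ennreal_mult_top 0 ennreal_neg elim!: eventually_mono intro!: mult_left_mono)
  show ?thesis
  proof (cases "0 < c")
    case c: True
    have "ennreal c * esssup M f = ennreal c * esssup M (\<lambda>x. ennreal (1 / c) * (ennreal c * f x))"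
      using c by (simp flip: ennreal_mult'' mult.assoc)
    also have "\<dots> \<le> ennreal c * (ennreal (1 / c) * esssup M (\<lambda>x. ennreal c * f x))"
      by (intro mult_left_mono le) auto
    also have "\<dots> = esssup M (\<lambda>x. ennreal c * f x)"
      using c by (simp flip: ennreal_mult'' mult.assoc)
    finally show ?thesis using le by (simp add: True Lp_norm_infinity antisym)
  qed (simp add: True Lp_norm_infinity 0 ennreal_neg)
next
  case False
  then show ?thesis
    using exponent[OF p False]
    by (simp add: Lp_norm_def ennreal_powr_mult nn_integral_cmult ennreal_powr_powr ennreal_powr_1)
qed

lemma Lp_norm_SUP:
  assumes p: "1 \<le> p" and [measurable]: "\<And>n::nat. h n \<in> borel_measurable M" and inc: "incseq h"
  shows "Lp_norm M p (\<lambda>x. SUP n. h n x) = (SUP n. Lp_norm M p (h n))"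
proof (rule antisym)
  show "(SUP n. Lp_norm M p (h n)) \<le> Lp_norm M p (\<lambda>x. SUP n. h n x)"
    using p by (intro SUP_least Lp_norm_mono_AE) (auto intro!: SUP_upper AE_I2)
  show "Lp_norm M p (\<lambda>x. SUP n. h n x) \<le> (SUP n. Lp_norm M p (h n))"
  proof (cases "p = \<infinity>")
    case True
    have "AE x in M. \<forall>n. h n x \<le> esssup M (h n)"
      by (subst AE_all_countable) (auto intro: esssup_AE)
    then have "AE x in M. (SUP n. h n x) \<le> (SUP n. esssup M (h n))"
      by (eventually_elim) (auto intro!: SUP_mono)
    then show ?thesis by (simp add: True Lp_norm_infinity esssup_le_iff)
  next
    case False
    note e = exponent[OF p False]
    have "(\<integral>\<^sup>+x. ennreal_powr (SUP n. h n x) (enn2real p) \<partial>M) =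
        (\<integral>\<^sup>+x. (SUP n. ennreal_powr (h n x) (enn2real p)) \<partial>M)"
      using e by (simp add: ennreal_powr_SUP)
    also have "\<dots> = (SUP n. \<integral>\<^sup>+x. ennreal_powr (h n x) (enn2real p) \<partial>M)"
      using inc e by (intro nn_integral_monotone_convergence_SUP)
        (auto simp: incseq_def le_fun_def intro!: ennreal_powr_mono)
    finally show ?thesis
      using e False by (simp add: Lp_norm_def ennreal_powr_SUP)
  qed
qed

lemma Lp_norm_eq_0_iff:
  assumes p: "1 \<le> p" and [measurable]: "f \<in> borel_measurable M"
  shows "Lp_norm M p f = 0 \<longleftrightarrow> (AE x in M. f x = 0)"
proof (cases "p = \<infinity>")
  case True then show ?thesis using esssup_le_iff[of f M 0] by (simp add: Lp_norm_infinity)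
next
  case False
  then show ?thesis
    using exponent[OF p False]
    by (auto simp: Lp_norm_def ennreal_powr_eq_0_iff nn_integral_0_iff_AE)
qed

lemma function_norm_Lp_norm:
  assumes "1 \<le> p" shows "function_norm M (Lp_norm M p)"
proof
  show "Lp_norm M p (\<lambda>x. SUP n. h n x) \<le> (SUP n. Lp_norm M p (h n))"
    if "\<And>n. h n \<in> borel_measurable M" "incseq h" for h :: "nat \<Rightarrow> real \<Rightarrow> ennreal"
    using Lp_norm_SUP[OF assms that] by simp
qed (use assms in \<open>auto intro: Lp_norm_mono_AE Lp_norm_triangle Lp_norm_cmult simp: Lp_norm_eq_0_iff\<close>)

section \<open>Completeness of function norms\<close>

context function_seminorm
begin

lemma norm_cong_AE:
  assumes "f \<in> borel_measurable M" "g \<in> borel_measurable M" "AE x in M. f x = g x"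
  shows "N f = N g"
  using assms by (intro antisym norm_mono) (auto elim: eventually_mono)

lemma norm_0: "N (\<lambda>x. 0) = 0"
  using norm_cmult[of "\<lambda>x. 0" 0] by simp

text \<open>Apply \<open>norm_SUP_le\<close> to the increasing sequence of the infima of the tails.\<close>

lemma norm_Fatou:
  assumes [measurable]: "\<And>n::nat. h n \<in> borel_measurable M" "g \<in> borel_measurable M"
    and le: "AE x in M. g x \<le> liminf (\<lambda>n. h n x)" and bd: "\<And>n. n0 \<le> n \<Longrightarrow> N (h n) \<le> c"
  shows "N g \<le> c"
proof -
  define i where "i n x = (INF m\<in>{n..}. h m x)" for n x
  have [measurable]: "i n \<in> borel_measurable M" for n unfolding i_def by measurable
  have "N g \<le> N (\<lambda>x. SUP n. i n x)"
    using le by (intro norm_mono) (auto simp: i_def liminf_SUP_INF)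
  also have "\<dots> \<le> (SUP n. N (i n))"
    by (intro norm_SUP_le) (auto simp: incseq_def le_fun_def i_def intro!: INF_superset_mono)
  also have "\<dots> \<le> c"
  proof (rule SUP_least)
    fix n
    have "N (i n) \<le> N (h (max n n0))"
      by (intro norm_mono AE_I2) (auto simp: i_def intro: INF_lower)
    also have "\<dots> \<le> c" by (intro bd) simp
    finally show "N (i n) \<le> c" .
  qed
  finally show ?thesis .
qed

lemma norm_sum:
  assumes "finite I" "\<And>i. i \<in> I \<Longrightarrow> h i \<in> borel_measurable M"
  shows "N (\<lambda>x. \<Sum>i\<in>I. h i x) \<le> (\<Sum>i\<in>I. N (h i))"
  using assms
proof (induction I rule: finite_induct)
  case (insert i I)
  then have "N (\<lambda>x. h i x + (\<Sum>i\<in>I. h i x)) \<le> N (h i) + N (\<lambda>x. \<Sum>i\<in>I. h i x)"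
    by (intro norm_triangle) auto
  also have "\<dots> \<le> N (h i) + (\<Sum>i\<in>I. N (h i))"
    using insert by (intro add_left_mono) auto
  finally show ?case using insert by simp
qed (simp add: norm_0)

definition cnorm :: "(real \<Rightarrow> complex) \<Rightarrow> ennreal" where
  "cnorm f = N (\<lambda>x. ennreal (cmod (f x)))"

lemma cnorm_cong_AE:
  assumes [measurable]: "f \<in> borel_measurable M" "g \<in> borel_measurable M" and "AE x in M. f x = g x"
  shows "cnorm f = cnorm g"
  unfolding cnorm_def using assms by (intro norm_cong_AE) auto

lemma cnorm_cmult:
  assumes [measurable]: "f \<in> borel_measurable M"
  shows "cnorm (\<lambda>x. c * f x) = ennreal (cmod c) * cnorm f"
  unfolding cnorm_def by (subst norm_cmult[symmetric]) (auto simp: norm_mult ennreal_mult'')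

lemma cnorm_triangle:
  assumes [measurable]: "f \<in> borel_measurable M" "g \<in> borel_measurable M"
  shows "cnorm (\<lambda>x. f x + g x) \<le> cnorm f + cnorm g"
proof -
  have "cnorm (\<lambda>x. f x + g x) \<le> N (\<lambda>x. ennreal (cmod (f x)) + ennreal (cmod (g x)))"
    unfolding cnorm_def
    by (intro norm_mono AE_I2) (auto simp: norm_triangle_ineq simp flip: ennreal_plus intro!: ennreal_leI)
  also have "\<dots> \<le> cnorm f + cnorm g" unfolding cnorm_def by (intro norm_triangle) auto
  finally show ?thesis .
qed

lemma cnorm_triangle_diff:
  assumes [measurable]: "f \<in> borel_measurable M" "g \<in> borel_measurable M"
  shows "cnorm f \<le> cnorm (\<lambda>x. f x - g x) + cnorm g"
  using cnorm_triangle[of "\<lambda>x. f x - g x" g] by simp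

lemma cnorm_minus_commute: "cnorm (\<lambda>x. f x - g x) = cnorm (\<lambda>x. g x - f x)"
  by (simp add: cnorm_def norm_minus_commute)

lemma cnorm_0: "cnorm (\<lambda>x. 0) = 0"
  by (simp add: cnorm_def norm_0)

end

context function_norm
begin

lemma cnorm_eq_0_iff:
  assumes [measurable]: "f \<in> borel_measurable M"
  shows "cnorm f = 0 \<longleftrightarrow> (AE x in M. f x = 0)"
proof
  assume "cnorm f = 0"
  then show "AE x in M. f x = 0"
    using norm_definite[of "\<lambda>x. ennreal (cmod (f x))"] by (simp add: cnorm_def)
next
  assume "AE x in M. f x = 0"
  then show "cnorm f = 0"
    using cnorm_cong_AE[of f "\<lambda>x. 0"] by (simp add: cnorm_0)
qed

text \<open>Every multiple of the indicator of \<open>{x. f x = \<infinity>}\<close> lies below \<open>f\<close>, so this indicator has norm \<open>0\<close>.\<close>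

lemma norm_finite_imp_AE_finite:
  assumes [measurable]: "f \<in> borel_measurable M" and fin: "N f < \<infinity>"
  shows "AE x in M. f x < \<infinity>"
proof -
  let ?S = "\<lambda>x. if f x = \<infinity> then 1 else 0 :: ennreal"
  have [measurable]: "?S \<in> borel_measurable M" by measurable
  have le: "ennreal (real n) * N ?S \<le> N f" for n
    by (subst norm_cmult[symmetric]) (auto intro!: norm_mono)
  obtain c where c: "N f = ennreal c" "0 \<le> c" using fin by (cases "N f") auto
  have "N ?S = 0"
  proof (rule ccontr)
    assume nz: "N ?S \<noteq> 0"
    have "N ?S < \<infinity>" using le[of 1] fin by simp
    with nz obtain s where s: "N ?S = ennreal s" "0 < s" by (cases "N ?S") auto
    obtain n :: nat where "c < real n * s" using reals_Archimedean3[OF s(2)] by blast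
    with le[of n] s c show False by (simp flip: ennreal_mult'' add: ennreal_le_iff)
  qed
  then have "AE x in M. ?S x = 0" by (intro norm_definite) auto
  then show ?thesis by eventually_elim (auto simp: less_top split: if_splits)
qed

text \<open>The Riesz--Fischer argument: along a subsequence with geometrically decaying increments the
  sum of the increments has finite norm, so it is finite almost everywhere and the subsequence
  converges pointwise; Fatou's lemma turns this into convergence in norm.\<close>

lemma Riesz_Fischer:
  fixes f :: "nat \<Rightarrow> real \<Rightarrow> complex"
  assumes [measurable]: "\<And>n. f n \<in> borel_measurable M"
    and Cauchy: "\<And>e::real. 0 < e \<Longrightarrow> \<exists>n0. \<forall>m\<ge>n0. \<forall>n\<ge>n0. cnorm (\<lambda>x. f m x - f n x) < ennreal e"
  obtains g where "g \<in> borel_measurable M" "(\<lambda>n. cnorm (\<lambda>x. f n x - g x)) \<longlonglongrightarrow> 0"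
proof -
  have "\<exists>s. \<forall>j. (\<forall>m\<ge>s j. \<forall>n\<ge>s j. cnorm (\<lambda>x. f m x - f n x) < ennreal ((1/2)^j)) \<and> s j < s (Suc j)"
  proof (rule dependent_nat_choice)
    show "\<exists>n0. \<forall>m\<ge>n0. \<forall>n\<ge>n0. cnorm (\<lambda>x. f m x - f n x) < ennreal ((1/2)^0)"
      by (rule Cauchy) simp
    fix k j
    obtain n0 where "\<forall>m\<ge>n0. \<forall>n\<ge>n0. cnorm (\<lambda>x. f m x - f n x) < ennreal ((1/2)^Suc j)"
      using Cauchy[of "(1/2)^Suc j"] by auto
    then show "\<exists>n0. (\<forall>m\<ge>n0. \<forall>n\<ge>n0. cnorm (\<lambda>x. f m x - f n x) < ennreal ((1/2)^Suc j)) \<and> k < n0"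
      by (intro exI[of _ "max n0 (Suc k)"]) auto
  qed
  then obtain s where s: "\<And>j m n. s j \<le> m \<Longrightarrow> s j \<le> n \<Longrightarrow> cnorm (\<lambda>x. f m x - f n x) < ennreal ((1/2)^j)"
    and s_less: "\<And>j. s j < s (Suc j)" by blast
  have mono: "strict_mono s" using s_less by (simp add: strict_mono_Suc_iff)
  define D where "D J x = (\<Sum>j<J. ennreal (cmod (f (s (Suc j)) x - f (s j) x)))" for J x
  have D[measurable]: "D J \<in> borel_measurable M" for J unfolding D_def by measurable
  have "N (D J) \<le> 2" for J
  proof -
    have "N (D J) \<le> (\<Sum>j<J. cnorm (\<lambda>x. f (s (Suc j)) x - f (s j) x))"
      unfolding D_def cnorm_def by (intro norm_sum) auto
    also have "\<dots> \<le> (\<Sum>j<J. ennreal ((1/2)^j))"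
      using s_less by (intro sum_mono less_imp_le[OF s]) (auto intro: less_imp_le)
    also have "\<dots> = ennreal (\<Sum>j<J. (1/2)^j)" by simp
    also have "(\<Sum>j<J. (1/2)^j) \<le> (2::real)"
      by (subst geometric_sum) (auto simp: field_simps)
    finally show ?thesis by (simp add: ennreal_leI)
  qed
  moreover have "N (\<lambda>x. SUP J. D J x) \<le> (SUP J. N (D J))"
    by (intro norm_SUP_le D) (auto simp: D_def incseq_def le_fun_def simp del: sum_ennreal intro!: sum_mono2)
  ultimately have "N (\<lambda>x. SUP J. D J x) \<le> 2"
    by (meson SUP_least order_trans)
  then have "N (\<lambda>x. SUP J. D J x) < \<infinity>"
    by (rule le_less_trans) simp
  then have "AE x in M. (SUP J. D J x) < \<infinity>"
    by (intro norm_finite_imp_AE_finite) measurable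
  then have conv: "AE x in M. convergent (\<lambda>j. f (s j) x)"
  proof eventually_elim
    fix x assume "(SUP J. D J x) < \<infinity>"
    moreover have "(SUP J. D J x) = (\<Sum>j. ennreal (cmod (f (s (Suc j)) x - f (s j) x)))"
      unfolding D_def by (rule suminf_eq_SUP[symmetric])
    ultimately have "summable (\<lambda>j. cmod (f (s (Suc j)) x - f (s j) x))"
      by (intro summable_suminf_not_top) auto
    then have "summable (\<lambda>j. f (s (Suc j)) x - f (s j) x)"
      by (rule summable_norm_cancel)
    then have "convergent (\<lambda>J. (\<Sum>j<J. f (s (Suc j)) x - f (s j) x) + f (s 0) x)"
      by (intro convergent_add convergent_const) (simp add: summable_iff_convergent)
    then show "convergent (\<lambda>j. f (s j) x)"
      by (simp add: sum_lessThan_telescope[of "\<lambda>j. f (s j) x"])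
  qed
  define g where "g x = lim (\<lambda>j. f (s j) x)" for x
  have [measurable]: "g \<in> borel_measurable M" unfolding g_def by measurable
  have bound: "cnorm (\<lambda>x. f n x - g x) \<le> ennreal ((1/2)^j)" if n: "s j \<le> n" for n j
    unfolding cnorm_def
  proof (rule norm_Fatou[where h = "\<lambda>i x. ennreal (cmod (f n x - f (s i) x))" and ?n0.0 = j])
    show "AE x in M. ennreal (cmod (f n x - g x)) \<le> liminf (\<lambda>i. ennreal (cmod (f n x - f (s i) x)))"
      using conv
    proof eventually_elim
      fix x assume "convergent (\<lambda>j. f (s j) x)"
      then have "(\<lambda>j. f (s j) x) \<longlonglongrightarrow> g x" by (simp add: g_def convergent_LIMSEQ_iff)
      then have "(\<lambda>i. ennreal (cmod (f n x - f (s i) x))) \<longlonglongrightarrow> ennreal (cmod (f n x - g x))"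
        by (intro tendsto_intros)
      then have "liminf (\<lambda>i. ennreal (cmod (f n x - f (s i) x))) = ennreal (cmod (f n x - g x))"
        by (intro lim_imp_Liminf) auto
      then show "ennreal (cmod (f n x - g x)) \<le> liminf (\<lambda>i. ennreal (cmod (f n x - f (s i) x)))"
        by simp
    qed
    fix i assume "j \<le> i"
    then have "s j \<le> s i" using mono by (simp add: strict_mono_less_eq)
    then show "N (\<lambda>x. ennreal (cmod (f n x - f (s i) x))) \<le> ennreal ((1/2)^j)"
      using s[OF n, of "s i"] by (simp add: cnorm_def)
  qed auto
  have "(\<lambda>n. cnorm (\<lambda>x. f n x - g x)) \<longlonglongrightarrow> 0"
  proof (rule order_tendstoI)
    fix e :: ennreal assume e: "0 < e"
    have "(\<lambda>j. ennreal ((1/2)^j)) \<longlonglongrightarrow> ennreal 0"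
      by (intro tendsto_ennrealI LIMSEQ_power_zero) auto
    then have "eventually (\<lambda>j. ennreal ((1/2)^j) < e) sequentially"
      using e by (intro order_tendstoD(2)[where y = 0]) auto
    then obtain j where j: "ennreal ((1/2)^j) < e" by (auto simp: eventually_sequentially)
    show "eventually (\<lambda>n. cnorm (\<lambda>x. f n x - g x) < e) sequentially"
      unfolding eventually_sequentially
    proof (intro exI allI impI)
      fix n assume "s j \<le> n"
      from bound[OF this] j show "cnorm (\<lambda>x. f n x - g x) < e" by (rule le_less_trans)
    qed
  qed simp
  then show thesis using that[of g] by auto
qed

end

lemma ae_class_refl: "f \<in> borel_measurable M \<Longrightarrow> f \<in> ae_class M f"
  by (simp add: ae_class_def)

lemma rep_in: "F \<in> L0 M \<Longrightarrow> rep F \<in> F"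
  unfolding rep_def L0_def by (metis (no_types, lifting) ae_class_refl imageE someI)

lemma rep_measurable: "F \<in> L0 M \<Longrightarrow> rep F \<in> borel_measurable M"
  using rep_in[of F M] by (auto simp: L0_def ae_class_def)

lemma ae_class_in_L0: "f \<in> borel_measurable M \<Longrightarrow> ae_class M f \<in> L0 M"
  by (simp add: L0_def)

lemma rep_ae_class: "f \<in> borel_measurable M \<Longrightarrow> AE x in M. rep (ae_class M f) x = f x"
  using rep_in[OF ae_class_in_L0] by (force simp: ae_class_def)

lemma ae_class_eq_iff:
  assumes "f \<in> borel_measurable M" "g \<in> borel_measurable M"
  shows "ae_class M f = ae_class M g \<longleftrightarrow> (AE x in M. f x = g x)"
proof
  assume "ae_class M f = ae_class M g"
  then show "AE x in M. f x = g x" using ae_class_refl[OF assms(1)] by (simp add: ae_class_def)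
next
  assume *: "AE x in M. f x = g x"
  have "(AE x in M. h x = f x) \<longleftrightarrow> (AE x in M. h x = g x)" for h
    using * by (auto elim: eventually_elim2)
  then show "ae_class M f = ae_class M g" by (auto simp: ae_class_def)
qed

lemma ae_class_rep:
  assumes "F \<in> L0 M" shows "ae_class M (rep F) = F"
proof -
  obtain f where f: "f \<in> borel_measurable M" "F = ae_class M f" using assms by (auto simp: L0_def)
  then show ?thesis
    using rep_ae_class[OF f(1)] rep_measurable[OF assms] by (simp add: ae_class_eq_iff)
qed

text \<open>The module \<^const>\<open>fofana_space\<close> with an arbitrary norm in place of the Fofana norm.\<close>

definition norm_class_space ::
  "real measure \<Rightarrow> ((real \<Rightarrow> complex) \<Rightarrow> ennreal) \<Rightarrow> (complex, (real \<Rightarrow> complex) set) module" where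
  "norm_class_space M n =
     \<lparr>carrier = {F \<in> L0 M. n (rep F) < \<infinity>}, mult = undefined, one = undefined,
      zero = ae_class M (\<lambda>x. 0),
      add = (\<lambda>F G. ae_class M (\<lambda>x. rep F x + rep G x)),
      smult = (\<lambda>c F. ae_class M (\<lambda>x. c * rep F x))\<rparr>"

lemma cring_complex_ring: "cring complex_ring"
proof (rule cringI)
  show "abelian_group complex_ring"
    by (rule abelian_groupI) (auto simp: complex_ring_def intro: exI[of _ "- _"] left_minus)
  show "comm_monoid complex_ring"
    by (rule comm_monoidI) (auto simp: complex_ring_def)
qed (auto simp: complex_ring_def algebra_simps)

context function_norm
begin

abbreviation "V \<equiv> norm_class_space M cnorm"

lemma carrierD: "F \<in> carrier V \<Longrightarrow> F \<in> L0 M" "F \<in> carrier V \<Longrightarrow> cnorm (rep F) < \<infinity>"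
  by (auto simp: norm_class_space_def)

lemma rep_meas [measurable]: "F \<in> carrier V \<Longrightarrow> rep F \<in> borel_measurable M"
  by (rule rep_measurable[OF carrierD(1)])

lemma ae_class_carrier:
  assumes f: "f \<in> borel_measurable M" and "cnorm f < \<infinity>"
  shows "ae_class M f \<in> carrier V"
  using assms cnorm_cong_AE[OF rep_measurable[OF ae_class_in_L0] f rep_ae_class]
  by (auto simp: norm_class_space_def ae_class_in_L0)

lemma carrier_add:
  assumes F: "F \<in> carrier V" and G: "G \<in> carrier V"
  shows "F \<oplus>\<^bsub>V\<^esub> G = ae_class M (\<lambda>x. rep F x + rep G x)" "F \<oplus>\<^bsub>V\<^esub> G \<in> carrier V"
    "AE x in M. rep (F \<oplus>\<^bsub>V\<^esub> G) x = rep F x + rep G x"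
proof -
  note [measurable] = rep_meas[OF F] rep_meas[OF G]
  show eq: "F \<oplus>\<^bsub>V\<^esub> G = ae_class M (\<lambda>x. rep F x + rep G x)" by (simp add: norm_class_space_def)
  have "cnorm (\<lambda>x. rep F x + rep G x) < \<infinity>"
    using le_less_trans[OF cnorm_triangle[of "rep F" "rep G"]] carrierD(2)[OF F] carrierD(2)[OF G]
    by simp
  then show "F \<oplus>\<^bsub>V\<^esub> G \<in> carrier V" unfolding eq by (intro ae_class_carrier) auto
  show "AE x in M. rep (F \<oplus>\<^bsub>V\<^esub> G) x = rep F x + rep G x"
    unfolding eq by (rule rep_ae_class) measurable
qed

lemma carrier_smult:
  assumes F: "F \<in> carrier V"
  shows "c \<odot>\<^bsub>V\<^esub> F = ae_class M (\<lambda>x. c * rep F x)" "c \<odot>\<^bsub>V\<^esub> F \<in> carrier V"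
    "AE x in M. rep (c \<odot>\<^bsub>V\<^esub> F) x = c * rep F x"
proof -
  note [measurable] = rep_meas[OF F]
  show eq: "c \<odot>\<^bsub>V\<^esub> F = ae_class M (\<lambda>x. c * rep F x)" by (simp add: norm_class_space_def)
  have "cnorm (\<lambda>x. c * rep F x) < \<infinity>"
    using carrierD(2)[OF F] by (simp add: cnorm_cmult ennreal_mult_less_top)
  then show "c \<odot>\<^bsub>V\<^esub> F \<in> carrier V" unfolding eq by (intro ae_class_carrier) auto
  show "AE x in M. rep (c \<odot>\<^bsub>V\<^esub> F) x = c * rep F x"
    unfolding eq by (rule rep_ae_class) measurable
qed

lemma carrier_zero: "\<zero>\<^bsub>V\<^esub> \<in> carrier V" "AE x in M. rep \<zero>\<^bsub>V\<^esub> x = 0"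
proof -
  have eq: "\<zero>\<^bsub>V\<^esub> = ae_class M (\<lambda>x. 0)" by (simp add: norm_class_space_def)
  show "\<zero>\<^bsub>V\<^esub> \<in> carrier V" unfolding eq by (intro ae_class_carrier) (auto simp: cnorm_0)
  show "AE x in M. rep \<zero>\<^bsub>V\<^esub> x = 0" unfolding eq by (rule rep_ae_class) measurable
qed

lemma carrier_eqI:
  assumes "F \<in> carrier V" "G \<in> carrier V" "AE x in M. rep F x = rep G x"
  shows "F = G"
  using ae_class_eq_iff[OF rep_meas rep_meas] assms carrierD(1) by (metis ae_class_rep)

lemma abelian_group_V: "abelian_group V"
proof (rule abelian_groupI)
  fix F G H assume FGH: "F \<in> carrier V" "G \<in> carrier V" "H \<in> carrier V"
  show "(F \<oplus>\<^bsub>V\<^esub> G) \<oplus>\<^bsub>V\<^esub> H = F \<oplus>\<^bsub>V\<^esub> (G \<oplus>\<^bsub>V\<^esub> H)"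
  proof (rule carrier_eqI)
    show "AE x in M. rep ((F \<oplus>\<^bsub>V\<^esub> G) \<oplus>\<^bsub>V\<^esub> H) x = rep (F \<oplus>\<^bsub>V\<^esub> (G \<oplus>\<^bsub>V\<^esub> H)) x"
      using carrier_add(3)[OF carrier_add(2)[OF FGH(1,2)] FGH(3)] carrier_add(3)[OF FGH(1,2)]
        carrier_add(3)[OF FGH(1) carrier_add(2)[OF FGH(2,3)]] carrier_add(3)[OF FGH(2,3)]
      by eventually_elim simp
  qed (intro carrier_add FGH)+
next
  fix F G assume FG: "F \<in> carrier V" "G \<in> carrier V"
  show "F \<oplus>\<^bsub>V\<^esub> G \<in> carrier V" by (intro carrier_add FG)
  show "F \<oplus>\<^bsub>V\<^esub> G = G \<oplus>\<^bsub>V\<^esub> F" by (simp add: norm_class_space_def add.commute)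
next
  show "\<zero>\<^bsub>V\<^esub> \<in> carrier V" by (rule carrier_zero)
next
  fix F assume F: "F \<in> carrier V"
  show "\<zero>\<^bsub>V\<^esub> \<oplus>\<^bsub>V\<^esub> F = F"
  proof (rule carrier_eqI)
    show "AE x in M. rep (\<zero>\<^bsub>V\<^esub> \<oplus>\<^bsub>V\<^esub> F) x = rep F x"
      using carrier_add(3)[OF carrier_zero(1) F] carrier_zero(2) by eventually_elim simp
  qed (intro carrier_add carrier_zero F)+
  show "\<exists>G\<in>carrier V. G \<oplus>\<^bsub>V\<^esub> F = \<zero>\<^bsub>V\<^esub>"
  proof
    show m: "(-1) \<odot>\<^bsub>V\<^esub> F \<in> carrier V" by (rule carrier_smult(2)[OF F])
    show "((-1) \<odot>\<^bsub>V\<^esub> F) \<oplus>\<^bsub>V\<^esub> F = \<zero>\<^bsub>V\<^esub>"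
    proof (rule carrier_eqI)
      show "AE x in M. rep (((-1) \<odot>\<^bsub>V\<^esub> F) \<oplus>\<^bsub>V\<^esub> F) x = rep \<zero>\<^bsub>V\<^esub> x"
        using carrier_add(3)[OF m F] carrier_smult(3)[OF F, of "-1"] carrier_zero(2)
        by eventually_elim simp
    qed (intro carrier_add carrier_zero m F)+
  qed
qed

text \<open>Subtraction in \<open>V\<close> is defined through the abstract inverse of the group; adding \<open>G\<close> back
  identifies its representative.\<close>

lemma rep_minus:
  assumes F: "F \<in> carrier V" and G: "G \<in> carrier V"
  shows "AE x in M. rep (F \<ominus>\<^bsub>V\<^esub> G) x = rep F x - rep G x"
proof -
  interpret abelian_group V by (rule abelian_group_V)
  have "AE x in M. rep ((F \<ominus>\<^bsub>V\<^esub> G) \<oplus>\<^bsub>V\<^esub> G) x = rep (F \<ominus>\<^bsub>V\<^esub> G) x + rep G x"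
    by (intro carrier_add) (use F G in auto)
  moreover have "(F \<ominus>\<^bsub>V\<^esub> G) \<oplus>\<^bsub>V\<^esub> G = F"
    using F G by (simp add: a_minus_def a_assoc l_neg)
  ultimately show ?thesis by (auto elim: eventually_mono)
qed

lemma module_V: "module complex_ring V"
proof (rule moduleI)
  fix a b :: complex and F G assume F: "F \<in> carrier V"
  have R: "a \<oplus>\<^bsub>complex_ring\<^esub> b = a + b" "a \<otimes>\<^bsub>complex_ring\<^esub> b = a * b" "\<one>\<^bsub>complex_ring\<^esub> = 1"
    by (auto simp: complex_ring_def)
  note S = carrier_smult(3)[OF F] carrier_smult(2)[OF F]
  show "a \<odot>\<^bsub>V\<^esub> F \<in> carrier V" by (rule S)
  show "(a \<oplus>\<^bsub>complex_ring\<^esub> b) \<odot>\<^bsub>V\<^esub> F = a \<odot>\<^bsub>V\<^esub> F \<oplus>\<^bsub>V\<^esub> b \<odot>\<^bsub>V\<^esub> F"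
    unfolding R
  proof (rule carrier_eqI)
    show "AE x in M. rep ((a + b) \<odot>\<^bsub>V\<^esub> F) x = rep (a \<odot>\<^bsub>V\<^esub> F \<oplus>\<^bsub>V\<^esub> b \<odot>\<^bsub>V\<^esub> F) x"
      using S(1)[of "a + b"] S(1)[of a] S(1)[of b] carrier_add(3)[OF S(2,2), of a b]
      by eventually_elim (simp add: algebra_simps)
  qed (intro carrier_add S)+
  show "(a \<otimes>\<^bsub>complex_ring\<^esub> b) \<odot>\<^bsub>V\<^esub> F = a \<odot>\<^bsub>V\<^esub> (b \<odot>\<^bsub>V\<^esub> F)"
    unfolding R
  proof (rule carrier_eqI)
    show "AE x in M. rep ((a * b) \<odot>\<^bsub>V\<^esub> F) x = rep (a \<odot>\<^bsub>V\<^esub> (b \<odot>\<^bsub>V\<^esub> F)) x"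
      using S(1)[of "a * b"] S(1)[of b] carrier_smult(3)[OF S(2)[of b], of a]
      by eventually_elim simp
  qed (intro carrier_smult S)+
  show "\<one>\<^bsub>complex_ring\<^esub> \<odot>\<^bsub>V\<^esub> F = F"
    unfolding R
  proof (rule carrier_eqI)
    show "AE x in M. rep (1 \<odot>\<^bsub>V\<^esub> F) x = rep F x" using S(1)[of 1] by eventually_elim simp
  qed (intro S F)+
  assume G: "G \<in> carrier V"
  show "a \<odot>\<^bsub>V\<^esub> (F \<oplus>\<^bsub>V\<^esub> G) = a \<odot>\<^bsub>V\<^esub> F \<oplus>\<^bsub>V\<^esub> a \<odot>\<^bsub>V\<^esub> G"
  proof (rule carrier_eqI)
    show "AE x in M. rep (a \<odot>\<^bsub>V\<^esub> (F \<oplus>\<^bsub>V\<^esub> G)) x = rep (a \<odot>\<^bsub>V\<^esub> F \<oplus>\<^bsub>V\<^esub> a \<odot>\<^bsub>V\<^esub> G) x"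
      using carrier_smult(3)[OF carrier_add(2)[OF F G], of a] carrier_add(3)[OF F G] S(1)[of a]
        carrier_smult(3)[OF G, of a] carrier_add(3)[OF S(2) carrier_smult(2)[OF G], of a a]
      by eventually_elim (simp add: algebra_simps)
  qed (intro carrier_smult carrier_add F G)+
qed (auto intro: cring_complex_ring abelian_group_V)

lemma cnorm_rep_minus:
  assumes "F \<in> carrier V" "G \<in> carrier V"
  shows "cnorm (rep (F \<ominus>\<^bsub>V\<^esub> G)) = cnorm (\<lambda>x. rep F x - rep G x)"
proof -
  interpret abelian_group V by (rule abelian_group_V)
  have "F \<ominus>\<^bsub>V\<^esub> G \<in> carrier V" using assms by simp
  note [measurable] = rep_meas[OF this] rep_meas[OF assms(1)] rep_meas[OF assms(2)]
  show ?thesis by (intro cnorm_cong_AE rep_minus assms) auto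
qed

text \<open>A Cauchy sequence of classes has a limit by \<open>Riesz_Fischer\<close> applied to representatives; the limit
  has finite norm because it is at finite distance from a member of the sequence.\<close>

theorem complex_banach_space_V: "complex_banach_space V (\<lambda>F. enn2real (cnorm (rep F)))"
proof -
  interpret abelian_group V by (rule abelian_group_V)
  let ?n = "\<lambda>F. enn2real (cnorm (rep F))"
  let ?d = "\<lambda>u v. if u \<in> carrier V \<and> v \<in> carrier V then ?n (u \<ominus>\<^bsub>V\<^esub> v) else 0"
  have n0: "?n F = 0 \<longleftrightarrow> F = \<zero>\<^bsub>V\<^esub>" if F: "F \<in> carrier V" for F
  proof -
    note [measurable] = rep_meas[OF F]
    have "?n F = 0 \<longleftrightarrow> cnorm (rep F) = 0"
      using carrierD(2)[OF F] by (auto simp: enn2real_eq_0_iff)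
    also have "\<dots> \<longleftrightarrow> (AE x in M. rep F x = rep \<zero>\<^bsub>V\<^esub> x)"
      using carrier_zero(2) by (subst cnorm_eq_0_iff) (auto elim: eventually_elim2)
    also have "\<dots> \<longleftrightarrow> F = \<zero>\<^bsub>V\<^esub>"
      using carrier_eqI[OF F carrier_zero(1)] by auto
    finally show ?thesis .
  qed
  have tri: "?n (F \<oplus>\<^bsub>V\<^esub> G) \<le> ?n F + ?n G" if F: "F \<in> carrier V" and G: "G \<in> carrier V" for F G
  proof -
    note [measurable] = rep_meas[OF F] rep_meas[OF G] rep_meas[OF carrier_add(2)[OF F G]]
    have "cnorm (rep (F \<oplus>\<^bsub>V\<^esub> G)) = cnorm (\<lambda>x. rep F x + rep G x)"
      by (intro cnorm_cong_AE carrier_add F G) auto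
    also have "\<dots> \<le> cnorm (rep F) + cnorm (rep G)" by (rule cnorm_triangle) auto
    finally have "?n (F \<oplus>\<^bsub>V\<^esub> G) \<le> enn2real (cnorm (rep F) + cnorm (rep G))"
      using carrierD(2)[OF F] carrierD(2)[OF G] by (intro enn2real_mono) auto
    then show ?thesis
      using carrierD(2)[OF F] carrierD(2)[OF G] by (simp add: enn2real_plus)
  qed
  have hom: "?n (c \<odot>\<^bsub>V\<^esub> F) = cmod c * ?n F" if F: "F \<in> carrier V" for c F
  proof -
    note [measurable] = rep_meas[OF F] rep_meas[OF carrier_smult(2)[OF F]]
    have "cnorm (rep (c \<odot>\<^bsub>V\<^esub> F)) = cnorm (\<lambda>x. c * rep F x)"
      by (intro cnorm_cong_AE carrier_smult F) auto
    then show ?thesis by (simp add: cnorm_cmult enn2real_mult)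
  qed
  interpret d: Metric_space "carrier V" ?d
  proof
    fix F G H
    show "0 \<le> ?d F G" by simp
    show "?d F G = ?d G F"
      by (auto simp: cnorm_rep_minus cnorm_minus_commute[of "rep F" "rep G"])
    assume FG: "F \<in> carrier V" "G \<in> carrier V"
    show "?d F G = 0 \<longleftrightarrow> F = G"
    proof -
      have "F \<ominus>\<^bsub>V\<^esub> G = \<zero>\<^bsub>V\<^esub> \<Longrightarrow> F = G"
        using FG minus_equality[of F "\<ominus>\<^bsub>V\<^esub> G"] by (simp add: a_minus_def)
      then show ?thesis using FG by (auto simp: n0 a_minus_def r_neg)
    qed
    assume H: "H \<in> carrier V"
    have "F \<ominus>\<^bsub>V\<^esub> H = (F \<ominus>\<^bsub>V\<^esub> G) \<oplus>\<^bsub>V\<^esub> (G \<ominus>\<^bsub>V\<^esub> H)"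
      using FG H by (simp add: a_minus_def a_assoc) (simp add: a_assoc[symmetric] l_neg)
    then show "?d F H \<le> ?d F G + ?d G H"
      using tri[of "F \<ominus>\<^bsub>V\<^esub> G" "G \<ominus>\<^bsub>V\<^esub> H"] FG H by simp
  qed
  have "d.mcomplete"
    unfolding d.mcomplete_def
  proof (intro allI impI)
    fix F assume "d.MCauchy F"
    then have F: "\<And>n. F n \<in> carrier V"
      and Cauchy: "\<And>e. 0 < e \<Longrightarrow> \<exists>N. \<forall>n n'. N \<le> n \<longrightarrow> N \<le> n' \<longrightarrow> ?d (F n) (F n') < e"
      unfolding d.MCauchy_def by auto
    have fin: "cnorm (rep (G \<ominus>\<^bsub>V\<^esub> H)) < \<infinity>" if "G \<in> carrier V" "H \<in> carrier V" for G H
      using that by (intro carrierD(2)) simp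
    note [measurable] = rep_meas[OF F]
    obtain g where [measurable]: "g \<in> borel_measurable M"
      and g: "(\<lambda>n. cnorm (\<lambda>x. rep (F n) x - g x)) \<longlonglongrightarrow> 0"
    proof (rule Riesz_Fischer[of "\<lambda>n. rep (F n)"])
      fix e :: real assume "0 < e"
      then obtain n0 where n0: "\<And>m n. n0 \<le> m \<Longrightarrow> n0 \<le> n \<Longrightarrow> ?d (F m) (F n) < e"
        using Cauchy by blast
      have "cnorm (\<lambda>x. rep (F m) x - rep (F n) x) < ennreal e" if "n0 \<le> m" "n0 \<le> n" for m n
        using n0[OF that] F fin[OF F F, of m n] \<open>0 < e\<close> cnorm_rep_minus[OF F F, of m n]
        by (cases "cnorm (\<lambda>x. rep (F m) x - rep (F n) x)") (auto simp: ennreal_lessI)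
      then show "\<exists>n0. \<forall>m\<ge>n0. \<forall>n\<ge>n0. cnorm (\<lambda>x. rep (F m) x - rep (F n) x) < ennreal e"
        by blast
    qed auto
    obtain n where n: "cnorm (\<lambda>x. rep (F n) x - g x) < 1"
      using order_tendstoD(2)[OF g, of 1] by (auto simp: eventually_sequentially)
    have "cnorm g \<le> cnorm (\<lambda>x. g x - rep (F n) x) + cnorm (rep (F n))"
      by (rule cnorm_triangle_diff) auto
    also have "\<dots> < \<infinity>"
      using less_trans[OF n] carrierD(2)[OF F, of n] by (simp add: cnorm_minus_commute[of g])
    finally have G: "ae_class M g \<in> carrier V" by (intro ae_class_carrier) auto
    note [measurable] = rep_meas[OF G]
    have "cnorm (\<lambda>x. rep (F n) x - rep (ae_class M g) x) = cnorm (\<lambda>x. rep (F n) x - g x)" for n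
      using rep_ae_class[of g M] by (intro cnorm_cong_AE) (auto elim: eventually_mono)
    then have d: "?d (F n) (ae_class M g) = enn2real (cnorm (\<lambda>x. rep (F n) x - g x))" for n
      using F G by (simp add: cnorm_rep_minus)
    have "(\<lambda>n. ?d (F n) (ae_class M g)) \<longlonglongrightarrow> 0"
      unfolding d using tendsto_enn2real[where l = 0] g by simp
    then show "\<exists>G. limitin d.mtopology F G sequentially"
      using F G by (intro exI[of _ "ae_class M g"]) (simp add: d.limitin_metric_dist_null)
  qed
  then show ?thesis
    unfolding complex_banach_space_def using module_V n0 tri hom by auto
qed

end

section \<open>Mixed norms over a family of windows\<close>

definition mixed_norm ::
  "real measure \<Rightarrow> (real \<Rightarrow> real \<Rightarrow> ennreal) \<Rightarrow> ennreal \<Rightarrow> ennreal \<Rightarrow> (real \<Rightarrow> ennreal) \<Rightarrow> ennreal" where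
  "mixed_norm M K q p g = Lp_norm M p (\<lambda>y. Lp_norm (density M (K y)) q g)"

text \<open>\<open>K y\<close> is the density of the measure that looks at a function near \<open>y\<close>.  The second assumption is
  what makes the inner norm a measurable function of \<open>y\<close>; without measurability the outer integral
  would not be additive.\<close>

locale measurable_windows =
  fixes M :: "real measure" and K :: "real \<Rightarrow> real \<Rightarrow> ennreal"
  assumes window_measurable: "K y \<in> borel_measurable M"
    and integral_window_measurable:
      "g \<in> borel_measurable M \<Longrightarrow> (\<lambda>y. \<integral>\<^sup>+x. g x * K y x \<partial>M) \<in> borel_measurable M"
begin

text \<open>For \<open>q = \<infinity>\<close> the sublevel sets of the essential supremum are described by the vanishing of
  the window integral of an indicator, so the same assumption serves all exponents.\<close>

lemma Lp_norm_window_measurable: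
  assumes q: "1 \<le> q" and g[measurable]: "g \<in> borel_measurable M"
  shows "(\<lambda>y. Lp_norm (density M (K y)) q g) \<in> borel_measurable M"
proof (cases "q = \<infinity>")
  case True
  have iff: "esssup (density M (K y)) g \<le> c \<longleftrightarrow>
      (\<integral>\<^sup>+x. indicator {c<..} (g x) * K y x \<partial>M) = 0" for y c
  proof -
    note [measurable] = window_measurable[of y]
    have "esssup (density M (K y)) g \<le> c \<longleftrightarrow> (AE x in M. 0 < K y x \<longrightarrow> g x \<le> c)"
      by (subst esssup_le_iff) (auto simp: AE_density)
    also have "\<dots> \<longleftrightarrow> (AE x in M. indicator {c<..} (g x) * K y x = 0)"
      by (intro AE_cong) (auto simp: indicator_def zero_less_iff_neq_zero)
    also have "\<dots> \<longleftrightarrow> (\<integral>\<^sup>+x. indicator {c<..} (g x) * K y x \<partial>M) = 0"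
      by (subst nn_integral_0_iff_AE) auto
    finally show ?thesis .
  qed
  have "(\<lambda>y. esssup (density M (K y)) g) \<in> borel_measurable M"
  proof (rule borel_measurableI_le)
    fix c
    have [measurable]: "(\<lambda>y. \<integral>\<^sup>+x. indicator {c<..} (g x) * K y x \<partial>M) \<in> borel_measurable M"
      by (rule integral_window_measurable) measurable
    show "{y \<in> space M. esssup (density M (K y)) g \<le> c} \<in> sets M"
      unfolding iff by measurable
  qed
  then show ?thesis by (simp add: True Lp_norm_infinity)
next
  case False
  have "(\<lambda>y. \<integral>\<^sup>+x. ennreal_powr (g x) (enn2real q) * K y x \<partial>M) \<in> borel_measurable M"
    by (rule integral_window_measurable) measurable
  then show ?thesis
    using False window_measurable by (simp add: Lp_norm_def nn_integral_density mult.commute)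
qed

lemma function_seminorm_mixed_norm:
  assumes q: "1 \<le> q" and p: "1 \<le> p"
  shows "function_seminorm M (mixed_norm M K q p)"
proof
  note meas = Lp_norm_window_measurable[OF q]
  interpret outer: function_norm M "Lp_norm M p" by (rule function_norm_Lp_norm[OF p])
  interpret inner: function_norm "density M (K y)" "Lp_norm (density M (K y)) q" for y
    by (rule function_norm_Lp_norm[OF q])
  fix f g :: "real \<Rightarrow> ennreal" assume f: "f \<in> borel_measurable M" and g: "g \<in> borel_measurable M"
  show "mixed_norm M K q p f \<le> mixed_norm M K q p g" if "AE x in M. f x \<le> g x"
  proof -
    have "AE x in density M (K y). f x \<le> g x" for y
      using that by (auto simp: AE_density window_measurable)
    then have "Lp_norm (density M (K y)) q f \<le> Lp_norm (density M (K y)) q g" for y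
      using f g by (intro inner.norm_mono) auto
    then show ?thesis
      unfolding mixed_norm_def by (intro outer.norm_mono meas f g) simp
  qed
  show "mixed_norm M K q p (\<lambda>x. ennreal c * f x) = ennreal c * mixed_norm M K q p f" for c
    unfolding mixed_norm_def using f inner.norm_cmult[of f]
    by (simp add: outer.norm_cmult meas)
  have "mixed_norm M K q p (\<lambda>x. f x + g x) \<le>
      Lp_norm M p (\<lambda>y. Lp_norm (density M (K y)) q f + Lp_norm (density M (K y)) q g)"
    unfolding mixed_norm_def using f g
    by (intro outer.norm_mono AE_I2 inner.norm_triangle meas borel_measurable_add) auto
  also have "\<dots> \<le> mixed_norm M K q p f + mixed_norm M K q p g"
    unfolding mixed_norm_def by (intro outer.norm_triangle meas f g)
  finally show "mixed_norm M K q p (\<lambda>x. f x + g x) \<le> mixed_norm M K q p f + mixed_norm M K q p g" .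
next
  note meas = Lp_norm_window_measurable[OF q]
  fix h :: "nat \<Rightarrow> real \<Rightarrow> ennreal"
  assume h: "\<And>n. h n \<in> borel_measurable M" and inc: "incseq h"
  have "Lp_norm (density M (K y)) q (\<lambda>x. SUP n. h n x) = (SUP n. Lp_norm (density M (K y)) q (h n))" for y
    using h by (intro Lp_norm_SUP q inc) auto
  then have "mixed_norm M K q p (\<lambda>x. SUP n. h n x) =
      Lp_norm M p (\<lambda>y. SUP n. Lp_norm (density M (K y)) q (h n))"
    by (simp add: mixed_norm_def)
  also have "\<dots> = (SUP n. mixed_norm M K q p (h n))"
    unfolding mixed_norm_def using h inc
    by (intro Lp_norm_SUP p meas)
      (auto simp: incseq_def le_fun_def intro!: Lp_norm_mono_AE[OF q] AE_I2)
  finally show "mixed_norm M K q p (\<lambda>x. SUP n. h n x) \<le> (SUP n. mixed_norm M K q p (h n))" by simp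
qed

lemma mixed_norm_eq_0_imp:
  assumes q: "1 \<le> q" and p: "1 \<le> p" and g[measurable]: "g \<in> borel_measurable M"
    and 0: "mixed_norm M K q p g = 0"
  shows "AE y in M. (\<integral>\<^sup>+x. g x * K y x \<partial>M) = 0"
proof -
  have "AE y in M. Lp_norm (density M (K y)) q g = 0"
    using 0 Lp_norm_eq_0_iff[OF p Lp_norm_window_measurable[OF q g]] by (simp add: mixed_norm_def)
  then show ?thesis
  proof eventually_elim
    fix y assume 0: "Lp_norm (density M (K y)) q g = 0"
    note [measurable] = window_measurable[of y]
    have "AE x in density M (K y). g x = 0"
      using 0 by (subst (asm) Lp_norm_eq_0_iff[OF q]) auto
    then show "(\<integral>\<^sup>+x. g x * K y x \<partial>M) = 0"
      by (subst nn_integral_0_iff_AE) (auto simp: AE_density zero_less_iff_neq_zero elim!: eventually_mono)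
  qed
qed

end

lemma function_seminorm_SUP:
  assumes n: "\<And>i. i \<in> I \<Longrightarrow> function_seminorm M (n i)"
  shows "function_seminorm M (\<lambda>g. SUP i\<in>I. w i * n i g)"
proof
  fix f g :: "real \<Rightarrow> ennreal" assume f: "f \<in> borel_measurable M" and g: "g \<in> borel_measurable M"
  show "(SUP i\<in>I. w i * n i f) \<le> (SUP i\<in>I. w i * n i g)" if "AE x in M. f x \<le> g x"
    by (intro SUP_subset_mono order_refl mult_left_mono function_seminorm.norm_mono[OF n] f g that) auto
  show "(SUP i\<in>I. w i * n i (\<lambda>x. ennreal c * f x)) = ennreal c * (SUP i\<in>I. w i * n i f)" for c
    by (simp add: SUP_mult_left_ennreal function_seminorm.norm_cmult[OF n f] mult.left_commute cong: SUP_cong)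
  show "(SUP i\<in>I. w i * n i (\<lambda>x. f x + g x)) \<le> (SUP i\<in>I. w i * n i f) + (SUP i\<in>I. w i * n i g)"
  proof (rule SUP_least)
    fix i assume i: "i \<in> I"
    have "w i * n i (\<lambda>x. f x + g x) \<le> w i * n i f + w i * n i g"
      unfolding distrib_left[symmetric] by (intro mult_left_mono function_seminorm.norm_triangle[OF n] i f g) auto
    also have "\<dots> \<le> (SUP i\<in>I. w i * n i f) + (SUP i\<in>I. w i * n i g)"
      by (intro add_mono SUP_upper i)
    finally show "w i * n i (\<lambda>x. f x + g x) \<le> \<dots>" .
  qed
next
  fix h :: "nat \<Rightarrow> real \<Rightarrow> ennreal"
  assume h: "\<And>n. h n \<in> borel_measurable M" and inc: "incseq h"
  show "(SUP i\<in>I. w i * n i (\<lambda>x. SUP m. h m x)) \<le> (SUP m. SUP i\<in>I. w i * n i (h m))"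
  proof (rule SUP_least)
    fix i assume i: "i \<in> I"
    have "w i * n i (\<lambda>x. SUP m. h m x) \<le> w i * (SUP m. n i (h m))"
      by (intro mult_left_mono function_seminorm.norm_SUP_le[OF n] i h inc) auto
    also have "\<dots> = (SUP m. w i * n i (h m))" by (simp add: SUP_mult_left_ennreal)
    also have "\<dots> \<le> (SUP m. SUP i\<in>I. w i * n i (h m))"
      by (intro SUP_subset_mono order_refl SUP_upper i)
    finally show "w i * n i (\<lambda>x. SUP m. h m x) \<le> \<dots>" .
  qed
qed

text \<open>All properties but definiteness pass from the inner norms to the outer norm and to suprema.  The
  assumption \<open>total\<close> says that the windows together see every set of positive measure.\<close>

theorem function_norm_SUP_mixed_norm:
  assumes K: "\<And>r. r \<in> I \<Longrightarrow> measurable_windows M (K r)" and q: "1 \<le> q" and p: "1 \<le> p"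
    and w: "\<And>r. r \<in> I \<Longrightarrow> w r \<noteq> 0"
    and total: "\<And>g. g \<in> borel_measurable M \<Longrightarrow>
      (\<And>r. r \<in> I \<Longrightarrow> AE y in M. (\<integral>\<^sup>+x. g x * K r y x \<partial>M) = 0) \<Longrightarrow> AE x in M. g x = 0"
  shows "function_norm M (\<lambda>g. SUP r\<in>I. w r * mixed_norm M (K r) q p g)"
proof -
  interpret function_seminorm M "\<lambda>g. SUP r\<in>I. w r * mixed_norm M (K r) q p g"
    by (intro function_seminorm_SUP measurable_windows.function_seminorm_mixed_norm K q p)
  show ?thesis
  proof
    fix g assume g: "g \<in> borel_measurable M" and 0: "(SUP r\<in>I. w r * mixed_norm M (K r) q p g) = 0"
    show "AE x in M. g x = 0"
    proof (rule total[OF g])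
      fix r assume r: "r \<in> I"
      have "w r * mixed_norm M (K r) q p g \<le> 0" unfolding 0[symmetric] by (rule SUP_upper[OF r])
      then have "mixed_norm M (K r) q p g = 0" using w[OF r] by simp
      then show "AE y in M. (\<integral>\<^sup>+x. g x * K r y x \<partial>M) = 0"
        by (rule measurable_windows.mixed_norm_eq_0_imp[OF K[OF r] q p g])
    qed
  qed
qed

section \<open>The Dunkl kernel on the imaginary axis\<close>

text \<open>In the variable \<open>v = u\<^sup>2\<close> the Bessel function $j_k(u)$ is an ordinary power series.  The quotient of
  Gamma functions in its coefficients is a Pochhammer symbol, which stays above
  \<open>(1 / 2) ^ n\<close> for \<open>k > - 1 / 2\<close>.\<close>

definition bessel_coeff :: "real \<Rightarrow> nat \<Rightarrow> real" where
  "bessel_coeff k n = (-1) ^ n / (fact n * 4 ^ n * pochhammer (k + 1) n)"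

definition bessel_power :: "real \<Rightarrow> real \<Rightarrow> real" where
  "bessel_power k v = (\<Sum>n. bessel_coeff k n * v ^ n)"

lemma pochhammer_ge_half_power:
  assumes "k > - 1 / 2" shows "(1 / 2) ^ n \<le> pochhammer (k + 1 :: real) n"
proof -
  have "(\<Prod>i<n. 1 / 2) \<le> (\<Prod>i<n. k + 1 + of_nat i)"
    using assms by (intro prod_mono) auto
  then show ?thesis by (simp add: pochhammer_prod atLeast0LessThan)
qed

lemma pochhammer_pos': "k > - 1 / 2 \<Longrightarrow> 0 < pochhammer (k + 1 :: real) n"
  by (rule pochhammer_pos) simp

lemma abs_bessel_coeff_le:
  assumes "k > - 1 / 2" shows "\<bar>bessel_coeff k n\<bar> \<le> inverse (fact n)"
proof -
  have "(1::real) \<le> (4 * (1/2)) ^ n" by (simp add: one_le_power)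
  also have "\<dots> = 4 ^ n * (1 / 2 :: real) ^ n" by (rule power_mult_distrib)
  also have "\<dots> \<le> 4 ^ n * pochhammer (k + 1) n"
    by (intro mult_left_mono pochhammer_ge_half_power assms) auto
  finally have "fact n * 1 \<le> fact n * (4 ^ n * pochhammer (k + 1) n)"
    by (intro mult_left_mono) auto
  then show ?thesis
    using pochhammer_pos'[OF assms, of n]
    by (simp add: bessel_coeff_def abs_mult inverse_eq_divide field_simps)
qed

lemma summable_bessel_abs:
  assumes "k > - 1 / 2" shows "summable (\<lambda>n. \<bar>bessel_coeff k n * v ^ n\<bar>)"
proof (rule summable_comparison_test')
  show "summable (\<lambda>n. inverse (fact n) * \<bar>v\<bar> ^ n)" by (rule summable_exp)
  show "norm \<bar>bessel_coeff k n * v ^ n\<bar> \<le> inverse (fact n) * \<bar>v\<bar> ^ n" if "0 \<le> n" for n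
    using mult_right_mono[OF abs_bessel_coeff_le[OF assms, of n], of "\<bar>v\<bar> ^ n"]
    by (simp add: abs_mult power_abs)
qed

lemma summable_bessel:
  assumes "k > - 1 / 2" shows "summable (\<lambda>n. bessel_coeff k n * v ^ n)"
  by (rule summable_rabs_cancel[OF summable_bessel_abs[OF assms]])

lemma bessel_power_0: "bessel_power k 0 = 1"
  unfolding bessel_power_def by (subst powser_zero) (simp add: bessel_coeff_def)

lemma bessel_j_of_real:
  assumes k: "k > - 1 / 2"
  shows "bessel_j k (of_real u) = of_real (bessel_power k (u ^ 2))"
proof -
  have G: "0 < Gamma (k + 1)" using k by (intro Gamma_real_pos) auto
  have tm: "of_real (Gamma (k + 1)) * ((-1) ^ n * of_real u ^ (2 * n) /
      of_real (fact n * 2 ^ (2 * n) * Gamma (real n + k + 1))) =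
      (of_real (bessel_coeff k n * (u ^ 2) ^ n) :: complex)" for n
  proof -
    have "k + 1 \<notin> \<int>\<^sub>\<le>\<^sub>0" using k by (auto elim!: nonpos_Ints_cases)
    then have "pochhammer (k + 1) n = Gamma (k + 1 + of_nat n) / Gamma (k + 1)"
      by (rule pochhammer_Gamma)
    then have "Gamma (k + 1) * ((-1) ^ n * u ^ (2 * n) / (fact n * 2 ^ (2 * n) * Gamma (real n + k + 1))) =
        bessel_coeff k n * (u ^ 2) ^ n"
      using G by (simp add: bessel_coeff_def add_ac power_mult)
    from arg_cong[OF this, of complex_of_real] show ?thesis
      by (simp only: of_real_power of_real_mult of_real_divide of_real_minus of_real_1)
  qed
  let ?t = "\<lambda>n. (-1) ^ n * of_real u ^ (2 * n) /
      of_real (fact n * 2 ^ (2 * n) * Gamma (real n + k + 1)) :: complex"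
  have "summable (\<lambda>n. of_real (bessel_coeff k n * (u ^ 2) ^ n) :: complex)"
    by (intro summable_of_real summable_bessel k)
  then have "summable (\<lambda>n. of_real (Gamma (k + 1)) * ?t n)"
    unfolding tm .
  moreover have "complex_of_real (Gamma (k + 1)) \<noteq> 0" using G by simp
  ultimately have "summable ?t" by (subst (asm) summable_cmult_iff) blast
  from suminf_mult[OF this, of "of_real (Gamma (k + 1))"]
  have "bessel_j k (of_real u) = (\<Sum>n. of_real (Gamma (k + 1)) * ?t n)"
    unfolding bessel_j_def by (rule sym)
  also have "\<dots> = of_real (bessel_power k (u ^ 2))"
    unfolding tm bessel_power_def by (intro suminf_of_real[symmetric] summable_bessel k)
  finally show ?thesis .
qed

text \<open>Both Bessel functions are even, so rotating \<open>\<i> * u\<close> by \<open>\<i>\<close> gives real arguments: the real part of the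
  kernel is $j_k$ and its imaginary part is a multiple of $u j_{k+1}(u)$.\<close>

lemma dunkl_kernel_imaginary:
  assumes k: "k > - 1 / 2"
  shows "dunkl_kernel k (\<i> * of_real u) =
    Complex (bessel_power k (u ^ 2)) (u * bessel_power (k + 1) (u ^ 2) / (2 * (k + 1)))"
proof -
  have arg: "\<i> * (\<i> * of_real u) = of_real (- u)" by (simp flip: mult.assoc)
  have "dunkl_kernel k (\<i> * of_real u) = of_real (bessel_power k (u ^ 2)) +
      \<i> * of_real u / of_real (2 * (k + 1)) * of_real (bessel_power (k + 1) (u ^ 2))"
    unfolding dunkl_kernel_def arg using k by (subst (1 2) bessel_j_of_real) auto
  then show ?thesis by (simp add: complex_eq_iff Re_divide_of_real Im_divide_of_real del: of_real_add of_real_mult)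
qed

lemma has_real_derivative_bessel_power:
  assumes k: "k > - 1 / 2"
  shows "(bessel_power k has_real_derivative - bessel_power (k + 1) v / (4 * (k + 1))) (at v)"
proof -
  have "diffs (bessel_coeff k) n * v ^ n = - 1 / (4 * (k + 1)) * (bessel_coeff (k + 1) n * v ^ n)" for n
  proof -
    have "bessel_coeff k (Suc n) = - bessel_coeff (k + 1) n / (4 * (k + 1) * real (Suc n))"
      unfolding bessel_coeff_def pochhammer_rec fact_Suc power_Suc
      by (simp add: add.assoc mult_ac del: of_nat_Suc)
    then have "diffs (bessel_coeff k) n = - 1 / (4 * (k + 1)) * bessel_coeff (k + 1) n"
      unfolding diffs_def by (simp del: of_nat_Suc)
    then show ?thesis by simp
  qed
  then have "(\<Sum>n. diffs (bessel_coeff k) n * v ^ n) = - 1 / (4 * (k + 1)) * bessel_power (k + 1) v"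
    unfolding bessel_power_def using k by (simp only:) (intro suminf_mult summable_bessel, simp)
  then show ?thesis
    unfolding bessel_power_def[abs_def]
    using termdiffs_strong_converges_everywhere[of "bessel_coeff k" v] summable_bessel[OF k] by simp
qed

text \<open>This is the first-order equation \<open>b' + (2 * k + 1) * b / u = a\<close> between the real part \<open>a\<close> and
  the imaginary part \<open>b\<close> of the kernel, written in the variable \<open>v = u\<^sup>2\<close>.\<close>

lemma bessel_power_recurrence:
  assumes k: "k > - 1 / 2"
  shows "v * (- bessel_power (k + 2) v / (4 * (k + 2))) = (k + 1) * (bessel_power k v - bessel_power (k + 1) v)"
proof -
  have k1: "k + 1 > - 1 / 2" using k by simp
  let ?c = "bessel_coeff (k + 1)"
  have "(bessel_power (k + 1) has_real_derivative (\<Sum>n. diffs ?c n * v ^ n)) (at v)"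
    unfolding bessel_power_def[abs_def]
    by (intro termdiffs_strong_converges_everywhere summable_bessel k1)
  then have D: "(\<Sum>n. diffs ?c n * v ^ n) = - bessel_power (k + 2) v / (4 * (k + 2))"
    using DERIV_unique[OF _ has_real_derivative_bessel_power[OF k1, of v]] by (simp add: add.assoc)
  have "summable (\<lambda>n. diffs ?c n * v ^ n)"
    by (rule termdiff_converges_all) (intro summable_bessel k1)
  then have "(\<lambda>n. of_nat n * ?c n * v ^ (n - Suc 0)) sums (\<Sum>n. diffs ?c n * v ^ n)"
    by (rule diffs_equiv)
  then have "(\<lambda>n. v * (of_nat n * ?c n * v ^ (n - Suc 0))) sums (v * (\<Sum>n. diffs ?c n * v ^ n))"
    by (rule sums_mult)
  moreover have "v * (of_nat n * ?c n * v ^ (n - Suc 0)) = (k + 1) * (bessel_coeff k n * v ^ n - ?c n * v ^ n)" for n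
  proof -
    have P: "pochhammer (k + 1) n * (k + 1 + n) = (k + 1) * pochhammer (k + 2) n"
      using pochhammer_Suc[of "k + 1" n] pochhammer_rec[of "k + 1" n] by (simp add: add_ac)
    have "bessel_coeff k n = ?c n * ((k + 1 + n) / (k + 1))"
    proof -
      have "bessel_coeff k n * (k + 1) = ?c n * (k + 1 + n)"
      proof -
        have "(k + 1) / pochhammer (k + 1) n = (k + 1 + n) / pochhammer (k + 2) n"
          using P pochhammer_pos'[OF k, of n] pochhammer_pos'[OF k1, of n]
          by (subst frac_eq_eq) (auto simp: add.assoc mult.commute)
        then have "(-1) ^ n / (fact n * 4 ^ n) * ((k + 1) / pochhammer (k + 1) n) =
            (-1) ^ n / (fact n * 4 ^ n) * ((k + 1 + n) / pochhammer (k + 2) n)"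
          by simp
        then show ?thesis unfolding bessel_coeff_def by (simp add: add.assoc)
      qed
      then show ?thesis using k by (simp add: field_simps)
    qed
    then have *: "(k + 1) * (bessel_coeff k n - ?c n) = of_nat n * ?c n"
      using k by (simp add: field_simps)
    have "v * (of_nat n * ?c n * v ^ (n - Suc 0)) = of_nat n * ?c n * v ^ n"
      by (cases n) auto
    then show ?thesis unfolding *[symmetric] by (simp add: algebra_simps)
  qed
  moreover have "(\<lambda>n. (k + 1) * (bessel_coeff k n * v ^ n - ?c n * v ^ n)) sums
      ((k + 1) * (bessel_power k v - bessel_power (k + 1) v))"
    unfolding bessel_power_def by (intro sums_mult sums_diff summable_sums summable_bessel k k1)
  ultimately have "(\<lambda>n. (k + 1) * (bessel_coeff k n * v ^ n - ?c n * v ^ n)) sums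
      (v * (\<Sum>n. diffs ?c n * v ^ n))"
    and "(\<lambda>n. (k + 1) * (bessel_coeff k n * v ^ n - ?c n * v ^ n)) sums
      ((k + 1) * (bessel_power k v - bessel_power (k + 1) v))"
    by simp_all
  from sums_unique2[OF this] show ?thesis unfolding D .
qed

text \<open>The squared modulus of the kernel at \<open>\<i> * u\<close> is the energy \<open>a\<^sup>2 + b\<^sup>2\<close>.  It starts at \<open>1\<close>, and
  in the variable \<open>v = u\<^sup>2\<close> its derivative is a negative multiple of a square, because
  \<open>2 * k + 1 > 0\<close>.\<close>

lemma cmod_dunkl_kernel_imaginary_le_1:
  assumes k: "k > - 1 / 2"
  shows "cmod (dunkl_kernel k (\<i> * of_real u)) \<le> 1"
proof -
  have k1: "k + 1 > - 1 / 2" using k by simp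
  define H where "H v = (bessel_power k v)\<^sup>2 + v * (bessel_power (k + 1) v)\<^sup>2 * (1 / (4 * (k + 1)\<^sup>2))" for v
  have "H (u\<^sup>2) \<le> H 0"
  proof (rule DERIV_nonpos_imp_nonincreasing[where f = H])
    fix v :: real
    let ?a = "bessel_power k v" and ?b = "bessel_power (k + 1) v"
    let ?b' = "- bessel_power (k + 2) v / (4 * (k + 2))"
    have b': "(bessel_power (k + 1) has_real_derivative ?b') (at v)"
      using has_real_derivative_bessel_power[OF k1, of v] by (simp add: add.assoc)
    have "(H has_real_derivative 2 * ?a * (- ?b / (4 * (k + 1))) +
        (?b\<^sup>2 + 2 * ?b * (v * ?b')) / (4 * (k + 1)\<^sup>2)) (at v)"
      unfolding H_def[abs_def]
      by (rule derivative_eq_intros has_real_derivative_bessel_power[OF k] b' refl)+ (simp add: mult_ac)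
    moreover have "2 * ?a * (- ?b / (4 * (k + 1))) + (?b\<^sup>2 + 2 * ?b * (v * ?b')) / (4 * (k + 1)\<^sup>2) =
        - (2 * k + 1) * ?b\<^sup>2 / (4 * (k + 1)\<^sup>2)"
      unfolding bessel_power_recurrence[OF k] using k
      by (simp add: divide_simps) (simp add: power2_eq_square algebra_simps)
    moreover have "- (2 * k + 1) * ?b\<^sup>2 / (4 * (k + 1)\<^sup>2) \<le> 0"
      using k by (intro divide_nonpos_nonneg mult_nonpos_nonneg) auto
    ultimately show "\<exists>y. (H has_real_derivative y) (at v) \<and> y \<le> 0"
      by (intro exI[of _ "- (2 * k + 1) * ?b\<^sup>2 / (4 * (k + 1)\<^sup>2)"]) simp
  qed simp
  also have "H 0 = 1" by (simp add: H_def bessel_power_0)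
  also have "H (u\<^sup>2) = (cmod (dunkl_kernel k (\<i> * of_real u)))\<^sup>2"
    unfolding H_def dunkl_kernel_imaginary[OF k] cmod_power2 complex.sel power_divide power_mult_distrib by simp
  finally show ?thesis by (simp add: power_le_one_iff)
qed

lemma continuous_on_bessel_power:
  assumes k: "k > - 1 / 2" and f: "continuous_on A f"
  shows "continuous_on A (\<lambda>x. bessel_power k (f x))"
proof -
  have "continuous_on UNIV (bessel_power k)"
    by (intro continuous_at_imp_continuous_on ballI DERIV_isCont[OF has_real_derivative_bessel_power[OF k]])
  from continuous_on_compose2[OF this f] show ?thesis by simp
qed

lemma continuous_dunkl_kernel_imaginary:
  assumes k: "k > - 1 / 2"
  shows "continuous_on UNIV (\<lambda>u::real. dunkl_kernel k (\<i> * of_real u))"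
proof -
  have "continuous_on UNIV (\<lambda>u. bessel_power k (u\<^sup>2))" "continuous_on UNIV (\<lambda>u. bessel_power (k + 1) (u\<^sup>2))"
    using k by (intro continuous_on_bessel_power continuous_intros; simp)+
  then show ?thesis
    unfolding dunkl_kernel_imaginary[OF k] Complex_eq using k by (intro continuous_intros) auto
qed

section \<open>Gaussian moments of the Dunkl measure\<close>

lemma nn_integral_reflect_lborel:
  fixes f :: "real \<Rightarrow> ennreal"
  assumes "f \<in> borel_measurable borel"
  shows "(\<integral>\<^sup>+x. f (- x) \<partial>lborel) = (\<integral>\<^sup>+x. f x \<partial>lborel)"
  using nn_integral_real_affine[OF assms, of "-1" 0] by simp

text \<open>The substitution \<open>s = t * x\<^sup>2\<close> turns the integral over the half line into the Gamma integral.  It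
  is carried out on compact intervals that exhaust the half line.\<close>

lemma nn_integral_Gaussian_moment:
  fixes a t :: real
  assumes a: "0 < a" and t: "0 < t"
  shows "(\<integral>\<^sup>+x. ennreal (\<bar>x\<bar> powr (2 * a - 1) * exp (- t * x\<^sup>2)) \<partial>lborel) = ennreal (Gamma a / t powr a)"
proof -
  let ?f = "\<lambda>s::real. s powr (a - 1) / exp s"
  let ?h = "\<lambda>x::real. \<bar>x\<bar> powr (2 * a - 1) * exp (- t * x\<^sup>2)"
  have sub: "(\<integral>\<^sup>+s. ennreal (?f s) * indicator {0..t * (real n)\<^sup>2} s \<partial>lborel) =
      (\<integral>\<^sup>+x. ennreal (2 * t powr a * ?h x) * indicator {0..real n} x \<partial>lborel)" for n
  proof -
    have "(\<integral>\<^sup>+s. ennreal (?f s) * indicator {0..t * (real n)\<^sup>2} s \<partial>lborel) =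
      (\<integral>\<^sup>+s. ennreal (?f s * indicator {t * 0\<^sup>2..t * (real n)\<^sup>2} s) \<partial>lborel)"
      by (intro nn_integral_cong) (auto simp: indicator_def)
    also have "\<dots> =
      (\<integral>\<^sup>+x. ennreal (?f (t * x\<^sup>2) * (2 * t * x) * indicator {0..real n} x) \<partial>lborel)"
      using t by (intro nn_integral_substitution)
        (auto simp: set_borel_measurable_def intro!: derivative_eq_intros continuous_intros)
    also have "\<dots> = (\<integral>\<^sup>+x. ennreal (2 * t powr a * ?h x) * indicator {0..real n} x \<partial>lborel)"
    proof (intro nn_integral_cong)
      fix x :: real
      show "ennreal (?f (t * x\<^sup>2) * (2 * t * x) * indicator {0..real n} x) =
          ennreal (2 * t powr a * ?h x) * indicator {0..real n} x"
      proof (cases "0 < x")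
        case True
        have "(t * x\<^sup>2) powr (a - 1) * (2 * t * x) = 2 * (t powr (a - 1) * t powr 1) * (x powr (2 * (a - 1)) * x powr 1)"
          using True t by (simp add: powr_mult powr_powr flip: powr_numeral)
        also have "\<dots> = 2 * t powr a * x powr (2 * a - 1)"
          unfolding powr_add[symmetric] by (simp add: algebra_simps)
        finally show ?thesis using True
          by (auto simp: indicator_def exp_minus field_simps)
      qed (auto simp: indicator_def)
    qed
    finally show ?thesis .
  qed
  have [measurable]: "?f \<in> borel_measurable borel" "?h \<in> borel_measurable borel" by measurable
  have sup: "(SUP n. \<integral>\<^sup>+x. F x * indicator {0..c n} x \<partial>lborel) = (\<integral>\<^sup>+x. F x * indicator {0..} x \<partial>lborel)"
    if [measurable]: "F \<in> borel_measurable borel" and c: "incseq c" "\<And>x. \<exists>n::nat. x \<le> c n" for F and c :: "nat \<Rightarrow> real"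
  proof -
    have "(\<integral>\<^sup>+x. F x * indicator {0..} x \<partial>lborel) = (\<integral>\<^sup>+x. (SUP n. F x * indicator {0..c n} x) \<partial>lborel)"
    proof (intro nn_integral_cong)
      fix x
      obtain n where "x \<le> c n" using c(2) by blast
      then have "F x * indicator {0..} x \<le> F x * indicator {0..c n} x" by (auto simp: indicator_def)
      then show "F x * indicator {0..} x = (SUP n. F x * indicator {0..c n} x)"
        by (intro antisym SUP_least) (auto intro: SUP_upper2[of n] simp: indicator_def)
    qed
    also have "\<dots> = (SUP n. \<integral>\<^sup>+x. F x * indicator {0..c n} x \<partial>lborel)"
      using c(1) by (intro nn_integral_monotone_convergence_SUP)
        (auto simp: incseq_def le_fun_def indicator_def intro: order_trans)
    finally show ?thesis by simp
  qed
  have "ennreal (Gamma a) = (\<integral>\<^sup>+s. ennreal (?f s) * indicator {0..} s \<partial>lborel)"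
    by (subst Gamma_conv_nn_integral_real[OF a]) (auto intro!: nn_integral_cong simp: indicator_def)
  also have "\<dots> = (SUP n. \<integral>\<^sup>+s. ennreal (?f s) * indicator {0..t * (real n)\<^sup>2} s \<partial>lborel)"
  proof (rule sup[symmetric])
    show "\<exists>n. x \<le> t * (real n)\<^sup>2" for x
    proof -
      obtain n :: nat where n: "max 1 (x / t) \<le> n" using real_arch_simple by blast
      then have "x / t \<le> 1 * real n" "1 * real n \<le> real n * real n"
        by (auto intro!: mult_right_mono)
      then have "x / t \<le> real n * real n" by simp
      then show ?thesis using t by (intro exI[of _ n]) (simp add: field_simps power2_eq_square)
    qed
  qed (use t in \<open>auto simp: incseq_def intro!: mult_left_mono power_mono\<close>)
  also have "\<dots> = (\<integral>\<^sup>+x. ennreal (2 * t powr a * ?h x) * indicator {0..} x \<partial>lborel)"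
    unfolding sub by (rule sup) (auto simp: incseq_def intro: real_arch_simple)
  also have "\<dots> = ennreal (2 * t powr a) * (\<integral>\<^sup>+x. ennreal (?h x) * indicator {0..} x \<partial>lborel)"
    by (subst nn_integral_cmult[symmetric]) (auto simp: ennreal_mult'' mult.assoc)
  finally have half: "ennreal (Gamma a) = ennreal (2 * t powr a) * (\<integral>\<^sup>+x. ennreal (?h x) * indicator {0..} x \<partial>lborel)" .
  have "(\<integral>\<^sup>+x. ennreal (?h x) \<partial>lborel) =
      (\<integral>\<^sup>+x. ennreal (?h x) * indicator {0..} x + ennreal (?h (- x)) * indicator {0..} (- x) \<partial>lborel)"
    by (intro nn_integral_cong_AE AE_I2) (auto simp: indicator_def)
  also have "\<dots> = 2 * (\<integral>\<^sup>+x. ennreal (?h x) * indicator {0..} x \<partial>lborel)"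
  proof -
    let ?F = "\<lambda>x. ennreal (?h x) * indicator {0..} x"
    have [measurable]: "?F \<in> borel_measurable borel" by measurable
    have "(\<integral>\<^sup>+x. ?F x + ?F (- x) \<partial>lborel) = (\<integral>\<^sup>+x. ?F x \<partial>lborel) + (\<integral>\<^sup>+x. ?F (- x) \<partial>lborel)"
      by (rule nn_integral_add) measurable
    also have "(\<integral>\<^sup>+x. ?F (- x) \<partial>lborel) = (\<integral>\<^sup>+x. ?F x \<partial>lborel)"
      by (rule nn_integral_reflect_lborel) measurable
    finally show ?thesis unfolding mult_2 .
  qed
  finally have "ennreal (t powr a) * (\<integral>\<^sup>+x. ennreal (?h x) \<partial>lborel) = ennreal (Gamma a)"
    unfolding half by (simp add: ennreal_mult'' mult_ac)
  then have "ennreal (1 / t powr a) * (ennreal (t powr a) * (\<integral>\<^sup>+x. ennreal (?h x) \<partial>lborel)) = ennreal (Gamma a / t powr a)"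
    using Gamma_real_pos[OF a] by (simp flip: ennreal_mult'')
  then show ?thesis using t by (simp flip: ennreal_mult'' mult.assoc)
qed

locale dunkl =
  fixes k :: real
  assumes k: "k > - 1 / 2"
begin

abbreviation "\<mu> \<equiv> dunkl_measure k"

definition weight :: "real \<Rightarrow> real" where
  "weight x = \<bar>x\<bar> powr (2 * k + 1) / (2 powr (k + 1) * Gamma (k + 1))"

lemma Gamma_k_pos: "0 < Gamma (k + 1)"
  using k by (intro Gamma_real_pos) auto

lemma weight_nonneg: "0 \<le> weight x"
  using Gamma_k_pos by (simp add: weight_def)

lemma weight_pos: "x \<noteq> 0 \<Longrightarrow> 0 < weight x"
  using Gamma_k_pos by (simp add: weight_def)

lemma weight_uminus: "weight (- x) = weight x"
  by (simp add: weight_def)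

lemma weight_borel [measurable]: "weight \<in> borel_measurable borel"
  unfolding weight_def[abs_def] by measurable

lemma weight_measurable [measurable]: "weight \<in> borel_measurable lebesgue"
  by (intro measurable_completion) simp

lemma dunkl_measure_eq: "\<mu> = density lebesgue (\<lambda>x. ennreal (weight x))"
  by (simp add: dunkl_measure_def weight_def)

lemma space_dunkl [simp]: "space \<mu> = UNIV"
  by (simp add: dunkl_measure_eq)

lemma sets_dunkl: "sets \<mu> = sets lebesgue"
  by (simp add: dunkl_measure_eq)

lemma borel_imp_measurable: "f \<in> borel_measurable borel \<Longrightarrow> f \<in> borel_measurable \<mu>"
  unfolding measurable_cong_sets[OF sets_dunkl refl] by (intro measurable_completion) simp

lemma id_measurable_dunkl: "(\<lambda>x. x) \<in> measurable \<mu> borel"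
  by (rule borel_imp_measurable) simp

text \<open>The density vanishes only at the point \<open>0\<close>.\<close>

lemma AE_dunkl_iff: "(AE x in \<mu>. P x) \<longleftrightarrow> (AE x in lebesgue. P x)"
proof -
  have "AE x in lebesgue. x \<noteq> (0::real)" by (intro AE_completion AE_lborel_singleton)
  then show ?thesis
    unfolding dunkl_measure_eq
    by (subst AE_density) (auto elim!: eventually_elim2 simp: weight_pos)
qed

lemma nn_integral_dunkl_borel:
  assumes [measurable]: "f \<in> borel_measurable borel"
  shows "(\<integral>\<^sup>+x. f x \<partial>\<mu>) = (\<integral>\<^sup>+x. ennreal (weight x) * f x \<partial>lborel)"
  unfolding dunkl_measure_eq
  by (subst nn_integral_density) (auto intro: measurable_completion simp: nn_integral_completion)

lemma integral_dunkl_borel: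
  fixes f :: "real \<Rightarrow> 'a::{banach, second_countable_topology}"
  assumes [measurable]: "f \<in> borel_measurable borel"
  shows "(LINT x|\<mu>. f x) = (LINT x|lborel. weight x *\<^sub>R f x)"
  unfolding dunkl_measure_eq
  by (subst integral_density) (auto intro: measurable_completion simp: integral_completion weight_nonneg)

lemma integral_odd_eq_0:
  fixes f :: "real \<Rightarrow> 'a::{banach, second_countable_topology}"
  assumes [measurable]: "f \<in> borel_measurable borel" and odd: "\<And>x. f (- x) = - f x"
  shows "(LINT x|\<mu>. f x) = 0"
proof -
  have "(LINT x|lborel. weight x *\<^sub>R f x) = (LINT x|lborel. weight (- x) *\<^sub>R f (- x))"
    using lborel_integral_real_affine[of "-1" "\<lambda>x. weight x *\<^sub>R f x" 0] by simp
  also have "\<dots> = - (LINT x|lborel. weight x *\<^sub>R f x)"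
    by (simp add: odd weight_uminus)
  finally have "2 *\<^sub>R (LINT x|lborel. weight x *\<^sub>R f x) = 0"
    by (simp add: scaleR_2 eq_neg_iff_add_eq_0)
  then show ?thesis by (simp add: integral_dunkl_borel)
qed

lemma nn_integral_power_Gaussian:
  assumes t: "0 < t"
  shows "(\<integral>\<^sup>+x. ennreal (x ^ (2 * m) * exp (- t * x\<^sup>2)) \<partial>\<mu>) =
    ennreal ((2 * t) powr - (k + 1) * pochhammer (k + 1) m / t ^ m)"
proof -
  let ?a = "k + 1 + real m"
  have a: "0 < ?a" using k by simp
  have c: "0 < 2 powr (k + 1) * Gamma (k + 1)" using Gamma_k_pos by simp
  have "(\<integral>\<^sup>+x. ennreal (x ^ (2 * m) * exp (- t * x\<^sup>2)) \<partial>\<mu>) =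
      (\<integral>\<^sup>+x. ennreal (weight x) * ennreal (x ^ (2 * m) * exp (- t * x\<^sup>2)) \<partial>lborel)"
    by (rule nn_integral_dunkl_borel) measurable
  also have "\<dots> = (\<integral>\<^sup>+x. ennreal (1 / (2 powr (k + 1) * Gamma (k + 1))) *
      ennreal (\<bar>x\<bar> powr (2 * ?a - 1) * exp (- t * x\<^sup>2)) \<partial>lborel)"
  proof (intro nn_integral_cong_AE, use AE_lborel_singleton[of 0] in eventually_elim)
    fix x :: real assume "x \<noteq> 0"
    then have "\<bar>x\<bar> powr (2 * ?a - 1) = \<bar>x\<bar> powr (2 * k + 1) * \<bar>x\<bar> powr (real (2 * m))"
      unfolding powr_add[symmetric] by (simp add: algebra_simps)
    also have "\<bar>x\<bar> powr (real (2 * m)) = x ^ (2 * m)"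
      using \<open>x \<noteq> 0\<close> by (subst powr_realpow) (auto simp: power_even_abs)
    finally show "ennreal (weight x) * ennreal (x ^ (2 * m) * exp (- t * x\<^sup>2)) =
        ennreal (1 / (2 powr (k + 1) * Gamma (k + 1))) * ennreal (\<bar>x\<bar> powr (2 * ?a - 1) * exp (- t * x\<^sup>2))"
      using c by (simp add: weight_def flip: ennreal_mult'')
  qed
  also have "\<dots> = ennreal (1 / (2 powr (k + 1) * Gamma (k + 1))) * ennreal (Gamma ?a / t powr ?a)"
    unfolding nn_integral_Gaussian_moment[OF a t, symmetric] by (rule nn_integral_cmult) measurable
  also have "\<dots> = ennreal (1 / (2 powr (k + 1) * Gamma (k + 1)) * (Gamma ?a / t powr ?a))"
    using c Gamma_real_pos[OF a] by (simp flip: ennreal_mult'')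
  also have "1 / (2 powr (k + 1) * Gamma (k + 1)) * (Gamma ?a / t powr ?a) =
      (2 * t) powr - (k + 1) * pochhammer (k + 1) m / t ^ m"
  proof -
    have "k + 1 \<notin> \<int>\<^sub>\<le>\<^sub>0" using k by (auto elim!: nonpos_Ints_cases)
    then have "Gamma ?a = pochhammer (k + 1) m * Gamma (k + 1)"
      using Gamma_k_pos by (subst pochhammer_Gamma) auto
    moreover have "t powr ?a = t powr (k + 1) * t ^ m"
      using t by (simp add: powr_add powr_realpow)
    moreover have "(2 * t) powr - (k + 1) = 1 / (2 powr (k + 1) * t powr (k + 1))"
      unfolding powr_minus_divide using t by (simp add: powr_mult)
    ultimately show ?thesis using c Gamma_k_pos by simp
  qed
  finally show ?thesis .
qed

lemma integrable_power_Gaussian: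
  assumes t: "0 < t" shows "integrable \<mu> (\<lambda>x. x ^ m * exp (- t * x\<^sup>2))"
proof -
  have even: "integrable \<mu> (\<lambda>x. x ^ (2 * m) * exp (- t * x\<^sup>2))" for m
    by (rule integrableI_nonneg, rule borel_imp_measurable, measurable)
      (use nn_integral_power_Gaussian[OF t, of m] in simp_all)
  have "integrable \<mu> (\<lambda>x. x ^ (2 * 0) * exp (- t * x\<^sup>2) + x ^ (2 * m) * exp (- t * x\<^sup>2))"
    by (intro Bochner_Integration.integrable_add even)
  then show ?thesis
  proof (rule Bochner_Integration.integrable_bound)
    have "\<bar>y\<bar> \<le> 1 + y\<^sup>2" for y :: real
      using sum_squares_bound[of 1 "\<bar>y\<bar>"] by simp
    then have *: "\<bar>x ^ m\<bar> \<le> 1 + x ^ (2 * m)" for x :: real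
      by (metis mult.commute power_mult)
    show "AE x in \<mu>. norm (x ^ m * exp (- t * x\<^sup>2)) \<le> norm (x ^ (2 * 0) * exp (- t * x\<^sup>2) + x ^ (2 * m) * exp (- t * x\<^sup>2))"
      using mult_right_mono[OF *, of "exp (- t * x\<^sup>2)" x for x] by (intro AE_I2) (simp add: abs_mult distrib_right)
  qed (rule borel_imp_measurable, measurable)
qed

lemma integral_power_Gaussian:
  assumes t: "0 < t"
  shows "(LINT x|\<mu>. x ^ (2 * m) * exp (- t * x\<^sup>2)) = (2 * t) powr - (k + 1) * pochhammer (k + 1) m / t ^ m"
  using t pochhammer_pos'[OF k, of m] nn_integral_power_Gaussian[OF t, of m]
  by (intro integral_eq_nn_integral[THEN trans] borel_imp_measurable) simp_all

text \<open>The indicator lies below a multiple of a Gaussian.\<close>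

lemma emeasure_interval_finite: "emeasure \<mu> {-r..r} < \<infinity>"
proof -
  have "emeasure \<mu> {-r..r} = (\<integral>\<^sup>+x. indicator {-r..r} x \<partial>\<mu>)"
    by (rule nn_integral_indicator[symmetric]) (simp add: sets_dunkl)
  also have "\<dots> \<le> (\<integral>\<^sup>+x. ennreal (exp (r\<^sup>2)) * ennreal (x ^ (2 * 0) * exp (- 1 * x\<^sup>2)) \<partial>\<mu>)"
  proof (intro nn_integral_mono)
    fix x
    show "indicator {-r..r} x \<le> ennreal (exp (r\<^sup>2)) * ennreal (x ^ (2 * 0) * exp (- 1 * x\<^sup>2))"
    proof (cases "x \<in> {-r..r}")
      case True
      then have "x\<^sup>2 \<le> r\<^sup>2" by (intro abs_le_square_iff[THEN iffD1]) auto
      then have "1 \<le> exp (r\<^sup>2) * exp (- (x\<^sup>2))" by (simp flip: exp_add)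
      then show ?thesis using True by (simp flip: ennreal_mult'')
    qed simp
  qed
  also have "\<dots> = ennreal (exp (r\<^sup>2)) * (\<integral>\<^sup>+x. ennreal (x ^ (2 * 0) * exp (- 1 * x\<^sup>2)) \<partial>\<mu>)"
    by (rule nn_integral_cmult, rule borel_imp_measurable) measurable
  also have "\<dots> < \<infinity>"
    using nn_integral_power_Gaussian[of 1 0] by (simp add: ennreal_mult_less_top)
  finally show ?thesis .
qed

lemma sigma_finite_dunkl: "sigma_finite_measure \<mu>"
proof
  show "\<exists>A. countable A \<and> A \<subseteq> sets \<mu> \<and> \<Union> A = space \<mu> \<and> (\<forall>a\<in>A. emeasure \<mu> a \<noteq> \<infinity>)"
  proof (intro exI[of _ "range (\<lambda>n. {- real n..real n})"] conjI)
    show "\<Union> (range (\<lambda>n. {- real n..real n})) = space \<mu>"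
    proof (auto, goal_cases)
      case (1 x)
      obtain n :: nat where "\<bar>x\<bar> \<le> n" using real_arch_simple by blast
      then show ?case by (intro exI[of _ n]) auto
    qed
    show "\<forall>a\<in>range (\<lambda>n. {- real n..real n}). emeasure \<mu> a \<noteq> \<infinity>"
      using emeasure_interval_finite by (auto simp: less_top)
  qed (auto simp: sets_dunkl)
qed

end

section \<open>Integrals of the kernel against Gaussians\<close>

lemma ennreal_powr_2: "ennreal_powr x 2 = x\<^sup>2"
  by (cases x) (auto simp: ennreal_powr_def ennreal_power)

lemma exponent_2: "enn2real 2 = 2" "recip 2 = 1 / 2"
proof -
  have *: "(2::ennreal) = ennreal 2" by simp
  show "enn2real 2 = 2" unfolding * by (rule enn2real_ennreal) simp
  have "inverse (ennreal 2) = ennreal (1 / 2)" by (subst inverse_ennreal) (auto simp: inverse_eq_divide)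
  then have "inverse 2 = ennreal (1 / 2)" unfolding * .
  then have "recip 2 = enn2real (ennreal (1 / 2))" unfolding recip_def by (rule arg_cong)
  also have "\<dots> = 1 / 2" by (rule enn2real_ennreal) simp
  finally show "recip 2 = 1 / 2" .
qed

lemma ennreal_power2_le_imp_le:
  fixes x y :: ennreal
  assumes "x\<^sup>2 \<le> y\<^sup>2" shows "x \<le> y"
proof (cases y)
  case (real b)
  then have "x\<^sup>2 \<noteq> \<infinity>" using assms by (auto simp: ennreal_power top_unique)
  then obtain a where a: "x = ennreal a" "0 \<le> a" by (cases x) auto
  have "a\<^sup>2 \<le> b\<^sup>2" using assms real a by (simp add: ennreal_power)
  then have "a \<le> b" using real(1) by (rule power2_le_imp_le)
  then show ?thesis using real a by (simp add: ennreal_leI)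
qed simp

lemma summable_exp_abs: "summable (\<lambda>n. \<bar>A * (z ^ n / fact n)\<bar>)" for A z :: real
  using summable_mult[OF summable_exp[of "\<bar>z\<bar>"], of "\<bar>A\<bar>"]
  by (simp add: abs_mult power_abs field_simps)

context dunkl
begin

sublocale L2: function_norm \<mu> "Lp_norm \<mu> 2"
  by (rule function_norm_Lp_norm) simp

abbreviation "norm2 \<equiv> L2.cnorm"

abbreviation "L2 \<equiv> Lp \<mu> 2"

lemma L2_iff: "f \<in> L2 \<longleftrightarrow> f \<in> borel_measurable \<mu> \<and> norm2 f < \<infinity>"
  by (simp add: Lp_def L2.cnorm_def)

lemma L2_measurable [measurable_dest]: "f \<in> L2 \<Longrightarrow> f \<in> borel_measurable \<mu>"
  by (simp add: L2_iff)

lemma norm2_power2: "(norm2 f)\<^sup>2 = (\<integral>\<^sup>+x. ennreal ((cmod (f x))\<^sup>2) \<partial>\<mu>)"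
proof -
  let ?I = "\<integral>\<^sup>+x. ennreal_powr (ennreal (cmod (f x))) 2 \<partial>\<mu>"
  have "norm2 f = ennreal_powr ?I (1 / 2)"
    by (simp add: L2.cnorm_def Lp_norm_def exponent_2)
  then have "(norm2 f)\<^sup>2 = ennreal_powr (ennreal_powr ?I (1 / 2)) 2"
    by (simp only: ennreal_powr_2)
  also have "\<dots> = ?I" by (subst ennreal_powr_powr) (auto simp: ennreal_powr_1)
  also have "?I = (\<integral>\<^sup>+x. ennreal ((cmod (f x))\<^sup>2) \<partial>\<mu>)"
    by (simp add: ennreal_powr_2 ennreal_power)
  finally show ?thesis .
qed

lemma L2_iff_integrable: "f \<in> L2 \<longleftrightarrow> f \<in> borel_measurable \<mu> \<and> integrable \<mu> (\<lambda>x. (cmod (f x))\<^sup>2)"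
proof -
  have "norm2 f < \<infinity> \<longleftrightarrow> (norm2 f)\<^sup>2 < \<infinity>" by (cases "norm2 f") (auto simp: ennreal_power)
  then show ?thesis
    unfolding L2_iff norm2_power2 by (auto simp: integrable_iff_bounded)
qed

text \<open>With extended values on both sides this covers the existence of the pairing of square-integrable
  functions as well as its size.\<close>

lemma Cauchy_Schwarz_norm2:
  assumes [measurable]: "f \<in> borel_measurable \<mu>" "g \<in> borel_measurable \<mu>"
  shows "(\<integral>\<^sup>+x. ennreal (cmod (f x)) * ennreal (cmod (g x)) \<partial>\<mu>) \<le> norm2 f * norm2 g"
proof (rule ennreal_power2_le_imp_le)
  show "(\<integral>\<^sup>+x. ennreal (cmod (f x)) * ennreal (cmod (g x)) \<partial>\<mu>)\<^sup>2 \<le> (norm2 f * norm2 g)\<^sup>2"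
    unfolding power_mult_distrib norm2_power2
    using Cauchy_Schwarz_nn_integral[of "\<lambda>x. ennreal (cmod (f x))" \<mu> "\<lambda>x. ennreal (cmod (g x))"]
    by (simp add: ennreal_power)
qed

lemma L2_mult_integrable:
  assumes f: "f \<in> L2" and g: "g \<in> L2"
  shows "integrable \<mu> (\<lambda>x. f x * g x)"
proof (rule integrableI_bounded)
  note [measurable] = L2_measurable[OF f] L2_measurable[OF g]
  show "(\<lambda>x. f x * g x) \<in> borel_measurable \<mu>" by measurable
  have "(\<integral>\<^sup>+x. ennreal (norm (f x * g x)) \<partial>\<mu>) \<le> norm2 f * norm2 g"
    using Cauchy_Schwarz_norm2[of f g] by (simp add: norm_mult ennreal_mult'')
  also have "\<dots> < \<infinity>" using f g by (simp add: L2_iff ennreal_mult_less_top)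
  finally show "(\<integral>\<^sup>+x. ennreal (norm (f x * g x)) \<partial>\<mu>) < \<infinity>" .
qed

lemma norm_integral_mult_le:
  assumes f: "f \<in> L2" and g: "g \<in> L2"
  shows "ennreal (cmod (LINT x|\<mu>. f x * g x)) \<le> norm2 f * norm2 g"
proof -
  note [measurable] = L2_measurable[OF f] L2_measurable[OF g]
  have "ennreal (cmod (LINT x|\<mu>. f x * g x)) \<le> (\<integral>\<^sup>+x. ennreal (norm (f x * g x)) \<partial>\<mu>)"
    by (rule integral_norm_bound_ennreal[OF L2_mult_integrable[OF f g]])
  also have "\<dots> \<le> norm2 f * norm2 g"
    using Cauchy_Schwarz_norm2[of f g] by (simp add: norm_mult ennreal_mult'')
  finally show ?thesis .
qed

lemma L2_add: "f \<in> L2 \<Longrightarrow> g \<in> L2 \<Longrightarrow> (\<lambda>x. f x + g x) \<in> L2"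
  using L2.cnorm_triangle[of f g] by (auto simp: L2_iff intro: le_less_trans)

lemma L2_cmult: "f \<in> L2 \<Longrightarrow> (\<lambda>x. c * f x) \<in> L2"
  using L2.cnorm_cmult[of f c] by (auto simp: L2_iff ennreal_mult_less_top)

lemma L2_diff: "f \<in> L2 \<Longrightarrow> g \<in> L2 \<Longrightarrow> (\<lambda>x. f x - g x) \<in> L2"
  using L2_add[of f "\<lambda>x. -1 * g x"] L2_cmult[of g "-1"] by simp

lemma L2_cnj:
  assumes "f \<in> L2" shows "(\<lambda>x. cnj (f x)) \<in> L2"
proof -
  have "continuous_on UNIV cnj" by (intro continuous_on_cnj continuous_on_id)
  then have "(\<lambda>x. cnj (f x)) \<in> borel_measurable \<mu>"
    using L2_measurable[OF assms] by (rule borel_measurable_continuous_on)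
  then show ?thesis using assms by (simp add: L2_iff_integrable)
qed

lemma L2_bound:
  assumes g: "g \<in> L2" and [measurable]: "f \<in> borel_measurable \<mu>"
    and le: "AE x in \<mu>. cmod (f x) \<le> c * cmod (g x)"
  shows "f \<in> L2"
proof -
  note [measurable] = L2_measurable[OF g]
  have "norm2 f \<le> norm2 (\<lambda>x. of_real c * g x)"
    unfolding L2.cnorm_def using le
    by (intro L2.norm_mono) (auto simp: norm_mult intro!: ennreal_leI elim!: eventually_mono
      intro: order_trans[OF _ mult_right_mono[OF abs_ge_self]])
  also have "\<dots> < \<infinity>" using L2_cmult[OF g] by (simp add: L2_iff)
  finally show ?thesis by (simp add: L2_iff)
qed

text \<open>The kernel of the transform is \<open>ker_even u - \<i> * ker_odd u\<close>.  Keeping its even and odd part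
  apart lets parity kill one of them against every Gaussian.\<close>

definition ker_even :: "real \<Rightarrow> real" where
  "ker_even u = bessel_power k (u\<^sup>2)"

definition ker_odd :: "real \<Rightarrow> real" where
  "ker_odd u = u * bessel_power (k + 1) (u\<^sup>2) / (2 * (k + 1))"

lemma kernel_minus_eq: "dunkl_kernel k (- \<i> * of_real u) = of_real (ker_even u) - \<i> * of_real (ker_odd u)"
proof -
  have "- \<i> * of_real u = \<i> * of_real (- u)" by simp
  then have "dunkl_kernel k (- \<i> * of_real u) = dunkl_kernel k (\<i> * of_real (- u))" by (simp only:)
  also have "\<dots> = of_real (ker_even u) - \<i> * of_real (ker_odd u)"
    unfolding dunkl_kernel_imaginary[OF k] by (simp add: complex_eq_iff ker_even_def ker_odd_def)
  finally show ?thesis .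
qed

lemma cmod_kernel_minus_le_1: "cmod (dunkl_kernel k (- \<i> * of_real u)) \<le> 1"
  using cmod_dunkl_kernel_imaginary_le_1[OF k, of "- u"] by simp

lemma continuous_ker_even: "continuous_on UNIV ker_even"
  unfolding ker_even_def[abs_def] using k by (intro continuous_on_bessel_power continuous_intros)

lemma continuous_ker_odd: "continuous_on UNIV ker_odd"
  unfolding ker_odd_def[abs_def] using k by (intro continuous_on_bessel_power continuous_intros) auto

lemma borel_ker_even [measurable]: "ker_even \<in> borel_measurable borel"
  by (intro borel_measurable_continuous_onI continuous_ker_even)

lemma borel_ker_odd [measurable]: "ker_odd \<in> borel_measurable borel"
  by (intro borel_measurable_continuous_onI continuous_ker_odd)

lemma borel_kernel_minus [measurable]: "(\<lambda>u. dunkl_kernel k (- \<i> * of_real u)) \<in> borel_measurable borel"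
  unfolding kernel_minus_eq by measurable

lemma borel_kernel_plus [measurable]: "(\<lambda>u. dunkl_kernel k (\<i> * of_real u)) \<in> borel_measurable borel"
  by (intro borel_measurable_continuous_onI continuous_dunkl_kernel_imaginary k)

lemma abs_ker_even_le_1: "\<bar>ker_even u\<bar> \<le> 1"
  using order_trans[OF abs_Re_le_cmod cmod_kernel_minus_le_1[of u]] unfolding kernel_minus_eq by simp

lemma abs_ker_odd_le_1: "\<bar>ker_odd u\<bar> \<le> 1"
  using order_trans[OF abs_Im_le_cmod cmod_kernel_minus_le_1[of u]] unfolding kernel_minus_eq by simp

lemma ker_even_uminus: "ker_even (- u) = ker_even u"
  by (simp add: ker_even_def)

lemma ker_odd_uminus: "ker_odd (- u) = - ker_odd u"
  by (simp add: ker_odd_def)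

text \<open>The Gaussian moment of \<open>x ^ (2 * n)\<close> is proportional to \<open>pochhammer (k + 1) n\<close>, which
  is what the coefficients of the kernel divide by.  So integrating the kernel against a Gaussian
  term by term leaves an exponential series.\<close>

lemma integral_power_series_Gaussian:
  assumes t: "0 < t"
    and c: "\<And>n. c n * (pochhammer (k + 1) (n + j) / t ^ (n + j)) = A * (z ^ n / fact n)"
    and sum: "\<And>v. summable (\<lambda>n. \<bar>c n * v ^ n\<bar>)"
  shows "(LINT x|\<mu>. (\<Sum>n. c n * (x\<^sup>2) ^ n) * (x ^ (2 * j) * exp (- t * x\<^sup>2))) =
    (2 * t) powr - (k + 1) * (A * exp z)"
proof -
  let ?C = "(2 * t) powr - (k + 1)"
  let ?f = "\<lambda>n x. c n * (x ^ (2 * (n + j)) * exp (- t * x\<^sup>2))"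
  have term_eq: "c n * (x\<^sup>2) ^ n * (x ^ (2 * j) * exp (- t * x\<^sup>2)) = ?f n x" for n x
    by (simp add: power_add power_mult distrib_left)
  have int: "integrable \<mu> (?f n)" for n
    by (intro integrable_mult_right integrable_power_Gaussian t)
  have val: "(LINT x|\<mu>. ?f n x) = ?C * (A * (z ^ n / fact n))" for n
    unfolding integral_mult_right_zero integral_power_Gaussian[OF t] c[symmetric] by simp
  have nval: "(LINT x|\<mu>. norm (?f n x)) = ?C * \<bar>A * (z ^ n / fact n)\<bar>" for n
  proof -
    have "(LINT x|\<mu>. norm (?f n x)) = (LINT x|\<mu>. \<bar>c n\<bar> * (x ^ (2 * (n + j)) * exp (- t * x\<^sup>2)))"
    proof (intro Bochner_Integration.integral_cong refl)
      fix x :: real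
      have "\<bar>x ^ (2 * (n + j))\<bar> = x ^ (2 * (n + j))" by (intro abs_of_nonneg zero_le_even_power')
      then show "norm (?f n x) = \<bar>c n\<bar> * (x ^ (2 * (n + j)) * exp (- t * x\<^sup>2))"
        by (simp only: real_norm_def abs_mult abs_exp_cancel)
    qed
    also have "\<dots> = \<bar>c n\<bar> * (?C * (pochhammer (k + 1) (n + j) / t ^ (n + j)))"
      unfolding integral_mult_right_zero integral_power_Gaussian[OF t] by simp
    also have "\<dots> = ?C * \<bar>c n * (pochhammer (k + 1) (n + j) / t ^ (n + j))\<bar>"
      using t pochhammer_pos'[OF k, of "n + j"] by (simp add: abs_mult)
    finally show ?thesis unfolding c .
  qed
  have "(LINT x|\<mu>. (\<Sum>n. c n * (x\<^sup>2) ^ n) * (x ^ (2 * j) * exp (- t * x\<^sup>2))) = (LINT x|\<mu>. (\<Sum>n. ?f n x))"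
    unfolding term_eq[symmetric]
    by (intro Bochner_Integration.integral_cong refl suminf_mult2 summable_rabs_cancel[OF sum])
  also have "\<dots> = (\<Sum>n. LINT x|\<mu>. ?f n x)"
  proof (rule integral_suminf[OF int])
    show "AE x in \<mu>. summable (\<lambda>n. norm (?f n x))"
    proof (intro AE_I2)
      fix x
      have "summable (\<lambda>n. \<bar>c n * (x\<^sup>2) ^ n\<bar> * \<bar>x ^ (2 * j) * exp (- t * x\<^sup>2)\<bar>)"
        by (intro summable_mult2 sum)
      then show "summable (\<lambda>n. norm (?f n x))"
        by (simp only: abs_mult[symmetric] term_eq real_norm_def)
    qed
    show "summable (\<lambda>n. LINT x|\<mu>. norm (?f n x))"
      unfolding nval by (intro summable_mult summable_exp_abs)
  qed
  also have "\<dots> = ?C * (A * (\<Sum>n. z ^ n / fact n))"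
  proof -
    have s: "summable (\<lambda>n. z ^ n / fact n)" using summable_exp[of z] by (simp add: field_simps)
    show ?thesis unfolding val by (simp only: suminf_mult[OF summable_mult[OF s]] suminf_mult[OF s])
  qed
  also have "(\<Sum>n. z ^ n / fact n) = exp z"
    by (simp add: exp_def field_simps)
  finally show ?thesis .
qed

lemma integral_ker_even_Gaussian:
  assumes t: "0 < t"
  shows "(LINT x|\<mu>. ker_even (l * x) * exp (- t * x\<^sup>2)) = (2 * t) powr - (k + 1) * exp (- (1 / (4 * t)) * l\<^sup>2)"
proof -
  let ?c = "\<lambda>n. bessel_coeff k n * (l\<^sup>2) ^ n"
  have "(LINT x|\<mu>. (\<Sum>n. ?c n * (x\<^sup>2) ^ n) * (x ^ (2 * 0) * exp (- t * x\<^sup>2))) =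
      (2 * t) powr - (k + 1) * (1 * exp (- (1 / (4 * t)) * l\<^sup>2))"
  proof (rule integral_power_series_Gaussian[OF t])
    fix n
    show "?c n * (pochhammer (k + 1) (n + 0) / t ^ (n + 0)) = 1 * ((- (1 / (4 * t)) * l\<^sup>2) ^ n / fact n)"
      using pochhammer_pos'[OF k, of n] t
      by (simp add: bessel_coeff_def power_mult_distrib power_divide power_minus[of "l\<^sup>2 / _"] power_minus[of "l\<^sup>2 / _" n])
  next
    fix v
    show "summable (\<lambda>n. \<bar>?c n * v ^ n\<bar>)"
      using summable_bessel_abs[OF k, of "l\<^sup>2 * v"] by (simp add: power_mult_distrib mult.assoc)
  qed
  then show ?thesis by (simp add: ker_even_def bessel_power_def power_mult_distrib mult.assoc)
qed

lemma integral_ker_odd_Gaussian: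
  assumes t: "0 < t"
  shows "(LINT x|\<mu>. ker_odd (l * x) * (x * exp (- t * x\<^sup>2))) =
    (2 * t) powr - (k + 2) * (l * exp (- (1 / (4 * t)) * l\<^sup>2))"
proof -
  have k1: "k + 1 > - 1 / 2" using k by simp
  let ?c = "\<lambda>n. bessel_coeff (k + 1) n * (l\<^sup>2) ^ n"
  let ?e = "exp (- (1 / (4 * t)) * l\<^sup>2)"
  have *: "(LINT x|\<mu>. (\<Sum>n. ?c n * (x\<^sup>2) ^ n) * (x ^ (2 * 1) * exp (- t * x\<^sup>2))) =
      (2 * t) powr - (k + 1) * ((k + 1) / t * ?e)"
  proof (rule integral_power_series_Gaussian[OF t])
    fix n
    show "?c n * (pochhammer (k + 1) (n + 1) / t ^ (n + 1)) = (k + 1) / t * ((- (1 / (4 * t)) * l\<^sup>2) ^ n / fact n)"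
      using pochhammer_pos'[OF k1, of n] t
      by (simp add: bessel_coeff_def pochhammer_rec power_mult_distrib power_divide
          power_minus[of "l\<^sup>2 / _"] power_minus[of "l\<^sup>2 / _" n] add_ac) (simp add: mult_ac)
  next
    fix v
    show "summable (\<lambda>n. \<bar>?c n * v ^ n\<bar>)"
      using summable_bessel_abs[OF k1, of "l\<^sup>2 * v"] by (simp add: power_mult_distrib mult.assoc)
  qed
  have "ker_odd (l * x) * (x * exp (- t * x\<^sup>2)) =
      l / (2 * (k + 1)) * ((\<Sum>n. ?c n * (x\<^sup>2) ^ n) * (x ^ (2 * 1) * exp (- t * x\<^sup>2)))" for x
    by (simp add: ker_odd_def bessel_power_def power_mult_distrib mult.assoc power2_eq_square mult.left_commute)
  then have "(LINT x|\<mu>. ker_odd (l * x) * (x * exp (- t * x\<^sup>2))) =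
      l / (2 * (k + 1)) * ((2 * t) powr - (k + 1) * ((k + 1) / t * ?e))"
    by (simp only: integral_mult_right_zero *)
  also have "\<dots> = (2 * t) powr - (k + 1) / (2 * t) * (l * ?e)"
  proof -
    have *: "l / (2 * a) * (P * (a / t * e)) = P / (2 * t) * (l * e)" if "a \<noteq> 0" for a P e :: real
      using that t by (simp add: field_simps)
    show ?thesis by (rule *) (use k in simp)
  qed
  also have "(2 * t) powr - (k + 1) / (2 * t) = (2 * t) powr (- (k + 1) - 1)"
    using t by (subst powr_diff, subst powr_one) simp_all
  also have "- (k + 1) - 1 = - (k + 2)" by simp
  finally show ?thesis .
qed

end

section \<open>The transform on the span of the Gaussians\<close>

context dunkl
begin

abbreviation "F \<equiv> dunkl_transform_L1 k"

definition gauss_even :: "real \<Rightarrow> real \<Rightarrow> complex" where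
  "gauss_even t x = of_real (exp (- t * x\<^sup>2))"

definition gauss_odd :: "real \<Rightarrow> real \<Rightarrow> complex" where
  "gauss_odd t x = of_real (x * exp (- t * x\<^sup>2))"

lemma borel_gauss [measurable]: "gauss_even t \<in> borel_measurable borel" "gauss_odd t \<in> borel_measurable borel"
  unfolding gauss_even_def[abs_def] gauss_odd_def[abs_def] by measurable

lemma integrable_gauss:
  assumes "0 < t" shows "integrable \<mu> (gauss_even t)" "integrable \<mu> (gauss_odd t)"
  using integrable_power_Gaussian[OF assms, of 0] integrable_power_Gaussian[OF assms, of 1]
  by (auto simp: gauss_even_def[abs_def] gauss_odd_def[abs_def] simp del: of_real_mult)

lemma integrable_bounded_mult:
  fixes f g :: "real \<Rightarrow> 'a::{real_normed_algebra, banach, second_countable_topology}"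
  assumes g: "integrable \<mu> g" and [measurable]: "f \<in> borel_measurable \<mu>" and le: "\<And>x. norm (f x) \<le> 1"
  shows "integrable \<mu> (\<lambda>x. f x * g x)"
proof (rule Bochner_Integration.integrable_bound[OF g])
  show "(\<lambda>x. f x * g x) \<in> borel_measurable \<mu>" using g by measurable
  have "norm (f x * g x) \<le> 1 * norm (g x)" for x
    by (rule order_trans[OF norm_mult_ineq mult_right_mono[OF le norm_ge_zero]])
  then show "AE x in \<mu>. norm (f x * g x) \<le> norm (g x)" by simp
qed

lemma F_integrable:
  assumes "integrable \<mu> f"
  shows "integrable \<mu> (\<lambda>x. dunkl_kernel k (- \<i> * of_real (l * x)) * f x)"
  by (intro integrable_bounded_mult[OF assms] borel_imp_measurable cmod_kernel_minus_le_1) measurable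

lemma F_add:
  assumes "integrable \<mu> f" "integrable \<mu> g"
  shows "F (\<lambda>x. f x + g x) = (\<lambda>l. F f l + F g l)"
  unfolding dunkl_transform_L1_def
  using F_integrable[OF assms(1)] F_integrable[OF assms(2)] by (simp add: distrib_left)

lemma F_cmult: "F (\<lambda>x. c * f x) = (\<lambda>l. c * F f l)"
  unfolding dunkl_transform_L1_def by (simp add: mult.left_commute[of _ c])

lemma F_real:
  assumes g: "integrable \<mu> g"
  shows "F (\<lambda>x. of_real (g x)) l =
    of_real (LINT x|\<mu>. ker_even (l * x) * g x) - \<i> * of_real (LINT x|\<mu>. ker_odd (l * x) * g x)"
proof -
  have e: "integrable \<mu> (\<lambda>x. ker_even (l * x) * g x)"
    by (intro integrable_bounded_mult[OF g] borel_imp_measurable) (auto simp: abs_ker_even_le_1)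
  have o: "integrable \<mu> (\<lambda>x. ker_odd (l * x) * g x)"
    by (intro integrable_bounded_mult[OF g] borel_imp_measurable) (auto simp: abs_ker_odd_le_1)
  have "F (\<lambda>x. of_real (g x)) l =
      (LINT x|\<mu>. of_real (ker_even (l * x) * g x) - \<i> * of_real (ker_odd (l * x) * g x))"
    unfolding dunkl_transform_L1_def kernel_minus_eq by (simp add: algebra_simps)
  also have "\<dots> = (LINT x|\<mu>. of_real (ker_even (l * x) * g x)) - (LINT x|\<mu>. \<i> * of_real (ker_odd (l * x) * g x))"
    using e o by (intro Bochner_Integration.integral_diff integrable_mult_right integrable_of_real)
  also have "\<dots> = of_real (LINT x|\<mu>. ker_even (l * x) * g x) - \<i> * of_real (LINT x|\<mu>. ker_odd (l * x) * g x)"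
    by (simp only: integral_mult_right_zero integral_complex_of_real)
  finally show ?thesis .
qed

lemma F_gauss_even:
  assumes t: "0 < t"
  shows "F (gauss_even t) = (\<lambda>l. of_real ((2 * t) powr - (k + 1)) * gauss_even (1 / (4 * t)) l)"
proof
  fix l
  have i: "integrable \<mu> (\<lambda>x. exp (- t * x\<^sup>2))" using integrable_power_Gaussian[OF t, of 0] by simp
  have "(LINT x|\<mu>. ker_odd (l * x) * exp (- t * x\<^sup>2)) = 0"
    by (rule integral_odd_eq_0) (auto simp: ker_odd_uminus)
  then show "F (gauss_even t) l = of_real ((2 * t) powr - (k + 1)) * gauss_even (1 / (4 * t)) l"
    unfolding gauss_even_def[abs_def] F_real[OF i] integral_ker_even_Gaussian[OF t] by simp
qed

lemma F_gauss_odd: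
  assumes t: "0 < t"
  shows "F (gauss_odd t) = (\<lambda>l. - \<i> * of_real ((2 * t) powr - (k + 2)) * gauss_odd (1 / (4 * t)) l)"
proof
  fix l
  have i: "integrable \<mu> (\<lambda>x. x * exp (- t * x\<^sup>2))" using integrable_power_Gaussian[OF t, of 1] by simp
  have "(LINT x|\<mu>. ker_even (l * x) * (x * exp (- t * x\<^sup>2))) = 0"
    by (rule integral_odd_eq_0) (auto simp: ker_even_uminus)
  then show "F (gauss_odd t) l = - \<i> * of_real ((2 * t) powr - (k + 2)) * gauss_odd (1 / (4 * t)) l"
    unfolding gauss_odd_def[abs_def] F_real[OF i] integral_ker_odd_Gaussian[OF t] by simp
qed

text \<open>On these functions everything about the transform is explicit: it maps a Gaussian with parameter
  \<open>t\<close> to a multiple of the one with parameter \<open>1 / (4 * t)\<close>.  So the span is mapped onto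
  itself.\<close>

inductive_set gauss_span :: "(real \<Rightarrow> complex) set" where
  even: "0 < t \<Longrightarrow> gauss_even t \<in> gauss_span"
| odd: "0 < t \<Longrightarrow> gauss_odd t \<in> gauss_span"
| add: "f \<in> gauss_span \<Longrightarrow> g \<in> gauss_span \<Longrightarrow> (\<lambda>x. f x + g x) \<in> gauss_span"
| scale: "f \<in> gauss_span \<Longrightarrow> (\<lambda>x. c * f x) \<in> gauss_span"

lemma gauss_span_borel: "d \<in> gauss_span \<Longrightarrow> d \<in> borel_measurable borel"
  by (induction rule: gauss_span.induct) auto

lemma gauss_span_measurable [measurable_dest]: "d \<in> gauss_span \<Longrightarrow> d \<in> borel_measurable \<mu>"
  by (intro borel_imp_measurable gauss_span_borel)

lemma gauss_span_integrable: "d \<in> gauss_span \<Longrightarrow> integrable \<mu> d"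
  by (induction rule: gauss_span.induct) (auto simp: integrable_gauss)

lemma gauss_span_L2: "d \<in> gauss_span \<Longrightarrow> d \<in> L2"
proof (induction rule: gauss_span.induct)
  case (even t)
  have "(cmod (gauss_even t x))\<^sup>2 = x ^ 0 * exp (- (2 * t) * x\<^sup>2)" for x
    by (simp add: gauss_even_def power2_eq_square flip: exp_add)
  then show ?case
    using integrable_power_Gaussian[of "2 * t" 0] even
    by (simp add: L2_iff_integrable borel_imp_measurable)
next
  case (odd t)
  have "(cmod (gauss_odd t x))\<^sup>2 = x ^ 2 * exp (- (2 * t) * x\<^sup>2)" for x
    by (simp add: gauss_odd_def norm_mult power_mult_distrib power2_eq_square[of "exp _"] flip: exp_add)
  then show ?case
    using integrable_power_Gaussian[of "2 * t" 2] odd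
    by (simp add: L2_iff_integrable borel_imp_measurable)
qed (auto intro: L2_add L2_cmult)

lemma gauss_span_diff: "f \<in> gauss_span \<Longrightarrow> g \<in> gauss_span \<Longrightarrow> (\<lambda>x. f x - g x) \<in> gauss_span"
  using gauss_span.add[OF _ gauss_span.scale[of g "-1"], of f] by simp

lemma gauss_span_cnj: "f \<in> gauss_span \<Longrightarrow> (\<lambda>x. cnj (f x)) \<in> gauss_span"
proof (induction rule: gauss_span.induct)
  case (even t) then show ?case using gauss_span.even[of t] by (simp add: gauss_even_def[abs_def])
next
  case (odd t) then show ?case using gauss_span.odd[of t] by (simp add: gauss_odd_def[abs_def])
qed (simp_all add: gauss_span.add gauss_span.scale)

lemma gauss_span_F: "d \<in> gauss_span \<Longrightarrow> F d \<in> gauss_span"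
proof (induction rule: gauss_span.induct)
  case (even t) then show ?case unfolding F_gauss_even[OF even] by (intro gauss_span.intros) simp
next
  case (odd t) then show ?case unfolding F_gauss_odd[OF odd] by (intro gauss_span.intros) simp
qed (simp_all add: F_add F_cmult gauss_span_integrable gauss_span.add gauss_span.scale)

lemma gauss_span_F_surj: "d \<in> gauss_span \<Longrightarrow> \<exists>e\<in>gauss_span. F e = d"
proof (induction rule: gauss_span.induct)
  case (even t)
  define s where "s = 1 / (4 * t)"
  define c where "c = complex_of_real ((2 * s) powr - (k + 1))"
  have s: "0 < s" "1 / (4 * s) = t" and c: "c \<noteq> 0" using even by (auto simp: s_def c_def)
  have "F (\<lambda>x. (1 / c) * gauss_even s x) = gauss_even t"
    unfolding F_cmult F_gauss_even[OF s(1)] s(2) c_def[symmetric] using c by simp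
  then show ?case using gauss_span.scale[OF gauss_span.even[OF s(1)]] by blast
next
  case (odd t)
  define s where "s = 1 / (4 * t)"
  define c where "c = - \<i> * complex_of_real ((2 * s) powr - (k + 2))"
  have s: "0 < s" "1 / (4 * s) = t" and c: "c \<noteq> 0" using odd by (auto simp: s_def c_def)
  have "F (\<lambda>x. (1 / c) * gauss_odd s x) = gauss_odd t"
    unfolding F_cmult F_gauss_odd[OF s(1)] s(2) c_def[symmetric] using c by simp
  then show ?case using gauss_span.scale[OF gauss_span.odd[OF s(1)]] by blast
next
  case (add f g)
  then obtain e h where "e \<in> gauss_span" "F e = f" "h \<in> gauss_span" "F h = g" by blast
  then show ?case
    by (intro bexI[of _ "\<lambda>x. e x + h x"] gauss_span.add) (auto simp: F_add gauss_span_integrable)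
next
  case (scale f c)
  then obtain e where "e \<in> gauss_span" "F e = f" by blast
  then show ?case by (intro bexI[of _ "\<lambda>x. c * e x"] gauss_span.scale) (auto simp: F_cmult)
qed

lemma integral_gauss_even_even:
  assumes "0 < s" "0 < t"
  shows "(LINT x|\<mu>. gauss_even s x * cnj (gauss_even t x)) = of_real ((2 * (s + t)) powr - (k + 1))"
proof -
  have "(LINT x|\<mu>. gauss_even s x * cnj (gauss_even t x)) = (LINT x|\<mu>. of_real (x ^ (2 * 0) * exp (- (s + t) * x\<^sup>2)))"
    by (intro Bochner_Integration.integral_cong)
      (auto simp: gauss_even_def algebra_simps simp flip: of_real_mult exp_add)
  also have "\<dots> = of_real ((2 * (s + t)) powr - (k + 1))"
    unfolding integral_complex_of_real using integral_power_Gaussian[of "s + t" 0] assms by simp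
  finally show ?thesis .
qed

lemma integral_gauss_odd_odd:
  assumes "0 < s" "0 < t"
  shows "(LINT x|\<mu>. gauss_odd s x * cnj (gauss_odd t x)) = of_real ((2 * (s + t)) powr - (k + 1) * (k + 1) / (s + t))"
proof -
  have "(LINT x|\<mu>. gauss_odd s x * cnj (gauss_odd t x)) = (LINT x|\<mu>. of_real (x ^ (2 * 1) * exp (- (s + t) * x\<^sup>2)))"
  proof (intro Bochner_Integration.integral_cong refl)
    fix x
    have "exp (- s * x\<^sup>2) * exp (- t * x\<^sup>2) = exp (- (s + t) * x\<^sup>2)"
      by (simp add: algebra_simps flip: exp_add)
    then have "(x * exp (- s * x\<^sup>2)) * (x * exp (- t * x\<^sup>2)) = x ^ (2 * 1) * exp (- (s + t) * x\<^sup>2)"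
      by (simp only: mult_ac) (simp add: power2_eq_square mult_ac)
    then show "gauss_odd s x * cnj (gauss_odd t x) = of_real (x ^ (2 * 1) * exp (- (s + t) * x\<^sup>2))"
      unfolding gauss_odd_def by (simp only: complex_cnj_complex_of_real of_real_mult[symmetric])
  qed
  also have "\<dots> = of_real ((2 * (s + t)) powr - (k + 1) * (k + 1) / (s + t))"
    unfolding integral_complex_of_real using integral_power_Gaussian[of "s + t" 1] assms by simp
  finally show ?thesis .
qed

lemma integral_gauss_even_odd:
  "(LINT x|\<mu>. gauss_even s x * cnj (gauss_odd t x)) = 0" "(LINT x|\<mu>. gauss_odd t x * cnj (gauss_even s x)) = 0"
  by (rule integral_odd_eq_0; simp add: gauss_even_def gauss_odd_def)+

text \<open>With \<open>T = (s + t) / (4 * s * t)\<close> the parameter of the product of the two transforms, the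
  scaling factors satisfy \<open>2 * s * (2 * t) * (2 * T) = 2 * (s + t)\<close>.\<close>

lemma gauss_scaling:
  fixes s t a :: real
  assumes "0 < s" "0 < t"
  shows "(2 * s) powr a * (2 * t) powr a * (2 * (1 / (4 * s) + 1 / (4 * t))) powr a = (2 * (s + t)) powr a"
proof -
  have "2 * s * (2 * t) * (2 * (1 / (4 * s) + 1 / (4 * t))) = 2 * (s + t)"
    using assms by (simp add: field_simps)
  then show ?thesis using assms by (simp flip: powr_mult)
qed

lemma integral_scaled_product:
  "(LINT l|\<mu>. (a * f l) * cnj (b * g l)) = (a * cnj b) * (LINT l|\<mu>. f l * cnj (g l))"
proof -
  have "(a * f l) * cnj (b * g l) = (a * cnj b) * (f l * cnj (g l))" for l by (simp add: mult_ac)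
  then show ?thesis by (simp only: integral_mult_right_zero)
qed

lemma F_isometry_even_even:
  assumes s: "0 < s" and t: "0 < t"
  shows "(LINT l|\<mu>. F (gauss_even s) l * cnj (F (gauss_even t) l)) = (LINT x|\<mu>. gauss_even s x * cnj (gauss_even t x))"
proof -
  have pos: "0 < 1 / (4 * s)" "0 < 1 / (4 * t)" using s t by auto
  show ?thesis
    unfolding F_gauss_even[OF s] F_gauss_even[OF t] integral_scaled_product integral_gauss_even_even[OF s t]
      integral_gauss_even_even[OF pos] complex_cnj_complex_of_real of_real_mult[symmetric] gauss_scaling[OF s t] ..
qed

lemma F_isometry_odd_odd:
  assumes s: "0 < s" and t: "0 < t"
  shows "(LINT l|\<mu>. F (gauss_odd s) l * cnj (F (gauss_odd t) l)) = (LINT x|\<mu>. gauss_odd s x * cnj (gauss_odd t x))"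
proof -
  have pos: "0 < 1 / (4 * s)" "0 < 1 / (4 * t)" using s t by auto
  let ?T = "1 / (4 * s) + 1 / (4 * t)" and ?p = "\<lambda>u. u powr - (k + 1)"
  have unit: "(- \<i> * of_real a) * cnj (- \<i> * of_real b) = of_real (a * b)" for a b
    by (simp add: complex_eq_iff)
  have p: "u powr - (k + 2) = ?p u / u" if "0 < u" for u :: real
  proof -
    have "- (k + 2) = - (k + 1) - 1" by simp
    then show ?thesis using that by (simp only: powr_diff powr_one)
  qed
  have "(2 * s) * (2 * t) * ?T = s + t" using s t by (simp add: field_simps)
  then have "?p (2 * (s + t)) * (k + 1) / (s + t) =
      (?p (2 * s) * ?p (2 * t) * ?p (2 * ?T)) * (k + 1) / ((2 * s) * (2 * t) * ?T)"
    unfolding gauss_scaling[OF s t] by (simp only:)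
  also have "\<dots> = (2 * s) powr - (k + 2) * (2 * t) powr - (k + 2) * (?p (2 * ?T) * (k + 1) / ?T)"
  proof -
    have "(A * B * C) * K / (S * T * U) = A / S * (B / T) * (C * K / U)" for A B C K S T U :: real
      by simp
    then show ?thesis using p[of "2 * s"] p[of "2 * t"] s t by (simp only: mult_pos_pos zero_less_numeral)
  qed
  finally show ?thesis
    unfolding F_gauss_odd[OF s] F_gauss_odd[OF t] integral_scaled_product integral_gauss_odd_odd[OF s t]
      integral_gauss_odd_odd[OF pos] unit of_real_mult[symmetric] by (simp only:)
qed

lemma F_isometry_even_odd:
  assumes s: "0 < s" and t: "0 < t"
  shows "(LINT l|\<mu>. F (gauss_even s) l * cnj (F (gauss_odd t) l)) = (LINT x|\<mu>. gauss_even s x * cnj (gauss_odd t x))"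
    "(LINT l|\<mu>. F (gauss_odd t) l * cnj (F (gauss_even s) l)) = (LINT x|\<mu>. gauss_odd t x * cnj (gauss_even s x))"
  unfolding F_gauss_even[OF s] F_gauss_odd[OF t] integral_scaled_product integral_gauss_even_odd by simp_all

text \<open>Both sides are sesquilinear, so the four cases of generators suffice; the mixed ones vanish by
  parity.\<close>

lemma F_isometry_inner:
  assumes "d \<in> gauss_span" "e \<in> gauss_span"
  shows "(LINT l|\<mu>. F d l * cnj (F e l)) = (LINT x|\<mu>. d x * cnj (e x))"
proof -
  note int = L2_mult_integrable[OF gauss_span_L2 gauss_span_L2[OF gauss_span_cnj]]
  note Fint = int[OF gauss_span_F gauss_span_F]
  have gen: "0 < t \<Longrightarrow> (LINT l|\<mu>. F d l * cnj (F (gauss_even t) l)) = (LINT x|\<mu>. d x * cnj (gauss_even t x))"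
    "0 < t \<Longrightarrow> (LINT l|\<mu>. F d l * cnj (F (gauss_odd t) l)) = (LINT x|\<mu>. d x * cnj (gauss_odd t x))" for t
    using assms(1)
  proof (induction rule: gauss_span.induct)
    case (even s)
    { case 1 then show ?case by (intro F_isometry_even_even even)
    next
      case 2 then show ?case by (intro F_isometry_even_odd even) }
  next
    case (odd s)
    { case 1 then show ?case by (intro F_isometry_even_odd odd)
    next
      case 2 then show ?case by (intro F_isometry_odd_odd odd) }
  next
    case (add f g)
    have fg: "f \<in> gauss_span" "g \<in> gauss_span" by fact+
    have sum: "(LINT x|\<mu>. (f x + g x) * cnj (h x)) = (LINT x|\<mu>. f x * cnj (h x)) + (LINT x|\<mu>. g x * cnj (h x))"
      "(LINT x|\<mu>. F (\<lambda>x. f x + g x) x * cnj (F h x)) = (LINT x|\<mu>. F f x * cnj (F h x)) + (LINT x|\<mu>. F g x * cnj (F h x))"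
      if "h \<in> gauss_span" for h
      using int[OF fg(1) that] int[OF fg(2) that] Fint[OF fg(1) that] Fint[OF fg(2) that]
      by (simp_all add: F_add gauss_span_integrable fg distrib_right)
    { case 1 then show ?case using add sum[of "gauss_even t"] by (simp add: gauss_span.even)
    next
      case 2 then show ?case using add sum[of "gauss_odd t"] by (simp add: gauss_span.odd) }
  next
    case (scale f c)
    { case 1 then show ?case using scale by (simp add: F_cmult mult.assoc)
    next
      case 2 then show ?case using scale by (simp add: F_cmult mult.assoc) }
  qed
  show ?thesis
    using assms(2)
  proof (induction rule: gauss_span.induct)
    case (add f g)
    show ?case
      using int[OF assms(1) add(1)] int[OF assms(1) add(2)] Fint[OF assms(1) add(1)] Fint[OF assms(1) add(2)] add
      by (simp add: F_add gauss_span_integrable distrib_left)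
  next
    case (scale f c)
    then show ?case by (simp add: F_cmult mult.left_commute[of _ "cnj c"])
  qed (use gen in auto)
qed

lemma L2_power2_integral:
  assumes f: "f \<in> L2"
  shows "(norm2 f)\<^sup>2 = ennreal (cmod (LINT x|\<mu>. f x * cnj (f x)))"
proof -
  have i: "integrable \<mu> (\<lambda>x. (cmod (f x))\<^sup>2)" using f by (simp add: L2_iff_integrable)
  have "(LINT x|\<mu>. f x * cnj (f x)) = of_real (LINT x|\<mu>. (cmod (f x))\<^sup>2)"
    unfolding complex_norm_square[symmetric] by (rule integral_complex_of_real)
  moreover have "(norm2 f)\<^sup>2 = ennreal (LINT x|\<mu>. (cmod (f x))\<^sup>2)"
    unfolding norm2_power2 by (rule nn_integral_eq_integral[OF i]) simp
  moreover have "0 \<le> (LINT x|\<mu>. (cmod (f x))\<^sup>2)" by simp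
  ultimately show ?thesis by (simp only: norm_of_real abs_of_nonneg)
qed

lemma norm2_F_gauss_span:
  assumes d: "d \<in> gauss_span" shows "norm2 (F d) = norm2 d"
proof -
  have eq: "(norm2 (F d))\<^sup>2 = (norm2 d)\<^sup>2"
    unfolding L2_power2_integral[OF gauss_span_L2[OF d]]
      L2_power2_integral[OF gauss_span_L2[OF gauss_span_F[OF d]]] F_isometry_inner[OF d d] ..
  show ?thesis
    by (rule antisym; rule ennreal_power2_le_imp_le; simp only: eq order_refl)
qed

end

section \<open>Density of the span of the Gaussians\<close>

lemma tendsto_0_of_power2:
  fixes u :: "nat \<Rightarrow> ennreal"
  assumes "(\<lambda>n. (u n)\<^sup>2) \<longlonglongrightarrow> 0" shows "u \<longlonglongrightarrow> 0"
proof (rule order_tendstoI)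
  fix e :: ennreal assume e: "0 < e"
  then have "0 < e\<^sup>2" by (simp add: zero_less_iff_neq_zero)
  then have "eventually (\<lambda>n. (u n)\<^sup>2 < e\<^sup>2) sequentially"
    using order_tendstoD(2)[OF assms] by simp
  then show "eventually (\<lambda>n. u n < e) sequentially"
  proof eventually_elim
    fix n assume "(u n)\<^sup>2 < e\<^sup>2"
    then show "u n < e" by (meson not_less power_mono zero_le)
  qed
qed simp

context dunkl
begin

lemma norm2_dominated_convergence:
  fixes u :: "nat \<Rightarrow> real \<Rightarrow> complex"
  assumes [measurable]: "\<And>n. u n \<in> borel_measurable \<mu>"
    and lim: "AE x in \<mu>. (\<lambda>n. u n x) \<longlonglongrightarrow> 0"
    and w: "integrable \<mu> (\<lambda>x. (w x)\<^sup>2)" and le: "\<And>n. AE x in \<mu>. cmod (u n x) \<le> w x"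
  shows "(\<lambda>n. norm2 (u n)) \<longlonglongrightarrow> 0"
proof (rule tendsto_0_of_power2)
  have "(\<lambda>n. \<integral>\<^sup>+x. ennreal ((cmod (u n x))\<^sup>2) \<partial>\<mu>) \<longlonglongrightarrow> (\<integral>\<^sup>+x. 0 \<partial>\<mu>)"
  proof (rule nn_integral_dominated_convergence)
    show "(\<lambda>x. ennreal ((w x)\<^sup>2)) \<in> borel_measurable \<mu>" using w by measurable
    show "AE x in \<mu>. ennreal ((cmod (u n x))\<^sup>2) \<le> ennreal ((w x)\<^sup>2)" for n
      using le[of n] by eventually_elim (auto intro!: ennreal_leI power_mono)
    show "(\<integral>\<^sup>+x. ennreal ((w x)\<^sup>2) \<partial>\<mu>) < \<infinity>"
      using w by (simp add: nn_integral_eq_integral)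
    show "AE x in \<mu>. (\<lambda>n. ennreal ((cmod (u n x))\<^sup>2)) \<longlonglongrightarrow> 0"
      using lim
    proof eventually_elim
      fix x assume "(\<lambda>n. u n x) \<longlonglongrightarrow> 0"
      then have "(\<lambda>n. ennreal ((cmod (u n x))\<^sup>2)) \<longlonglongrightarrow> ennreal ((cmod 0)\<^sup>2)"
        by (intro tendsto_intros)
      then show "(\<lambda>n. ennreal ((cmod (u n x))\<^sup>2)) \<longlonglongrightarrow> 0" by simp
    qed
  qed measurable
  then show "(\<lambda>n. (norm2 (u n))\<^sup>2) \<longlonglongrightarrow> 0" by (simp add: norm2_power2)
qed

definition approximable :: "(real \<Rightarrow> complex) \<Rightarrow> bool" where
  "approximable f \<longleftrightarrow> f \<in> borel_measurable \<mu> \<and>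
     (\<forall>e::real>0. \<exists>d\<in>gauss_span. norm2 (\<lambda>x. f x - d x) < ennreal e)"

lemma approximable_measurable: "approximable f \<Longrightarrow> f \<in> borel_measurable \<mu>"
  by (simp add: approximable_def)

lemma norm2_less_add:
  assumes [measurable]: "f \<in> borel_measurable \<mu>" "g \<in> borel_measurable \<mu>"
    and "norm2 f < ennreal (e / 2)" "norm2 g < ennreal (e / 2)" "0 < e"
  shows "norm2 (\<lambda>x. f x + g x) < ennreal e"
proof -
  have "norm2 (\<lambda>x. f x + g x) \<le> norm2 f + norm2 g" by (rule L2.cnorm_triangle) measurable
  also have "\<dots> < ennreal (e / 2) + ennreal (e / 2)" using assms by (intro add_strict_mono)
  also have "\<dots> = ennreal e" using assms by (simp flip: ennreal_plus)
  finally show ?thesis .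
qed

lemma approximable_close:
  assumes [measurable]: "f \<in> borel_measurable \<mu>"
    and ex: "\<And>e::real. 0 < e \<Longrightarrow> \<exists>g. approximable g \<and> norm2 (\<lambda>x. f x - g x) < ennreal e"
  shows "approximable f"
  unfolding approximable_def
proof (intro conjI allI impI)
  fix e :: real assume e: "0 < e"
  obtain g where g: "approximable g" "norm2 (\<lambda>x. f x - g x) < ennreal (e / 2)"
    using ex[of "e / 2"] e by auto
  obtain d where d: "d \<in> gauss_span" "norm2 (\<lambda>x. g x - d x) < ennreal (e / 2)"
    using g e unfolding approximable_def by (metis half_gt_zero)
  note [measurable] = approximable_measurable[OF g(1)] gauss_span_measurable[OF d(1)]
  have "norm2 (\<lambda>x. (f x - g x) + (g x - d x)) < ennreal e"
    by (rule norm2_less_add) (use g d e in auto)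
  then show "\<exists>d\<in>gauss_span. norm2 (\<lambda>x. f x - d x) < ennreal e" using d by auto
qed fact

lemma approximable_add:
  assumes f: "approximable f" and g: "approximable g"
  shows "approximable (\<lambda>x. f x + g x)"
  unfolding approximable_def
proof (intro conjI allI impI)
  note [measurable] = approximable_measurable[OF f] approximable_measurable[OF g]
  show "(\<lambda>x. f x + g x) \<in> borel_measurable \<mu>" by measurable
  fix e :: real assume e: "0 < e"
  obtain d where d: "d \<in> gauss_span" "norm2 (\<lambda>x. f x - d x) < ennreal (e / 2)"
    using f e unfolding approximable_def by (metis half_gt_zero)
  obtain d' where d': "d' \<in> gauss_span" "norm2 (\<lambda>x. g x - d' x) < ennreal (e / 2)"
    using g e unfolding approximable_def by (metis half_gt_zero)
  note [measurable] = gauss_span_measurable[OF d(1)] gauss_span_measurable[OF d'(1)]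
  have "norm2 (\<lambda>x. (f x - d x) + (g x - d' x)) < ennreal e"
    by (rule norm2_less_add) (use d d' e in auto)
  then show "\<exists>d\<in>gauss_span. norm2 (\<lambda>x. f x + g x - d x) < ennreal e"
    using d d' by (intro bexI[of _ "\<lambda>x. d x + d' x"] gauss_span.add) (auto simp: algebra_simps)
qed

lemma approximable_ii:
  assumes f: "approximable f" shows "approximable (\<lambda>x. \<i> * f x)"
  unfolding approximable_def
proof (intro conjI allI impI)
  note [measurable] = approximable_measurable[OF f]
  show "(\<lambda>x. \<i> * f x) \<in> borel_measurable \<mu>" by measurable
  fix e :: real assume e: "0 < e"
  obtain d where d: "d \<in> gauss_span" "norm2 (\<lambda>x. f x - d x) < ennreal e"
    using f e unfolding approximable_def by blast
  note [measurable] = gauss_span_measurable[OF d(1)]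
  have "norm2 (\<lambda>x. \<i> * (f x - d x)) = norm2 (\<lambda>x. f x - d x)"
    by (subst L2.cnorm_cmult) auto
  then show "\<exists>d\<in>gauss_span. norm2 (\<lambda>x. \<i> * f x - d x) < ennreal e"
    using d by (intro bexI[of _ "\<lambda>x. \<i> * d x"] gauss_span.scale) (auto simp: right_diff_distrib)
qed

lemma approximable_dominated:
  assumes s: "\<And>n::nat. approximable (s n)" and f[measurable]: "f \<in> borel_measurable \<mu>"
    and lim: "AE x in \<mu>. (\<lambda>n. s n x) \<longlonglongrightarrow> f x"
    and w: "integrable \<mu> (\<lambda>x. (w x)\<^sup>2)" and le: "\<And>n. AE x in \<mu>. cmod (f x - s n x) \<le> w x"
  shows "approximable f"
proof (rule approximable_close[OF f])
  fix e :: real assume e: "0 < e"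
  note [measurable] = approximable_measurable[OF s]
  have "(\<lambda>n. norm2 (\<lambda>x. f x - s n x)) \<longlonglongrightarrow> 0"
  proof (rule norm2_dominated_convergence[OF _ _ w le])
    show "AE x in \<mu>. (\<lambda>n. f x - s n x) \<longlonglongrightarrow> 0"
      using lim
    proof eventually_elim
      fix x assume "(\<lambda>n. s n x) \<longlonglongrightarrow> f x"
      from tendsto_diff[OF tendsto_const[of "f x"] this] show "(\<lambda>n. f x - s n x) \<longlonglongrightarrow> 0" by simp
    qed
  qed measurable
  then have "eventually (\<lambda>n. norm2 (\<lambda>x. f x - s n x) < ennreal e) sequentially"
    using e by (intro order_tendstoD(2)) auto
  then show "\<exists>g. approximable g \<and> norm2 (\<lambda>x. f x - g x) < ennreal e"
    using s by (auto simp: eventually_sequentially)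
qed

lemma gauss_span_sum:
  assumes "finite I" "\<And>i. i \<in> I \<Longrightarrow> h i \<in> gauss_span"
  shows "(\<lambda>x. \<Sum>i\<in>I. c i * h i x) \<in> gauss_span"
  using assms
proof (induction I rule: finite_induct)
  case empty
  show ?case using gauss_span.scale[OF gauss_span.even[of 1], of 0] by simp
next
  case (insert i I)
  then show ?case using gauss_span.add[OF gauss_span.scale[of "h i" "c i"]] by simp
qed

text \<open>In the variable \<open>v = exp (- x\<^sup>2)\<close> the functions \<open>exp (- (n + 1) * x\<^sup>2)\<close> are the monomials
  \<open>v ^ (n + 1)\<close>.  A profile \<open>a (x\<^sup>2)\<close> that vanishes far out is \<open>v * \<phi> v\<close> with \<open>\<phi>\<close> continuous on
  \<open>{0..1}\<close>, so approximating \<open>\<phi>\<close> uniformly by a polynomial leaves an error below \<open>e * v\<close>, which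
  is small in norm.\<close>

lemma approximable_profile:
  fixes a y :: "real \<Rightarrow> real"
  assumes y: "\<And>t. 0 < t \<Longrightarrow> (\<lambda>x. of_real (y x * exp (- t * x\<^sup>2))) \<in> gauss_span"
    and y_borel[measurable]: "y \<in> borel_measurable borel"
    and a: "continuous_on UNIV a" and a0: "\<And>v. b \<le> v \<Longrightarrow> a v = 0"
  shows "approximable (\<lambda>x. of_real (y x * a (x\<^sup>2)))"
  unfolding approximable_def
proof (intro conjI allI impI)
  have [measurable]: "a \<in> borel_measurable borel" by (rule borel_measurable_continuous_onI[OF a])
  have [measurable]: "(\<lambda>x. complex_of_real (y x * a (x\<^sup>2))) \<in> borel_measurable borel" by measurable
  show "(\<lambda>x. complex_of_real (y x * a (x\<^sup>2))) \<in> borel_measurable \<mu>"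
    by (rule borel_imp_measurable) measurable
  fix e :: real assume e: "0 < e"
  define g where "g x = complex_of_real (y x * exp (- 1 * x\<^sup>2))" for x
  have g: "g \<in> gauss_span" unfolding g_def by (rule y) simp
  obtain B where B: "norm2 g = ennreal B" "0 \<le> B"
    using gauss_span_L2[OF g] by (cases "norm2 g") (auto simp: L2_iff)
  define r where "r = e / (B + 1)"
  have r: "0 < r" "r * B < e" using e B by (auto simp: r_def field_simps)
  \<comment> \<open>Below \<open>exp (- b)\<close> the profile vanishes, so freezing the argument there avoids \<open>ln 0\<close> and the
    division by \<open>0\<close>.\<close>
  define m where "m v = max v (exp (- b))" for v
  have m: "0 < m v" for v by (simp add: m_def less_max_iff_disj)
  define \<phi> where "\<phi> v = a (- ln (m v)) / m v" for v
  have "continuous_on UNIV m" unfolding m_def by (intro continuous_intros)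
  then have "continuous_on {0..1} m" by (rule continuous_on_subset) simp
  then have "continuous_on {0..1} \<phi>"
    unfolding \<phi>_def using m
    by (intro continuous_on_divide continuous_on_compose2[OF a] continuous_intros) (auto simp: less_imp_neq[THEN not_sym])
  then obtain P where P: "real_polynomial_function P" "\<And>v. v \<in> {0..1} \<Longrightarrow> \<bar>\<phi> v - P v\<bar> < r"
    using Stone_Weierstrass_real_polynomial_function[of "{0..1}" \<phi> r] r by auto
  obtain c n where c: "P = (\<lambda>v. \<Sum>i\<le>n. c i * v ^ i)"
    using P(1) unfolding real_polynomial_function_iff_sum by blast
  let ?h = "\<lambda>i x. complex_of_real (y x * exp (- real (Suc i) * x\<^sup>2))"
  define d where "d x = (\<Sum>i\<le>n. of_real (c i) * ?h i x)" for x
  have d: "d \<in> gauss_span" unfolding d_def by (intro gauss_span_sum y) auto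
  have v\<phi>: "v * \<phi> v = a (- ln v)" if v: "0 < v" for v
  proof (cases "exp (- b) \<le> v")
    case True then show ?thesis using v by (simp add: \<phi>_def m_def)
  next
    case False
    then have "m v = exp (- b)" by (simp add: m_def)
    then have "\<phi> v = 0" using a0[of b] by (simp add: \<phi>_def)
    moreover have "ln v \<le> - b" using False v by (metis exp_ln_iff ln_exp ln_le_cancel_iff not_less exp_gt_zero less_imp_le)
    ultimately show ?thesis using a0 by simp
  qed
  have bound: "cmod (of_real (y x * a (x\<^sup>2)) - d x) \<le> cmod (of_real r * g x)" for x
  proof -
    let ?v = "exp (- 1 * x\<^sup>2)"
    have "d x = of_real (y x * (?v * P ?v))"
    proof -
      have "exp (- real (Suc i) * x\<^sup>2) = ?v * ?v ^ i" for i
        by (simp add: algebra_simps exp_add[symmetric] flip: exp_of_nat_mult)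
      then show ?thesis
        unfolding d_def c by (simp add: sum_distrib_left mult_ac)
    qed
    moreover have "a (x\<^sup>2) = ?v * \<phi> ?v" using v\<phi>[of ?v] by simp
    ultimately have "of_real (y x * a (x\<^sup>2)) - d x = of_real (y x * ?v * (\<phi> ?v - P ?v))"
      by (simp add: algebra_simps)
    then have "cmod (of_real (y x * a (x\<^sup>2)) - d x) = \<bar>y x * ?v\<bar> * \<bar>\<phi> ?v - P ?v\<bar>"
      by (simp only: norm_of_real abs_mult)
    also have "\<dots> \<le> \<bar>y x * ?v\<bar> * r"
      using P(2)[of ?v] by (intro mult_left_mono) auto
    finally show ?thesis using r unfolding g_def by (simp only: norm_mult norm_of_real) (simp add: abs_mult mult_ac)
  qed
  note [measurable] = gauss_span_borel[OF d] gauss_span_borel[OF g]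
  have "norm2 (\<lambda>x. of_real (y x * a (x\<^sup>2)) - d x) \<le> norm2 (\<lambda>x. of_real r * g x)"
    unfolding L2.cnorm_def
    by (intro L2.norm_mono AE_I2 ennreal_leI bound borel_imp_measurable) measurable
  also have "\<dots> = ennreal (r * B)"
    using gauss_span_measurable[OF g] r B by (simp add: L2.cnorm_cmult ennreal_mult'')
  also have "\<dots> < ennreal e" using r e by (intro ennreal_lessI)
  finally show "\<exists>d\<in>gauss_span. norm2 (\<lambda>x. of_real (y x * a (x\<^sup>2)) - d x) < ennreal e"
    using d by blast
qed

text \<open>The even part of \<open>f\<close> has the form \<open>a (x\<^sup>2)\<close> and the odd part the form \<open>x * b (x\<^sup>2)\<close>.  Since \<open>f\<close> vanishes
  near \<open>0\<close>, the division by \<open>x\<close> that defines \<open>b\<close> can be stopped at \<open>r\<close>.\<close>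

lemma approximable_continuous:
  fixes f :: "real \<Rightarrow> real"
  assumes f: "continuous_on UNIV f" and r: "0 < r"
    and f0: "\<And>x. \<bar>x\<bar> \<le> r \<Longrightarrow> f x = 0" "\<And>x. R \<le> \<bar>x\<bar> \<Longrightarrow> f x = 0"
  shows "approximable (\<lambda>x. of_real (f x))"
proof -
  define a where "a v = (f (sqrt v) + f (- sqrt v)) / 2" for v
  define b where "b v = (f (sqrt v) - f (- sqrt v)) / (2 * max r (sqrt v))" for v
  have cont: "continuous_on UNIV (\<lambda>v. f (sqrt v))" "continuous_on UNIV (\<lambda>v. f (- sqrt v))"
    by (intro continuous_on_compose2[OF f] continuous_intros; simp)+
  have far: "f (sqrt v) = 0" "f (- sqrt v) = 0" if "R\<^sup>2 \<le> v" for v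
  proof -
    have "R \<le> \<bar>sqrt v\<bar>" using that real_le_rsqrt[OF that] by linarith
    then show "f (sqrt v) = 0" "f (- sqrt v) = 0" using f0(2) by simp_all
  qed
  have "approximable (\<lambda>x. of_real (1 * a (x\<^sup>2)))"
  proof (rule approximable_profile[where b = "R\<^sup>2"])
    show "continuous_on UNIV a" unfolding a_def by (intro continuous_intros cont) simp
    show "(\<lambda>x. of_real (1 * exp (- t * x\<^sup>2))) \<in> gauss_span" if "0 < t" for t
      using gauss_span.even[OF that] by (simp add: gauss_even_def[abs_def])
  qed (auto simp: a_def far)
  moreover have "approximable (\<lambda>x. of_real (x * b (x\<^sup>2)))"
  proof (rule approximable_profile[where b = "R\<^sup>2"])
    show "continuous_on UNIV b" unfolding b_def using r by (intro continuous_intros cont) auto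
    show "(\<lambda>x. of_real (x * exp (- t * x\<^sup>2))) \<in> gauss_span" if "0 < t" for t
      using gauss_span.odd[OF that] by (simp add: gauss_odd_def[abs_def])
  qed (auto simp: b_def far)
  ultimately have "approximable (\<lambda>x. of_real (1 * a (x\<^sup>2)) + of_real (x * b (x\<^sup>2)))"
    by (rule approximable_add)
  moreover have "1 * a (x\<^sup>2) + x * b (x\<^sup>2) = f x" for x
  proof (cases "\<bar>x\<bar> \<le> r")
    case True then show ?thesis using f0(1) by (simp add: a_def b_def)
  next
    case False then show ?thesis using r
      by (cases "0 \<le> x") (auto simp: a_def b_def max_def field_simps)
  qed
  ultimately show ?thesis by (simp only: of_real_add[symmetric])
qed

text \<open>A measurable function is an almost everywhere limit of continuous ones.  Clamping them to \<open>[- C, C]\<close> keeps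
  them dominated, and \<open>cut n\<close> makes them vanish within \<open>1 / (n + 1)\<close> of \<open>0\<close> and beyond \<open>R + 1\<close>.\<close>

lemma approximable_bounded:
  fixes f :: "real \<Rightarrow> real"
  assumes f[measurable]: "f \<in> borel_measurable \<mu>" and bd: "\<And>x. \<bar>f x\<bar> \<le> C" and f0: "\<And>x. R < \<bar>x\<bar> \<Longrightarrow> f x = 0"
  shows "approximable (\<lambda>x. of_real (f x))"
proof -
  have C: "0 \<le> C" using bd[of 0] by simp
  have "f \<in> borel_measurable lebesgue" using f unfolding measurable_cong_sets[OF sets_dunkl refl] .
  then have "f measurable_on UNIV" by (rule lebesgue_measurable_imp_measurable_on) simp
  then obtain N g where N: "negligible N" and g: "\<And>n. continuous_on UNIV (g n)"
    and lim: "\<And>x. x \<notin> N \<Longrightarrow> (\<lambda>n. g n x) \<longlonglongrightarrow> f x"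
    unfolding measurable_on_def by auto
  define cut where "cut n x = max 0 (min 1 (min (real (Suc n) * \<bar>x\<bar> - 1) (R + 1 - \<bar>x\<bar>)))" for n x
  define s where "s n x = max (- C) (min C (g n x)) * cut n x" for n x
  have "approximable (\<lambda>x. of_real (s n x))" for n
  proof (rule approximable_continuous[where r = "1 / real (Suc n)" and R = "R + 1"])
    show "continuous_on UNIV (s n)" unfolding s_def cut_def by (intro continuous_intros g)
    fix x :: real
    show "s n x = 0" if "\<bar>x\<bar> \<le> 1 / real (Suc n)"
    proof -
      have "real (Suc n) * \<bar>x\<bar> - 1 \<le> 0" using that by (simp add: field_simps)
      then have "cut n x = 0" unfolding cut_def by linarith
      then show ?thesis by (simp add: s_def)
    qed
    show "s n x = 0" if "R + 1 \<le> \<bar>x\<bar>"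
    proof -
      have "cut n x = 0" unfolding cut_def using that by linarith
      then show ?thesis by (simp add: s_def)
    qed
  qed simp
  then show ?thesis
  proof (rule approximable_dominated[where w = "\<lambda>x. 2 * C * indicator {- (R + 1)..R + 1} x"])
    have "N \<in> null_sets lebesgue" using N by (simp add: negligible_iff_null_sets)
    then have "AE x in lebesgue. x \<notin> N" by (rule AE_not_in)
    moreover have "AE x in lebesgue. x \<noteq> (0::real)" by (intro AE_completion AE_lborel_singleton)
    ultimately show "AE x in \<mu>. (\<lambda>n. complex_of_real (s n x)) \<longlonglongrightarrow> of_real (f x)"
      unfolding AE_dunkl_iff
    proof eventually_elim
      fix x assume x: "x \<notin> N" "x \<noteq> 0"
      let ?c = "max 0 (min 1 (R + 1 - \<bar>x\<bar>))"
      have "(\<lambda>n. cut n x) \<longlonglongrightarrow> ?c"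
      proof (rule tendsto_eventually)
        obtain n0 :: nat where n0: "2 / \<bar>x\<bar> \<le> n0" using real_arch_simple by blast
        show "eventually (\<lambda>n. cut n x = ?c) sequentially"
          using eventually_ge_at_top[of n0]
        proof eventually_elim
          fix n assume "n0 \<le> n"
          then have "2 / \<bar>x\<bar> \<le> real (Suc n)" using n0 by linarith
          then have "2 \<le> real (Suc n) * \<bar>x\<bar>" using x by (simp add: field_simps)
          then show "cut n x = ?c" unfolding cut_def by linarith
        qed
      qed
      then have "(\<lambda>n. s n x) \<longlonglongrightarrow> max (- C) (min C (f x)) * ?c"
        unfolding s_def by (intro tendsto_intros lim x)
      moreover have "max (- C) (min C (f x)) * ?c = f x"
        using bd[of x] f0[of x] C by (cases "\<bar>x\<bar> \<le> R") (auto simp: max_def min_def)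
      ultimately have "(\<lambda>n. s n x) \<longlonglongrightarrow> f x" by simp
      then show "(\<lambda>n. complex_of_real (s n x)) \<longlonglongrightarrow> of_real (f x)" by (intro tendsto_intros)
    qed
    have "integrable \<mu> (\<lambda>x. (2 * C)\<^sup>2 * indicator {- (R + 1)..R + 1} x)"
      using emeasure_interval_finite[of "R + 1"]
      by (intro integrable_mult_right integrable_real_indicator) (auto simp: sets_dunkl)
    then show "integrable \<mu> (\<lambda>x. (2 * C * indicator {- (R + 1)..R + 1} x)\<^sup>2)"
      by (rule Bochner_Integration.integrable_cong[THEN iffD1, rotated -1]) (auto simp: indicator_def)
    fix n
    show "AE x in \<mu>. cmod (of_real (f x) - of_real (s n x)) \<le> 2 * C * indicator {- (R + 1)..R + 1} x"
    proof (rule AE_I2)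
      fix x
      have "\<bar>f x - s n x\<bar> \<le> 2 * C * indicator {- (R + 1)..R + 1} x"
      proof (cases "\<bar>x\<bar> \<le> R + 1")
        case True
        have "0 \<le> cut n x" "cut n x \<le> 1" unfolding cut_def by linarith+
        then have "\<bar>s n x\<bar> \<le> C * 1"
          unfolding s_def abs_mult using C by (intro mult_mono) auto
        then have "\<bar>f x - s n x\<bar> \<le> 2 * C" using bd[of x] by linarith
        then show ?thesis using True by (auto simp: indicator_def)
      next
        case False
        then have "cut n x = 0" unfolding cut_def by linarith
        then show ?thesis using f0[of x] False C by (simp add: s_def)
      qed
      then show "cmod (of_real (f x) - of_real (s n x)) \<le> 2 * C * indicator {- (R + 1)..R + 1} x"
        by (simp flip: of_real_diff)
    qed
  qed (use f in measurable)
qed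

lemma approximable_real:
  fixes f :: "real \<Rightarrow> real"
  assumes f[measurable]: "f \<in> borel_measurable \<mu>" and int: "integrable \<mu> (\<lambda>x. (f x)\<^sup>2)"
  shows "approximable (\<lambda>x. of_real (f x))"
proof -
  define s where "s n x = max (- real n) (min (real n) (f x)) * indicator {- real n..real n} x" for n x
  have "approximable (\<lambda>x. of_real (s n x))" for n
  proof (rule approximable_bounded[where C = n and R = n])
    have [measurable]: "(\<lambda>x. indicator {- real n..real n} x :: real) \<in> borel_measurable \<mu>"
      by (rule borel_imp_measurable) measurable
    show "s n \<in> borel_measurable \<mu>" unfolding s_def[abs_def] by measurable
  qed (auto simp: s_def indicator_def)
  then show ?thesis
  proof (rule approximable_dominated[where w = "\<lambda>x. \<bar>f x\<bar>"])
    show "AE x in \<mu>. (\<lambda>n. complex_of_real (s n x)) \<longlonglongrightarrow> of_real (f x)"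
    proof (rule AE_I2)
      fix x
      obtain n0 :: nat where n0: "max \<bar>x\<bar> \<bar>f x\<bar> \<le> n0" using real_arch_simple by blast
      have "eventually (\<lambda>n. s n x = f x) sequentially"
        using eventually_ge_at_top[of n0] by eventually_elim (use n0 in \<open>auto simp: s_def indicator_def\<close>)
      then have "(\<lambda>n. s n x) \<longlonglongrightarrow> f x" by (rule tendsto_eventually)
      then show "(\<lambda>n. complex_of_real (s n x)) \<longlonglongrightarrow> of_real (f x)" by (intro tendsto_intros)
    qed
    show "integrable \<mu> (\<lambda>x. \<bar>f x\<bar>\<^sup>2)" using int by simp
    fix n
    have "\<bar>f x - s n x\<bar> \<le> \<bar>f x\<bar>" for x by (auto simp: s_def indicator_def)
    then show "AE x in \<mu>. cmod (of_real (f x) - of_real (s n x)) \<le> \<bar>f x\<bar>"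
      by (simp flip: of_real_diff)
  qed (use f in measurable)
qed

lemma gauss_span_dense:
  assumes f: "f \<in> L2" and e: "0 < (e::real)"
  obtains d where "d \<in> gauss_span" "norm2 (\<lambda>x. f x - d x) < ennreal e"
proof -
  note [measurable] = L2_measurable[OF f]
  have int: "integrable \<mu> (\<lambda>x. (cmod (f x))\<^sup>2)" using f by (simp add: L2_iff_integrable)
  have part: "approximable (\<lambda>x. of_real (g x))"
    if [measurable]: "g \<in> borel_measurable \<mu>" and "\<And>x. \<bar>g x\<bar> \<le> cmod (f x)" for g :: "real \<Rightarrow> real"
  proof (rule approximable_real)
    show "integrable \<mu> (\<lambda>x. (g x)\<^sup>2)"
      by (rule Bochner_Integration.integrable_bound[OF int])
        (auto intro!: AE_I2 simp: that abs_le_square_iff[symmetric])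
  qed fact
  have "approximable (\<lambda>x. of_real (Re (f x)) + \<i> * of_real (Im (f x)))"
    by (intro approximable_add approximable_ii part abs_Re_le_cmod abs_Im_le_cmod) measurable
  then have "approximable f" by (simp flip: complex_eq)
  then show thesis using e that unfolding approximable_def by blast
qed

end

section \<open>The Plancherel theorem for the Dunkl transform\<close>

context dunkl
begin

lemma integral_mult_tendsto:
  assumes f: "f \<in> L2" and d: "\<And>n. d n \<in> L2" and h: "h \<in> L2"
    and lim: "(\<lambda>n. norm2 (\<lambda>x. f x - d n x)) \<longlonglongrightarrow> 0"
  shows "(\<lambda>n. LINT x|\<mu>. d n x * h x) \<longlonglongrightarrow> (LINT x|\<mu>. f x * h x)"
proof -
  have fin: "norm2 h < \<infinity>" using h by (simp add: L2_iff)
  have "(\<lambda>n. norm2 h * norm2 (\<lambda>x. f x - d n x)) \<longlonglongrightarrow> norm2 h * 0"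
    using fin by (intro ennreal_tendsto_cmult lim) simp
  then have lim0: "(\<lambda>n. norm2 h * norm2 (\<lambda>x. f x - d n x)) \<longlonglongrightarrow> 0" by simp
  have "(\<lambda>n. ennreal (cmod ((LINT x|\<mu>. d n x * h x) - (LINT x|\<mu>. f x * h x)))) \<longlonglongrightarrow> 0"
  proof (rule tendsto_sandwich[OF _ _ tendsto_const lim0])
    show "\<forall>\<^sub>F n in sequentially. ennreal (cmod ((LINT x|\<mu>. d n x * h x) - (LINT x|\<mu>. f x * h x)))
        \<le> norm2 h * norm2 (\<lambda>x. f x - d n x)"
    proof (intro always_eventually allI)
      fix n
      have "(LINT x|\<mu>. (f x - d n x) * h x) = (LINT x|\<mu>. f x * h x) - (LINT x|\<mu>. d n x * h x)"
        using L2_mult_integrable[OF f h] L2_mult_integrable[OF d h] by (simp add: left_diff_distrib)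
      then show "ennreal (cmod ((LINT x|\<mu>. d n x * h x) - (LINT x|\<mu>. f x * h x)))
        \<le> norm2 h * norm2 (\<lambda>x. f x - d n x)"
        using norm_integral_mult_le[OF L2_diff[OF f d] h, of n]
        by (simp add: norm_minus_commute mult.commute)
    qed
  qed simp
  then have "(\<lambda>n. cmod ((LINT x|\<mu>. d n x * h x) - (LINT x|\<mu>. f x * h x))) \<longlonglongrightarrow> 0"
    by (subst (asm) ennreal_tendsto_0_iff) auto
  then show ?thesis by (rule Lim_null[THEN iffD2, OF tendsto_norm_zero_cancel])
qed

text \<open>The closure in \<open>L\<^sup>2 \<times> L\<^sup>2\<close> of the graph of the transform on the span of Gaussians.\<close>

definition limit_transform :: "(real \<Rightarrow> complex) \<Rightarrow> (real \<Rightarrow> complex) \<Rightarrow> bool" where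
  "limit_transform f g \<longleftrightarrow> f \<in> L2 \<and> g \<in> L2 \<and> (\<exists>d. (\<forall>n::nat. d n \<in> gauss_span) \<and>
     (\<lambda>n. norm2 (\<lambda>x. f x - d n x)) \<longlonglongrightarrow> 0 \<and> (\<lambda>n. norm2 (\<lambda>x. g x - F (d n) x)) \<longlonglongrightarrow> 0)"

lemma norm2_add_tendsto_0:
  assumes [measurable]: "\<And>n. u n \<in> borel_measurable \<mu>" "\<And>n. v n \<in> borel_measurable \<mu>"
    and u: "(\<lambda>n. norm2 (u n)) \<longlonglongrightarrow> 0" and v: "(\<lambda>n. norm2 (v n)) \<longlonglongrightarrow> 0"
  shows "(\<lambda>n. norm2 (\<lambda>x. u n x + v n x)) \<longlonglongrightarrow> 0"
proof (rule tendsto_sandwich[OF _ _ tendsto_const])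
  show "\<forall>\<^sub>F n in sequentially. norm2 (\<lambda>x. u n x + v n x) \<le> norm2 (u n) + norm2 (v n)"
    by (intro always_eventually allI L2.cnorm_triangle) measurable
  show "(\<lambda>n. norm2 (u n) + norm2 (v n)) \<longlonglongrightarrow> 0"
    using tendsto_add[OF u v] by simp
qed simp

lemma norm2_cmult_tendsto_0:
  assumes [measurable]: "\<And>n. u n \<in> borel_measurable \<mu>" and u: "(\<lambda>n. norm2 (u n)) \<longlonglongrightarrow> 0"
  shows "(\<lambda>n. norm2 (\<lambda>x. c * u n x)) \<longlonglongrightarrow> 0"
proof -
  have "(\<lambda>n. ennreal (cmod c) * norm2 (u n)) \<longlonglongrightarrow> ennreal (cmod c) * 0"
    by (intro ennreal_tendsto_cmult u) simp
  then show ?thesis by (simp add: L2.cnorm_cmult)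
qed

lemma limit_transform_add:
  assumes "limit_transform f g" "limit_transform f' g'"
  shows "limit_transform (\<lambda>x. f x + f' x) (\<lambda>x. g x + g' x)"
proof -
  obtain d d' where d: "\<And>n. d n \<in> gauss_span" "(\<lambda>n. norm2 (\<lambda>x. f x - d n x)) \<longlonglongrightarrow> 0"
      "(\<lambda>n. norm2 (\<lambda>x. g x - F (d n) x)) \<longlonglongrightarrow> 0"
    and d': "\<And>n. d' n \<in> gauss_span" "(\<lambda>n. norm2 (\<lambda>x. f' x - d' n x)) \<longlonglongrightarrow> 0"
      "(\<lambda>n. norm2 (\<lambda>x. g' x - F (d' n) x)) \<longlonglongrightarrow> 0"
    and L: "f \<in> L2" "f' \<in> L2" "g \<in> L2" "g' \<in> L2"
    using assms unfolding limit_transform_def by blast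
  note [measurable] = L[THEN L2_measurable] gauss_span_measurable[OF d(1)] gauss_span_measurable[OF d'(1)]
    gauss_span_measurable[OF gauss_span_F[OF d(1)]] gauss_span_measurable[OF gauss_span_F[OF d'(1)]]
  have "(\<lambda>n. norm2 (\<lambda>x. (f x - d n x) + (f' x - d' n x))) \<longlonglongrightarrow> 0"
    by (intro norm2_add_tendsto_0 d d') measurable
  moreover have "(\<lambda>n. norm2 (\<lambda>x. (g x - F (d n) x) + (g' x - F (d' n) x))) \<longlonglongrightarrow> 0"
    by (intro norm2_add_tendsto_0 d d') measurable
  ultimately show ?thesis
    unfolding limit_transform_def using L d(1) d'(1)
    by (intro conjI L2_add exI[of _ "\<lambda>n x. d n x + d' n x"])
      (auto simp: F_add gauss_span_integrable add_diff_add intro: gauss_span.add)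
qed

lemma limit_transform_cmult:
  assumes "limit_transform f g"
  shows "limit_transform (\<lambda>x. c * f x) (\<lambda>x. c * g x)"
proof -
  obtain d where d: "\<And>n. d n \<in> gauss_span" "(\<lambda>n. norm2 (\<lambda>x. f x - d n x)) \<longlonglongrightarrow> 0"
      "(\<lambda>n. norm2 (\<lambda>x. g x - F (d n) x)) \<longlonglongrightarrow> 0"
    and L: "f \<in> L2" "g \<in> L2"
    using assms unfolding limit_transform_def by blast
  note [measurable] = L[THEN L2_measurable] gauss_span_measurable[OF d(1)]
    gauss_span_measurable[OF gauss_span_F[OF d(1)]]
  have "(\<lambda>n. norm2 (\<lambda>x. c * (f x - d n x))) \<longlonglongrightarrow> 0"
    by (intro norm2_cmult_tendsto_0 d) measurable
  moreover have "(\<lambda>n. norm2 (\<lambda>x. c * (g x - F (d n) x))) \<longlonglongrightarrow> 0"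
    by (intro norm2_cmult_tendsto_0 d) measurable
  ultimately show ?thesis
    unfolding limit_transform_def using L d(1)
    by (intro conjI L2_cmult exI[of _ "\<lambda>n x. c * d n x"])
      (auto simp: F_cmult right_diff_distrib intro: gauss_span.scale)
qed

lemma limit_transform_norm2:
  assumes "limit_transform f g" shows "norm2 f = norm2 g"
proof -
  obtain d where d: "\<And>n. d n \<in> gauss_span" "(\<lambda>n. norm2 (\<lambda>x. f x - d n x)) \<longlonglongrightarrow> 0"
      "(\<lambda>n. norm2 (\<lambda>x. g x - F (d n) x)) \<longlonglongrightarrow> 0"
    and L: "f \<in> L2" "g \<in> L2"
    using assms unfolding limit_transform_def by blast
  note [measurable] = L[THEN L2_measurable] gauss_span_measurable[OF d(1)]
    gauss_span_measurable[OF gauss_span_F[OF d(1)]]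
  let ?a = "\<lambda>n. norm2 (\<lambda>x. f x - d n x)" and ?b = "\<lambda>n. norm2 (\<lambda>x. g x - F (d n) x)"
  have lim: "(\<lambda>n. ?a n + ?b n) \<longlonglongrightarrow> 0" using tendsto_add[OF d(2,3)] by simp
  have 1: "norm2 f \<le> norm2 g + (?a n + ?b n)" for n
  proof -
    have "norm2 f \<le> ?a n + norm2 (d n)" by (rule L2.cnorm_triangle_diff) measurable
    also have "norm2 (d n) = norm2 (F (d n))" using norm2_F_gauss_span[OF d(1)] by simp
    also have "norm2 (F (d n)) \<le> norm2 (\<lambda>x. F (d n) x - g x) + norm2 g"
      by (rule L2.cnorm_triangle_diff) measurable
    finally show ?thesis by (simp add: L2.cnorm_minus_commute[of g] add_left_mono ac_simps)
  qed
  have 2: "norm2 g \<le> norm2 f + (?a n + ?b n)" for n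
  proof -
    have "norm2 g \<le> ?b n + norm2 (F (d n))" by (rule L2.cnorm_triangle_diff) measurable
    also have "norm2 (F (d n)) = norm2 (d n)" using norm2_F_gauss_span[OF d(1)] by simp
    also have "norm2 (d n) \<le> norm2 (\<lambda>x. d n x - f x) + norm2 f"
      by (rule L2.cnorm_triangle_diff) measurable
    finally show ?thesis by (simp add: L2.cnorm_minus_commute[of f] add_left_mono ac_simps)
  qed
  have *: "x \<le> y" if "\<And>n. x \<le> y + (?a n + ?b n)" for x y
  proof (rule LIMSEQ_le_const)
    show "(\<lambda>n. y + (?a n + ?b n)) \<longlonglongrightarrow> y" using tendsto_add[OF tendsto_const lim, of y] by simp
  qed (use that in auto)
  show ?thesis using *[OF 1] *[OF 2] by (rule antisym)
qed

text \<open>The closed graph is linear and isometric, so its fibre over \<open>0\<close> contains null functions only.\<close>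

lemma limit_transform_unique:
  assumes f: "limit_transform f g" and f': "limit_transform f g'"
  shows "AE x in \<mu>. g x = g' x"
proof -
  have "limit_transform (\<lambda>x. f x + -1 * f x) (\<lambda>x. g x + -1 * g' x)"
    by (intro limit_transform_add limit_transform_cmult assms)
  then have "norm2 (\<lambda>x. f x + -1 * f x) = norm2 (\<lambda>x. g x + -1 * g' x)"
    by (rule limit_transform_norm2)
  then have "norm2 (\<lambda>x. g x + -1 * g' x) = 0" by (simp add: L2.cnorm_0)
  moreover have "g \<in> borel_measurable \<mu>" "g' \<in> borel_measurable \<mu>"
    using assms by (auto simp: limit_transform_def L2_iff)
  then have "(\<lambda>x. g x + -1 * g' x) \<in> borel_measurable \<mu>" by measurable
  ultimately have "AE x in \<mu>. g x + -1 * g' x = 0"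
    using L2.cnorm_eq_0_iff by blast
  then show ?thesis by eventually_elim simp
qed

lemma gauss_span_sequence:
  assumes f: "f \<in> L2"
  obtains d where "\<And>n. d n \<in> gauss_span" "(\<lambda>n. norm2 (\<lambda>x. f x - d n x)) \<longlonglongrightarrow> 0"
proof -
  have "\<exists>d\<in>gauss_span. norm2 (\<lambda>x. f x - d x) < ennreal (1 / real (Suc n))" for n
    using gauss_span_dense[OF f, of "1 / real (Suc n)"] by auto
  then obtain d where d: "\<And>n. d n \<in> gauss_span" "\<And>n. norm2 (\<lambda>x. f x - d n x) < ennreal (1 / real (Suc n))"
    by metis
  have lim: "(\<lambda>n. ennreal (1 / real (Suc n))) \<longlonglongrightarrow> 0"
    using tendsto_ennrealI[OF LIMSEQ_inverse_real_of_nat] by (simp add: inverse_eq_divide)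
  have "(\<lambda>n. norm2 (\<lambda>x. f x - d n x)) \<longlonglongrightarrow> 0"
    by (rule tendsto_sandwich[OF _ _ tendsto_const lim])
      (auto intro!: always_eventually less_imp_le[OF d(2)] simp del: of_nat_Suc)
  then show thesis using that d(1) by blast
qed

text \<open>Sequences with the same mutual distances are Cauchy together.  With \<open>u = F \<circ> d\<close> this extends the
  transform to all of \<open>L\<^sup>2\<close>, and with the roles exchanged it makes the extension surjective.\<close>

lemma L2_limit_exists:
  assumes f: "f \<in> L2" and d: "\<And>n. d n \<in> L2" and lim: "(\<lambda>n. norm2 (\<lambda>x. f x - d n x)) \<longlonglongrightarrow> 0"
    and u: "\<And>n. u n \<in> L2" and iso: "\<And>m n. norm2 (\<lambda>x. u m x - u n x) = norm2 (\<lambda>x. d m x - d n x)"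
  obtains g where "g \<in> L2" "(\<lambda>n. norm2 (\<lambda>x. g x - u n x)) \<longlonglongrightarrow> 0"
proof -
  note [measurable] = L2_measurable[OF f] L2_measurable[OF d] L2_measurable[OF u]
  obtain g where [measurable]: "g \<in> borel_measurable \<mu>" and g: "(\<lambda>n. norm2 (\<lambda>x. u n x - g x)) \<longlonglongrightarrow> 0"
  proof (rule L2.Riesz_Fischer[of u])
    fix e :: real assume e: "0 < e"
    then have "eventually (\<lambda>n. norm2 (\<lambda>x. f x - d n x) < ennreal (e / 2)) sequentially"
      using lim by (intro order_tendstoD(2)) auto
    then obtain n0 where n0: "\<And>n. n0 \<le> n \<Longrightarrow> norm2 (\<lambda>x. f x - d n x) < ennreal (e / 2)"
      by (auto simp: eventually_sequentially)
    have "norm2 (\<lambda>x. u m x - u n x) < ennreal e" if "n0 \<le> m" "n0 \<le> n" for m n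
    proof -
      have "norm2 (\<lambda>x. (d m x - f x) + (f x - d n x)) < ennreal e"
        using n0[OF that(1)] n0[OF that(2)] e
        by (intro norm2_less_add) (auto simp: L2.cnorm_minus_commute[of "d m"])
      then show ?thesis by (simp add: iso)
    qed
    then show "\<exists>n0. \<forall>m\<ge>n0. \<forall>n\<ge>n0. norm2 (\<lambda>x. u m x - u n x) < ennreal e" by blast
  qed auto
  obtain n where n: "norm2 (\<lambda>x. u n x - g x) < 1"
    using order_tendstoD(2)[OF g, of 1] by (auto simp: eventually_sequentially)
  have "norm2 g \<le> norm2 (\<lambda>x. g x - u n x) + norm2 (u n)" by (rule L2.cnorm_triangle_diff) auto
  also have "\<dots> < \<infinity>"
    using less_trans[OF n] u[of n] by (simp add: L2.cnorm_minus_commute[of g] L2_iff)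
  finally have "g \<in> L2" by (simp add: L2_iff)
  then show thesis using that[of g] g by (simp add: L2.cnorm_minus_commute[of g])
qed

lemma norm2_F_diff:
  assumes "d \<in> gauss_span" "e \<in> gauss_span"
  shows "norm2 (\<lambda>x. F d x - F e x) = norm2 (\<lambda>x. d x - e x)"
proof -
  have "F (\<lambda>x. d x + (-1) * e x) = (\<lambda>l. F d l + F (\<lambda>x. (-1) * e x) l)"
    by (rule F_add) (use gauss_span_integrable assms in auto)
  then have "F (\<lambda>x. d x - e x) = (\<lambda>x. F d x - F e x)" unfolding F_cmult by simp
  then show ?thesis using norm2_F_gauss_span[OF gauss_span_diff[OF assms]] by simp
qed

lemma limit_transform_exists:
  assumes f: "f \<in> L2" shows "\<exists>g. limit_transform f g"
proof -
  obtain d where d: "\<And>n. d n \<in> gauss_span" "(\<lambda>n. norm2 (\<lambda>x. f x - d n x)) \<longlonglongrightarrow> 0"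
    using gauss_span_sequence[OF f] by blast
  obtain g where "g \<in> L2" "(\<lambda>n. norm2 (\<lambda>x. g x - F (d n) x)) \<longlonglongrightarrow> 0"
    using L2_limit_exists[OF f gauss_span_L2[OF d(1)] d(2) gauss_span_L2[OF gauss_span_F[OF d(1)]]
        norm2_F_diff[OF d(1) d(1)]] by blast
  then show ?thesis using f d unfolding limit_transform_def by blast
qed

lemma limit_transform_surj:
  assumes g: "g \<in> L2" shows "\<exists>f. limit_transform f g"
proof -
  obtain e where e: "\<And>n. e n \<in> gauss_span" "(\<lambda>n. norm2 (\<lambda>x. g x - e n x)) \<longlonglongrightarrow> 0"
    using gauss_span_sequence[OF g] by blast
  have "\<forall>n. \<exists>d. d \<in> gauss_span \<and> F d = e n" using gauss_span_F_surj[OF e(1)] by blast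
  then obtain d where d: "\<And>n. d n \<in> gauss_span" "\<And>n. F (d n) = e n" by metis
  have "norm2 (\<lambda>x. d m x - d n x) = norm2 (\<lambda>x. e m x - e n x)" for m n
    using norm2_F_diff[OF d(1)[of m] d(1)[of n]] by (simp add: d(2))
  then obtain f where "f \<in> L2" "(\<lambda>n. norm2 (\<lambda>x. f x - d n x)) \<longlonglongrightarrow> 0"
    using L2_limit_exists[OF g gauss_span_L2[OF e(1)] e(2), of d] gauss_span_L2[OF d(1)] by blast
  then show ?thesis using g e d unfolding limit_transform_def
    by (intro exI[of _ f] conjI exI[of _ d]) auto
qed

lemma F_bounded:
  assumes f: "integrable \<mu> f" shows "cmod (F f l) \<le> (LINT x|\<mu>. cmod (f x))"
proof -
  have "cmod (F f l) \<le> (LINT x|\<mu>. cmod (dunkl_kernel k (- \<i> * of_real (l * x)) * f x))"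
    unfolding dunkl_transform_L1_def by (rule integral_norm_bound)
  also have "\<dots> \<le> (LINT x|\<mu>. cmod (f x))"
  proof (rule integral_mono)
    show "integrable \<mu> (\<lambda>x. cmod (dunkl_kernel k (- \<i> * of_real (l * x)) * f x))"
      by (intro integrable_norm F_integrable f)
    show "integrable \<mu> (\<lambda>x. cmod (f x))" by (intro integrable_norm f)
    show "cmod (dunkl_kernel k (- \<i> * of_real (l * x)) * f x) \<le> cmod (f x)" for x
      unfolding norm_mult by (rule mult_left_le_one_le[OF _ _ cmod_kernel_minus_le_1]) auto
  qed
  finally show ?thesis .
qed

sublocale sigma_finite_measure \<mu> by (rule sigma_finite_dunkl)

lemma kernel_product_measurable:
  "(\<lambda>(x, l). dunkl_kernel k (- \<i> * of_real (l * x))) \<in> borel_measurable (\<mu> \<Otimes>\<^sub>M \<mu>)"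
proof -
  have [measurable]: "(\<lambda>p. fst p) \<in> borel_measurable (\<mu> \<Otimes>\<^sub>M \<mu>)" "(\<lambda>p. snd p) \<in> borel_measurable (\<mu> \<Otimes>\<^sub>M \<mu>)"
    using measurable_compose[OF measurable_fst id_measurable_dunkl]
      measurable_compose[OF measurable_snd id_measurable_dunkl] by auto
  have "(\<lambda>p. snd p * fst p :: real) \<in> borel_measurable (\<mu> \<Otimes>\<^sub>M \<mu>)" by measurable
  from measurable_compose[OF this borel_kernel_minus] show ?thesis by (simp add: case_prod_beta)
qed

lemma F_measurable:
  assumes f: "integrable \<mu> f" shows "F f \<in> borel_measurable \<mu>"
proof -
  note [measurable] = borel_measurable_integrable[OF f]
  have "(\<lambda>(l, x). dunkl_kernel k (- \<i> * of_real (l * x))) \<in> borel_measurable (\<mu> \<Otimes>\<^sub>M \<mu>)"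
    using kernel_product_measurable by (simp add: mult.commute)
  then have "(\<lambda>p. dunkl_kernel k (- \<i> * of_real (fst p * snd p)) * f (snd p)) \<in> borel_measurable (\<mu> \<Otimes>\<^sub>M \<mu>)"
    by (intro borel_measurable_times) (auto simp: case_prod_beta)
  then show ?thesis
    unfolding dunkl_transform_L1_def[abs_def]
    by (intro borel_measurable_lebesgue_integral) (simp add: case_prod_beta)
qed

text \<open>The kernel is symmetric in its two variables, so Fubini's theorem moves the transform from one
  factor to the other.\<close>

lemma F_duality:
  assumes f: "integrable \<mu> f" and h: "integrable \<mu> h"
  shows "(LINT l|\<mu>. F f l * h l) = (LINT x|\<mu>. f x * F h x)"
proof -
  interpret pair_sigma_finite \<mu> \<mu> ..
  note [measurable] = borel_measurable_integrable[OF f] borel_measurable_integrable[OF h]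
    kernel_product_measurable
  let ?E = "\<lambda>x l. dunkl_kernel k (- \<i> * of_real (l * x))"
  have prod: "integrable (\<mu> \<Otimes>\<^sub>M \<mu>) (\<lambda>p. f (fst p) * h (snd p))"
  proof (rule Fubini_integrable)
    show "integrable \<mu> (\<lambda>x. LINT y|\<mu>. norm (f (fst (x, y)) * h (snd (x, y))))"
      using integrable_norm[OF f] integrable_norm[OF h] by (simp add: norm_mult)
    show "AE x in \<mu>. integrable \<mu> (\<lambda>y. f (fst (x, y)) * h (snd (x, y)))"
      using h by simp
  qed measurable
  have "integrable (\<mu> \<Otimes>\<^sub>M \<mu>) (\<lambda>(x, l). ?E x l * f x * h l)"
  proof (rule Bochner_Integration.integrable_bound[OF prod])
    show "(\<lambda>(x, l). ?E x l * f x * h l) \<in> borel_measurable (\<mu> \<Otimes>\<^sub>M \<mu>)"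
    proof -
      have "(\<lambda>p. (case p of (x, l) \<Rightarrow> ?E x l) * f (fst p) * h (snd p)) \<in> borel_measurable (\<mu> \<Otimes>\<^sub>M \<mu>)"
        by measurable
      then show ?thesis by (simp add: case_prod_beta)
    qed
    have "cmod (?E x l * f x * h l) \<le> cmod (f x * h l)" for x l
      using mult_left_le_one_le[OF norm_ge_zero norm_ge_zero cmod_kernel_minus_le_1[of "l * x"], of "f x * h l"]
      by (simp only: norm_mult[symmetric] mult.assoc)
    then show "AE p in \<mu> \<Otimes>\<^sub>M \<mu>. norm (case p of (x, l) \<Rightarrow> ?E x l * f x * h l) \<le> norm (f (fst p) * h (snd p))"
      by (auto simp: case_prod_beta)
  qed
  from Fubini_integral[OF this]
  have "(LINT l|\<mu>. (LINT x|\<mu>. ?E x l * f x * h l)) = (LINT x|\<mu>. (LINT l|\<mu>. ?E x l * f x * h l))" .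
  moreover have "(LINT x|\<mu>. ?E x l * f x * h l) = F f l * h l" for l
    unfolding dunkl_transform_L1_def by simp
  moreover have "(LINT l|\<mu>. ?E x l * f x * h l) = f x * F h x" for x
  proof -
    have "?E x l * f x * h l = f x * (dunkl_kernel k (- \<i> * of_real (x * l)) * h l)" for l
      by (simp only: mult_ac)
    then show ?thesis unfolding dunkl_transform_L1_def by (simp only: integral_mult_right_zero)
  qed
  ultimately show ?thesis by (simp only:)
qed

text \<open>Used to pair with test functions of the form Gaussian times \<open>d\<close>: multiplying the bounded function
  \<open>F f\<close> by a Gaussian makes it square-integrable.\<close>

lemma gauss_span_times_Gaussian:
  "d \<in> gauss_span \<Longrightarrow> (\<lambda>x. gauss_even 1 x * d x) \<in> gauss_span"
proof (induction rule: gauss_span.induct)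
  case (even t)
  have "gauss_even 1 x * gauss_even t x = gauss_even (t + 1) x" for x
    by (simp add: gauss_even_def algebra_simps flip: of_real_mult exp_add)
  then show ?case using gauss_span.even[of "t + 1"] even by simp
next
  case (odd t)
  have "exp (- 1 * x\<^sup>2) * (x * exp (- t * x\<^sup>2)) = x * exp (- (t + 1) * x\<^sup>2)" for x :: real
    by (simp add: algebra_simps mult_exp_exp)
  then have "gauss_even 1 x * gauss_odd t x = gauss_odd (t + 1) x" for x
    unfolding gauss_even_def gauss_odd_def by (simp only: of_real_mult[symmetric])
  then show ?case using gauss_span.odd[of "t + 1"] odd by simp
next
  case (add f g)
  then show ?case using gauss_span.add by (simp add: distrib_left)
next
  case (scale f c)
  then show ?case using gauss_span.scale[of _ c] by (simp add: mult.left_commute[of _ c])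
qed

lemma L2_orthogonal_imp_0:
  assumes u: "u \<in> L2" and orth: "\<And>d. d \<in> gauss_span \<Longrightarrow> (LINT x|\<mu>. u x * d x) = 0"
  shows "AE x in \<mu>. u x = 0"
proof -
  note [measurable] = L2_measurable[OF u]
  obtain d where d: "\<And>n. d n \<in> gauss_span" "(\<lambda>n. norm2 (\<lambda>x. cnj (u x) - d n x)) \<longlonglongrightarrow> 0"
    using gauss_span_sequence[OF L2_cnj[OF u]] by blast
  have "(\<lambda>n. LINT x|\<mu>. d n x * u x) \<longlonglongrightarrow> (LINT x|\<mu>. cnj (u x) * u x)"
    by (rule integral_mult_tendsto[OF L2_cnj[OF u] gauss_span_L2[OF d(1)] u d(2)])
  moreover have "(LINT x|\<mu>. d n x * u x) = 0" for n using orth[OF d(1)] by (simp add: mult.commute)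
  ultimately have "(LINT x|\<mu>. cnj (u x) * u x) = 0" by (simp add: LIMSEQ_const_iff)
  then have "(norm2 u)\<^sup>2 = 0" unfolding L2_power2_integral[OF u] by (simp add: mult.commute)
  then have "norm2 u = 0" by simp
  then show ?thesis by (subst (asm) L2.cnorm_eq_0_iff) auto
qed

text \<open>By duality \<open>g\<close> and the integral \<open>F f\<close> have the same pairing with every function in the span of Gaussians,
  and that span is dense.\<close>

lemma limit_transform_L1:
  assumes fg: "limit_transform f g" and int: "integrable \<mu> f"
  shows "AE x in \<mu>. g x = F f x"
proof -
  obtain d where d: "\<And>n. d n \<in> gauss_span" "(\<lambda>n. norm2 (\<lambda>x. f x - d n x)) \<longlonglongrightarrow> 0"
      "(\<lambda>n. norm2 (\<lambda>x. g x - F (d n) x)) \<longlonglongrightarrow> 0"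
    and L: "f \<in> L2" "g \<in> L2"
    using fg unfolding limit_transform_def by blast
  note [measurable] = L2_measurable[OF L(2)] F_measurable[OF int]
  have weak: "(LINT x|\<mu>. g x * h x) = (LINT x|\<mu>. F f x * h x)" if h: "h \<in> gauss_span" for h
  proof (rule LIMSEQ_unique)
    show "(\<lambda>n. LINT x|\<mu>. F (d n) x * h x) \<longlonglongrightarrow> (LINT x|\<mu>. g x * h x)"
      by (rule integral_mult_tendsto[OF L(2) gauss_span_L2[OF gauss_span_F[OF d(1)]] gauss_span_L2[OF h] d(3)])
    have "(\<lambda>n. LINT x|\<mu>. d n x * F h x) \<longlonglongrightarrow> (LINT x|\<mu>. f x * F h x)"
      by (rule integral_mult_tendsto[OF L(1) gauss_span_L2[OF d(1)] gauss_span_L2[OF gauss_span_F[OF h]] d(2)])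
    then show "(\<lambda>n. LINT x|\<mu>. F (d n) x * h x) \<longlonglongrightarrow> (LINT x|\<mu>. F f x * h x)"
      using F_duality[OF gauss_span_integrable[OF d(1)] gauss_span_integrable[OF h]]
        F_duality[OF int gauss_span_integrable[OF h]] by simp
  qed
  let ?G = "gauss_even 1"
  have G: "?G \<in> gauss_span" by (rule gauss_span.even) simp
  note [measurable] = gauss_span_measurable[OF G]
  have gG: "(\<lambda>x. g x * ?G x) \<in> L2"
  proof (rule L2_bound[OF L(2), where c = 1])
    have "cmod (?G x) \<le> 1" for x by (simp add: gauss_even_def)
    then show "AE x in \<mu>. cmod (g x * ?G x) \<le> 1 * cmod (g x)"
      by (simp add: norm_mult mult_left_le)
  qed measurable
  have FG: "(\<lambda>x. F f x * ?G x) \<in> L2"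
  proof (rule L2_bound[OF gauss_span_L2[OF G]])
    show "AE x in \<mu>. cmod (F f x * ?G x) \<le> (LINT x|\<mu>. cmod (f x)) * cmod (?G x)"
      unfolding norm_mult by (intro AE_I2 mult_right_mono F_bounded int) auto
  qed measurable
  have "AE x in \<mu>. g x * ?G x - F f x * ?G x = 0"
  proof (rule L2_orthogonal_imp_0[OF L2_diff[OF gG FG]])
    fix h assume h: "h \<in> gauss_span"
    have "(LINT x|\<mu>. (g x * ?G x - F f x * ?G x) * h x) = (LINT x|\<mu>. (g x * ?G x) * h x) - (LINT x|\<mu>. (F f x * ?G x) * h x)"
      using L2_mult_integrable[OF gG gauss_span_L2[OF h]] L2_mult_integrable[OF FG gauss_span_L2[OF h]]
      by (simp add: left_diff_distrib)
    also have "\<dots> = 0"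
      using weak[OF gauss_span_times_Gaussian[OF h]] by (simp add: mult.assoc)
    finally show "(LINT x|\<mu>. (g x * ?G x - F f x * ?G x) * h x) = 0" .
  qed
  then show ?thesis
  proof eventually_elim
    fix x assume "g x * ?G x - F f x * ?G x = 0"
    then have "(g x - F f x) * ?G x = 0" by (simp add: left_diff_distrib)
    then show "g x = F f x" by (simp add: gauss_even_def)
  qed
qed

lemma Lp_1_integrable:
  assumes "f \<in> Lp \<mu> 1" shows "integrable \<mu> f"
proof (rule integrableI_bounded)
  show "f \<in> borel_measurable \<mu>" using assms by (simp add: Lp_def)
  have "(1::ennreal) \<noteq> \<infinity>" by simp
  then show "(\<integral>\<^sup>+x. ennreal (norm (f x)) \<partial>\<mu>) < \<infinity>"
    using assms by (simp add: Lp_def Lp_norm_def ennreal_powr_1 recip_def)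
qed

theorem Plancherel: "\<exists>T. is_dunkl_L2_extension k T"
proof -
  define T where "T f = (SOME g. limit_transform f g)" for f
  have T: "limit_transform f (T f)" if "f \<in> L2" for f
    unfolding T_def by (rule someI_ex[OF limit_transform_exists[OF that]])
  have "is_dunkl_L2_extension k T"
    unfolding is_dunkl_L2_extension_def Let_def L2.cnorm_def[symmetric]
  proof (intro conjI ballI allI)
    fix f assume f: "f \<in> L2"
    show "T f \<in> L2" using T[OF f] by (simp add: limit_transform_def)
    show "norm2 (T f) = norm2 f" using limit_transform_norm2[OF T[OF f]] by simp
    show "AE x in \<mu>. T (\<lambda>t. c * f t) x = c * T f x" for c
      by (rule limit_transform_unique[OF T[OF L2_cmult[OF f]] limit_transform_cmult[OF T[OF f]]])
    show "AE x in \<mu>. T (\<lambda>t. f t + g t) x = T f x + T g x" if g: "g \<in> L2" for g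
      by (rule limit_transform_unique[OF T[OF L2_add[OF f g]] limit_transform_add[OF T[OF f] T[OF g]]])
    obtain e where e: "limit_transform e f" using limit_transform_surj[OF f] by blast
    then have "e \<in> L2" by (simp add: limit_transform_def)
    then show "\<exists>e\<in>L2. AE x in \<mu>. T e x = f x"
      using limit_transform_unique[OF T e] by blast
  next
    fix f assume "f \<in> Lp \<mu> 1 \<inter> L2"
    then show "AE x in \<mu>. T f x = F f x"
      using limit_transform_L1[OF T Lp_1_integrable] by auto
  qed
  then show ?thesis by blast
qed

end

section \<open>Translated balls as windows, and the Fofana norm\<close>

lemma abs_enn2real_diff_le:
  fixes a b c :: ennreal
  assumes "a \<le> b + c" "b \<le> a + c" "a < \<infinity>" "b < \<infinity>" "c < \<infinity>"
  shows "\<bar>enn2real a - enn2real b\<bar> \<le> enn2real c"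
  using assms by (cases a; cases b; cases c) (auto simp flip: ennreal_plus)

lemma function_norm_cong:
  assumes "function_norm M N" and eq: "\<And>f. f \<in> borel_measurable M \<Longrightarrow> N' f = N f"
  shows "function_norm M N'"
proof -
  interpret function_norm M N by fact
  show ?thesis
  proof
    fix f g :: "real \<Rightarrow> ennreal" assume f: "f \<in> borel_measurable M" and g: "g \<in> borel_measurable M"
    show "N' f \<le> N' g" if "AE x in M. f x \<le> g x" using norm_mono[OF f g that] f g by (simp add: eq)
    show "N' (\<lambda>x. ennreal c * f x) = ennreal c * N' f" for c using norm_cmult[OF f] f by (simp add: eq)
    show "N' (\<lambda>x. f x + g x) \<le> N' f + N' g" using norm_triangle[OF f g] f g by (simp add: eq)
  next
    fix h :: "nat \<Rightarrow> real \<Rightarrow> ennreal" assume "\<And>n. h n \<in> borel_measurable M" "incseq h"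
    then show "N' (\<lambda>x. SUP n. h n x) \<le> (SUP n. N' (h n))" using norm_SUP_le[of h] by (simp add: eq)
  next
    fix f :: "real \<Rightarrow> ennreal" assume "f \<in> borel_measurable M" "N' f = 0"
    then show "AE x in M. f x = 0" using norm_definite[of f] by (simp add: eq)
  qed
qed

context dunkl
begin

abbreviation "\<F> \<equiv> dunkl_transform k"

lemma is_extension: "is_dunkl_L2_extension k \<F>"
  unfolding dunkl_transform_def by (rule someI_ex[OF Plancherel])

lemma transform_L2: "f \<in> L2 \<Longrightarrow> \<F> f \<in> L2"
  and transform_add: "f \<in> L2 \<Longrightarrow> g \<in> L2 \<Longrightarrow> AE x in \<mu>. \<F> (\<lambda>t. f t + g t) x = \<F> f x + \<F> g x"
  and transform_cmult: "f \<in> L2 \<Longrightarrow> AE x in \<mu>. \<F> (\<lambda>t. c * f t) x = c * \<F> f x"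
  and transform_norm2: "f \<in> L2 \<Longrightarrow> norm2 (\<F> f) = norm2 f"
  and transform_surj: "g \<in> L2 \<Longrightarrow> \<exists>f\<in>L2. AE x in \<mu>. \<F> f x = g x"
  using is_extension unfolding is_dunkl_L2_extension_def Let_def L2.cnorm_def[symmetric] by blast+

lemma norm2_transform_diff:
  assumes f: "f \<in> L2" and g: "g \<in> L2"
  shows "norm2 (\<lambda>x. f x - g x) = norm2 (\<lambda>x. \<F> f x - \<F> g x)"
proof -
  note L = L2_diff[OF f g] L2_cmult[OF g, of "-1"]
  note [measurable] = transform_L2[OF f, THEN L2_measurable] transform_L2[OF g, THEN L2_measurable]
    transform_L2[OF L(1), THEN L2_measurable]
  have "AE x in \<mu>. \<F> (\<lambda>x. f x - g x) x = \<F> f x - \<F> g x"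
    using transform_add[OF f L(2)] transform_cmult[OF g, of "-1"] by eventually_elim simp
  then have "norm2 (\<F> (\<lambda>x. f x - g x)) = norm2 (\<lambda>x. \<F> f x - \<F> g x)"
    by (intro L2.cnorm_cong_AE) auto
  then show ?thesis by (simp add: transform_norm2[OF L(1)])
qed

lemma kernel_measurable: "(\<lambda>x. dunkl_kernel k (\<i> * of_real (x * y))) \<in> borel_measurable \<mu>"
proof (rule borel_imp_measurable)
  have "(\<lambda>x::real. x * y) \<in> borel_measurable borel" by measurable
  from measurable_compose[OF this borel_kernel_plus]
  show "(\<lambda>x. dunkl_kernel k (\<i> * of_real (x * y))) \<in> borel_measurable borel" .
qed

lemma translation:
  assumes f: "f \<in> L2"
  shows "dunkl_translation k y f \<in> L2"
    and "AE x in \<mu>. \<F> (dunkl_translation k y f) x = dunkl_kernel k (\<i> * of_real (x * y)) * \<F> f x"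
proof -
  note [measurable] = transform_L2[OF f, THEN L2_measurable] kernel_measurable
  have "(\<lambda>x. dunkl_kernel k (\<i> * of_real (x * y)) * \<F> f x) \<in> L2"
  proof (rule L2_bound[OF transform_L2[OF f], where c = 1])
    show "AE x in \<mu>. cmod (dunkl_kernel k (\<i> * of_real (x * y)) * \<F> f x) \<le> 1 * cmod (\<F> f x)"
      unfolding norm_mult
      by (intro AE_I2 mult_right_mono cmod_dunkl_kernel_imaginary_le_1 k) simp
  qed measurable
  from transform_surj[OF this]
  have "\<exists>g. g \<in> L2 \<and> (AE x in \<mu>. \<F> g x = dunkl_kernel k (\<i> * of_real (x * y)) * \<F> f x)" by blast
  from someI_ex[OF this]
  show "dunkl_translation k y f \<in> L2"
    "AE x in \<mu>. \<F> (dunkl_translation k y f) x = dunkl_kernel k (\<i> * of_real (x * y)) * \<F> f x"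
    unfolding dunkl_translation_def by blast+
qed

lemma translation_0:
  assumes f: "f \<in> L2" shows "AE x in \<mu>. dunkl_translation k 0 f x = f x"
proof -
  note T = translation[OF f, of 0]
  note [measurable] = f[THEN L2_measurable] T(1)[THEN L2_measurable]
    transform_L2[OF f, THEN L2_measurable] transform_L2[OF T(1), THEN L2_measurable]
  have "dunkl_kernel k 0 = 1"
    using dunkl_kernel_imaginary[OF k, of 0] by (simp add: bessel_power_0 complex_eq_iff)
  then have "AE x in \<mu>. \<F> (dunkl_translation k 0 f) x - \<F> f x = 0"
    using T(2) by (auto elim!: eventually_mono)
  then have "norm2 (\<lambda>x. \<F> (dunkl_translation k 0 f) x - \<F> f x) = 0"
    by (subst L2.cnorm_eq_0_iff) measurable
  then have "norm2 (\<lambda>x. dunkl_translation k 0 f x - f x) = 0"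
    by (simp add: norm2_transform_diff[OF T(1) f])
  then have "AE x in \<mu>. dunkl_translation k 0 f x - f x = 0"
    by (subst (asm) L2.cnorm_eq_0_iff) measurable
  then show ?thesis by eventually_elim simp
qed

text \<open>On the transform side the translation is multiplication by a bounded continuous function of \<open>y\<close>, so
  dominated convergence applies.\<close>

lemma translation_continuous:
  assumes f: "f \<in> L2" and y: "ys \<longlonglongrightarrow> y"
  shows "(\<lambda>n. norm2 (\<lambda>x. dunkl_translation k (ys n) f x - dunkl_translation k y f x)) \<longlonglongrightarrow> 0"
proof -
  let ?E = "\<lambda>y x. dunkl_kernel k (\<i> * of_real (x * y))"
  note [measurable] = transform_L2[OF f, THEN L2_measurable] kernel_measurable
    transform_L2[OF translation(1)[OF f], THEN L2_measurable]
  have eq: "norm2 (\<lambda>x. dunkl_translation k (ys n) f x - dunkl_translation k y f x) =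
      norm2 (\<lambda>x. ?E (ys n) x * \<F> f x - ?E y x * \<F> f x)" for n
    unfolding norm2_transform_diff[OF translation(1)[OF f] translation(1)[OF f]]
  proof (rule L2.cnorm_cong_AE)
    show "AE x in \<mu>. \<F> (dunkl_translation k (ys n) f) x - \<F> (dunkl_translation k y f) x =
        ?E (ys n) x * \<F> f x - ?E y x * \<F> f x"
      using translation(2)[OF f, of "ys n"] translation(2)[OF f, of y] by eventually_elim simp
  qed measurable
  show ?thesis
    unfolding eq
  proof (rule norm2_dominated_convergence)
    show "AE x in \<mu>. (\<lambda>n. ?E (ys n) x * \<F> f x - ?E y x * \<F> f x) \<longlonglongrightarrow> 0"
    proof (rule AE_I2)
      fix x
      have "(\<lambda>n. x * ys n) \<longlonglongrightarrow> x * y" by (intro tendsto_intros y)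
      from continuous_on_tendsto_compose[OF continuous_dunkl_kernel_imaginary[OF k] this]
      have "(\<lambda>n. ?E (ys n) x) \<longlonglongrightarrow> ?E y x" by simp
      then have "(\<lambda>n. ?E (ys n) x * \<F> f x - ?E y x * \<F> f x) \<longlonglongrightarrow> ?E y x * \<F> f x - ?E y x * \<F> f x"
        by (intro tendsto_intros)
      then show "(\<lambda>n. ?E (ys n) x * \<F> f x - ?E y x * \<F> f x) \<longlonglongrightarrow> 0" by simp
    qed
    have "(\<lambda>x. 2 * \<F> f x) \<in> L2" by (rule L2_cmult[OF transform_L2[OF f]])
    then show "integrable \<mu> (\<lambda>x. (cmod (2 * \<F> f x))\<^sup>2)" by (simp add: L2_iff_integrable)
    fix n
    have "cmod (?E (ys n) x * \<F> f x - ?E y x * \<F> f x) \<le> 2 * cmod (\<F> f x)" for x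
    proof -
      have "cmod (?E (ys n) x - ?E y x) \<le> 1 + 1"
        by (intro order_trans[OF norm_triangle_ineq4] add_mono cmod_dunkl_kernel_imaginary_le_1 k)
      from mult_right_mono[OF this, of "cmod (\<F> f x)"] show ?thesis
        by (simp add: norm_mult flip: left_diff_distrib)
    qed
    then show "AE x in \<mu>. cmod (?E (ys n) x * \<F> f x - ?E y x * \<F> f x) \<le> cmod (2 * \<F> f x)"
      by (simp add: norm_mult)
  qed measurable
qed

abbreviation ball_shift :: "real \<Rightarrow> real \<Rightarrow> real \<Rightarrow> complex" where
  "ball_shift r y \<equiv> dunkl_translation k (- y) (indicator (dunkl_ball 0 r))"

definition translation_window :: "real \<Rightarrow> real \<Rightarrow> real \<Rightarrow> ennreal" where
  "translation_window r y x = ennreal (Re (ball_shift r y x))"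

lemma indicator_ball_L2: "indicator (dunkl_ball 0 r) \<in> L2"
proof -
  have m: "indicator {-r<..<r} \<in> borel_measurable \<mu>" by (rule borel_imp_measurable) measurable
  have "emeasure \<mu> {-r<..<r} < \<infinity>"
    by (rule le_less_trans[OF emeasure_mono emeasure_interval_finite[of r]]) (auto simp: sets_dunkl)
  then have "integrable \<mu> (indicator {-r<..<r} :: real \<Rightarrow> real)"
    by (intro integrable_real_indicator) (auto simp: sets_dunkl)
  moreover have "(cmod (indicator {-r<..<r} x))\<^sup>2 = indicator {-r<..<r} x" for x :: real
    by (auto simp: indicator_def)
  ultimately show ?thesis using m by (simp add: L2_iff_integrable dunkl_ball_def)
qed

lemma translation_window_measurable: "translation_window r y \<in> borel_measurable \<mu>"
proof -
  note [measurable] = translation(1)[OF indicator_ball_L2, THEN L2_measurable]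
  show ?thesis unfolding translation_window_def[abs_def] by measurable
qed

text \<open>Pairing with a fixed square-integrable \<open>h\<close> is continuous in the translation parameter, because
  \<open>y \<mapsto> \<tau>\<^sub>y \<chi>\<close> is continuous into \<open>L\<^sup>2\<close> and passing to the positive part does not increase
  distances.\<close>

lemma window_pairing_le:
  assumes h: "(\<lambda>x. complex_of_real (h x)) \<in> L2" and h0: "\<And>x. 0 \<le> h x"
  shows "(\<integral>\<^sup>+x. ennreal (h x) * translation_window r y x \<partial>\<mu>) \<le>
    (\<integral>\<^sup>+x. ennreal (h x) * translation_window r z x \<partial>\<mu>) +
    norm2 (\<lambda>x. of_real (h x)) * norm2 (\<lambda>x. ball_shift r y x
      - ball_shift r z x)"
proof -
  let ?t = "\<lambda>y. ball_shift r y"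
  note T = translation(1)[OF indicator_ball_L2]
  have hm: "(\<lambda>x. Re (complex_of_real (h x))) \<in> borel_measurable \<mu>"
    using L2_measurable[OF h] by measurable
  then have [measurable]: "h \<in> borel_measurable \<mu>" by simp
  note [measurable] = T[THEN L2_measurable] translation_window_measurable
  have le: "translation_window r y x \<le> translation_window r z x + ennreal (cmod (?t y x - ?t z x))" for x
  proof -
    have "Re (?t y x) \<le> max 0 (Re (?t z x)) + cmod (?t y x - ?t z x)"
      using abs_Re_le_cmod[of "?t y x - ?t z x"] by simp
    then have "ennreal (Re (?t y x)) \<le> ennreal (max 0 (Re (?t z x)) + cmod (?t y x - ?t z x))"
      by (rule ennreal_leI)
    also have "\<dots> = ennreal (max 0 (Re (?t z x))) + ennreal (cmod (?t y x - ?t z x))"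
      by (rule ennreal_plus) auto
    also have "ennreal (max 0 (Re (?t z x))) = ennreal (Re (?t z x))"
      by (simp add: max_def ennreal_neg)
    finally show ?thesis by (simp add: translation_window_def)
  qed
  have "(\<integral>\<^sup>+x. ennreal (h x) * translation_window r y x \<partial>\<mu>) \<le>
      (\<integral>\<^sup>+x. ennreal (h x) * translation_window r z x + ennreal (cmod (of_real (h x))) * ennreal (cmod (?t y x - ?t z x)) \<partial>\<mu>)"
    using h0 mult_left_mono[OF le, of "ennreal (h x)" x for x]
    by (intro nn_integral_mono) (simp add: distrib_left)
  also have "\<dots> = (\<integral>\<^sup>+x. ennreal (h x) * translation_window r z x \<partial>\<mu>) +
      (\<integral>\<^sup>+x. ennreal (cmod (of_real (h x))) * ennreal (cmod (?t y x - ?t z x)) \<partial>\<mu>)"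
    by (rule nn_integral_add) measurable
  also have "\<dots> \<le> (\<integral>\<^sup>+x. ennreal (h x) * translation_window r z x \<partial>\<mu>) +
      norm2 (\<lambda>x. of_real (h x)) * norm2 (\<lambda>x. ?t y x - ?t z x)"
    by (intro add_left_mono Cauchy_Schwarz_norm2 L2_measurable L2_diff T h)
  finally show ?thesis .
qed

lemma window_pairing_error_tendsto_0:
  assumes h: "(\<lambda>x. complex_of_real (h x)) \<in> L2" and y: "ys \<longlonglongrightarrow> y"
  shows "(\<lambda>n. norm2 (\<lambda>x. of_real (h x)) * norm2 (\<lambda>x. ball_shift r (ys n) x
      - ball_shift r y x)) \<longlonglongrightarrow> 0"
proof -
  have "norm2 (\<lambda>x. of_real (h x)) < \<infinity>" using h by (simp add: L2_iff)
  then have "(\<lambda>n. norm2 (\<lambda>x. of_real (h x)) * norm2 (\<lambda>x. ball_shift r (ys n) x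
      - ball_shift r y x)) \<longlonglongrightarrow> norm2 (\<lambda>x. of_real (h x)) * 0"
    by (intro ennreal_tendsto_cmult translation_continuous[OF indicator_ball_L2] tendsto_minus y) simp
  then show ?thesis by simp
qed

lemma window_pairing_finite:
  assumes h: "(\<lambda>x. complex_of_real (h x)) \<in> L2"
  shows "(\<integral>\<^sup>+x. ennreal (h x) * translation_window r y x \<partial>\<mu>) < \<infinity>"
proof -
  let ?t = "ball_shift r y"
  note T = translation(1)[OF indicator_ball_L2]
  have "(\<integral>\<^sup>+x. ennreal (h x) * translation_window r y x \<partial>\<mu>) \<le>
      (\<integral>\<^sup>+x. ennreal (cmod (of_real (h x))) * ennreal (cmod (?t x)) \<partial>\<mu>)"
    unfolding translation_window_def
    by (intro nn_integral_mono mult_mono ennreal_leI complex_Re_le_cmod) auto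
  also have "\<dots> \<le> norm2 (\<lambda>x. of_real (h x)) * norm2 ?t"
    by (intro Cauchy_Schwarz_norm2 L2_measurable T h)
  also have "\<dots> < \<infinity>" using T[of "- y" r] h by (simp add: L2_iff ennreal_mult_less_top)
  finally show ?thesis .
qed

lemma window_pairing_measurable:
  assumes h: "(\<lambda>x. complex_of_real (h x)) \<in> L2" and h0: "\<And>x. 0 \<le> h x"
  shows "(\<lambda>y. \<integral>\<^sup>+x. ennreal (h x) * translation_window r y x \<partial>\<mu>) \<in> borel_measurable borel"
proof -
  let ?P = "\<lambda>y. \<integral>\<^sup>+x. ennreal (h x) * translation_window r y x \<partial>\<mu>"
  have fin: "?P y < \<infinity>" for y by (rule window_pairing_finite[OF h])
  have "continuous_on UNIV (\<lambda>y. enn2real (?P y))"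
    unfolding continuous_on_sequentially
  proof (intro allI ballI impI, elim conjE)
    fix ys and y :: real assume ys: "ys \<longlonglongrightarrow> y"
    let ?e = "\<lambda>n. norm2 (\<lambda>x. of_real (h x)) * norm2 (\<lambda>x. ball_shift r (ys n) x
      - ball_shift r y x)"
    note e = window_pairing_error_tendsto_0[OF h ys, of r]
    have le1: "?P (ys n) \<le> ?P y + ?e n" for n by (rule window_pairing_le[OF h h0])
    have le2: "?P y \<le> ?P (ys n) + ?e n" for n
      using window_pairing_le[OF h h0, of r y "ys n"]
      by (simp add: L2.cnorm_minus_commute[of "dunkl_translation k (- y) _"])
    have e_fin: "?e n < \<infinity>" for n
      using h L2_diff[OF translation(1)[OF indicator_ball_L2] translation(1)[OF indicator_ball_L2]]
      by (simp add: L2_iff ennreal_mult_less_top)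
    have bound: "norm (enn2real (?P (ys n)) - enn2real (?P y)) \<le> enn2real (?e n)" for n
      unfolding real_norm_def by (rule abs_enn2real_diff_le[OF le1 le2 fin fin e_fin])
    have "(\<lambda>n. enn2real (?e n)) \<longlonglongrightarrow> 0" using tendsto_enn2real[where l = 0] e by simp
    then have "(\<lambda>n. enn2real (?P (ys n)) - enn2real (?P y)) \<longlonglongrightarrow> 0"
      by (rule Lim_null_comparison[OF always_eventually[OF allI[OF bound]]])
    then show "((\<lambda>y. enn2real (?P y)) \<circ> ys) \<longlonglongrightarrow> enn2real (?P y)"
      unfolding o_def by (rule Lim_null[THEN iffD2])
  qed
  then have "(\<lambda>y. enn2real (?P y)) \<in> borel_measurable borel"
    by (rule borel_measurable_continuous_onI)
  from measurable_compose[OF this measurable_ennreal]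
  have "(\<lambda>y. ennreal (enn2real (?P y))) \<in> borel_measurable borel" .
  moreover have "ennreal (enn2real (?P y)) = ?P y" for y using fin[of y] by simp
  ultimately show ?thesis by (simp only:)
qed

text \<open>A square-integrable approximation from below, to which the continuity in \<open>y\<close> applies.  The pairing with a
  general \<open>g\<close> is the supremum of the pairings with its truncations, and suprema preserve measurability.\<close>

definition truncation :: "(real \<Rightarrow> ennreal) \<Rightarrow> nat \<Rightarrow> real \<Rightarrow> real" where
  "truncation g n x = enn2real (min (g x) (of_nat n)) * indicator {- real n..real n} x"

lemma truncation_nonneg: "0 \<le> truncation g n x"
  by (simp add: truncation_def)

lemma ennreal_truncation: "ennreal (truncation g n x) = min (g x) (of_nat n) * indicator {- real n..real n} x"
proof -
  have "min (g x) (of_nat n) < \<infinity>" using of_nat_less_top[of n] by (simp add: min_less_iff_disj)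
  then show ?thesis by (simp add: truncation_def indicator_def)
qed

lemma truncation_L2:
  assumes [measurable]: "g \<in> borel_measurable \<mu>"
  shows "(\<lambda>x. complex_of_real (truncation g n x)) \<in> L2"
proof (rule L2_bound[where c = n])
  show "indicator (dunkl_ball 0 (real n + 1)) \<in> L2" by (rule indicator_ball_L2)
  have [measurable]: "(\<lambda>x. indicator {- real n..real n} x :: real) \<in> borel_measurable \<mu>"
    by (rule borel_imp_measurable) measurable
  show "(\<lambda>x. complex_of_real (truncation g n x)) \<in> borel_measurable \<mu>"
    unfolding truncation_def by measurable
  have "enn2real (min (g x) (of_nat n)) \<le> n" for x
    using enn2real_mono[of "min (g x) (of_nat n)" "of_nat n"] of_nat_less_top[of n] by simp
  then show "AE x in \<mu>. cmod (of_real (truncation g n x)) \<le> real n * cmod (indicator (dunkl_ball 0 (real n + 1)) x)"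
    by (auto simp: truncation_def dunkl_ball_def indicator_def)
qed

lemma truncation_measurable:
  assumes "g \<in> borel_measurable \<mu>"
  shows "(\<lambda>x. ennreal (truncation g n x)) \<in> borel_measurable \<mu>"
proof -
  have "(\<lambda>x. ennreal (Re (complex_of_real (truncation g n x)))) \<in> borel_measurable \<mu>"
    using truncation_L2[OF assms, THEN L2_measurable, of n] by measurable
  then show ?thesis by simp
qed

lemma SUP_truncation: "(SUP n. ennreal (truncation g n x)) = g x"
proof (rule antisym)
  show "(SUP n. ennreal (truncation g n x)) \<le> g x"
    by (rule SUP_least) (simp add: ennreal_truncation indicator_def)
  show "g x \<le> (SUP n. ennreal (truncation g n x))"
  proof (rule dense_le)
    fix z assume z: "z < g x"
    then obtain c where c: "z = ennreal c" "0 \<le> c" by (cases z) auto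
    obtain n :: nat where n: "max c \<bar>x\<bar> \<le> n" using real_arch_simple by blast
    then have "z \<le> of_nat n" using c by (simp add: ennreal_of_nat_eq_real_of_nat ennreal_leI)
    then have "z \<le> ennreal (truncation g n x)"
      using z n by (simp add: ennreal_truncation indicator_def abs_le_iff less_imp_le)
    then show "z \<le> (SUP n. ennreal (truncation g n x))" by (rule SUP_upper2[OF UNIV_I])
  qed
qed

lemma incseq_truncation: "incseq (\<lambda>n x. ennreal (truncation g n x))"
  by (auto simp: incseq_def le_fun_def ennreal_truncation indicator_def
      intro!: min.coboundedI2 of_nat_mono)

lemma measurable_windows_translation: "measurable_windows \<mu> (translation_window r)"
proof
  show "translation_window r y \<in> borel_measurable \<mu>" for y by (rule translation_window_measurable)
  fix g :: "real \<Rightarrow> ennreal" assume g[measurable]: "g \<in> borel_measurable \<mu>"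
  note trunc = truncation_L2[OF g]
  have "(\<integral>\<^sup>+x. g x * translation_window r y x \<partial>\<mu>) =
      (SUP n. \<integral>\<^sup>+x. ennreal (truncation g n x) * translation_window r y x \<partial>\<mu>)" for y
  proof -
    note [measurable] = truncation_measurable[OF g] translation_window_measurable[of r y]
    have "(\<integral>\<^sup>+x. g x * translation_window r y x \<partial>\<mu>) =
        (\<integral>\<^sup>+x. (SUP n. ennreal (truncation g n x) * translation_window r y x) \<partial>\<mu>)"
      by (simp only: SUP_mult_right_ennreal[symmetric] SUP_truncation)
    also have "\<dots> = (SUP n. \<integral>\<^sup>+x. ennreal (truncation g n x) * translation_window r y x \<partial>\<mu>)"
      using incseq_truncation[of g]
      by (intro nn_integral_monotone_convergence_SUP) (auto simp: incseq_def le_fun_def intro!: mult_right_mono)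
    finally show ?thesis .
  qed
  moreover have "(\<lambda>y. SUP n. \<integral>\<^sup>+x. ennreal (truncation g n x) * translation_window r y x \<partial>\<mu>) \<in> borel_measurable \<mu>"
    by (intro borel_measurable_SUP borel_imp_measurable window_pairing_measurable trunc truncation_nonneg) simp
  ultimately show "(\<lambda>y. \<integral>\<^sup>+x. g x * translation_window r y x \<partial>\<mu>) \<in> borel_measurable \<mu>" by simp
qed

lemma AE_imp_point_in_interval:
  assumes ae: "AE y in \<mu>. P y" and ab: "a < b"
  obtains y where "a < y" "y < b" "P y"
proof (rule ccontr)
  assume "\<not> thesis"
  then have no: "\<And>y. a < y \<Longrightarrow> y < b \<Longrightarrow> \<not> P y" using that by blast
  have "AE y in lborel. P y" using ae unfolding AE_dunkl_iff AE_completion_iff .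
  then have "AE y in lborel. y \<notin> {a<..<b}" using no by (auto elim!: eventually_mono)
  then have "{a<..<b} \<in> null_sets lborel" by (subst AE_iff_null_sets) auto
  then show False using ab by (simp add: null_sets_def)
qed

text \<open>By continuity a pairing that vanishes for almost every \<open>y\<close> vanishes at \<open>y = 0\<close>, where the
  window is the ball itself.\<close>

lemma translation_window_total:
  assumes g[measurable]: "g \<in> borel_measurable \<mu>"
    and 0: "\<And>r. 0 < r \<Longrightarrow> AE y in \<mu>. (\<integral>\<^sup>+x. g x * translation_window r y x \<partial>\<mu>) = 0"
  shows "AE x in \<mu>. g x = 0"
proof -
  note trunc = truncation_L2[OF g]
  have "AE x in \<mu>. truncation g n x = 0" for n
  proof -
    let ?r = "real n + 1"
    let ?P = "\<lambda>y. \<integral>\<^sup>+x. ennreal (truncation g n x) * translation_window ?r y x \<partial>\<mu>"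
    have le: "?P y \<le> (\<integral>\<^sup>+x. g x * translation_window ?r y x \<partial>\<mu>)" for y
    proof (intro nn_integral_mono mult_right_mono)
      fix x
      have "ennreal (truncation g n x) \<le> (SUP n. ennreal (truncation g n x))" by (rule SUP_upper) simp
      then show "ennreal (truncation g n x) \<le> g x" by (simp add: SUP_truncation)
    qed simp
    have "0 < ?r" by simp
    from 0[OF this] have ae: "AE y in \<mu>. ?P y = 0"
    proof eventually_elim
      fix y assume "(\<integral>\<^sup>+x. g x * translation_window ?r y x \<partial>\<mu>) = 0"
      with le[of y] show "?P y = 0" by simp
    qed
    have "\<forall>m. \<exists>y. 0 < y \<and> y < 1 / real (Suc m) \<and> ?P y = 0"
    proof
      fix m
      show "\<exists>y. 0 < y \<and> y < 1 / real (Suc m) \<and> ?P y = 0"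
        by (rule AE_imp_point_in_interval[OF ae, of 0 "1 / real (Suc m)"]) auto
    qed
    then obtain ys where ys: "\<And>m. 0 < ys m" "\<And>m. ys m < 1 / real (Suc m)" "\<And>m. ?P (ys m) = 0" by metis
    have "ys \<longlonglongrightarrow> 0"
    proof (rule tendsto_sandwich[OF _ _ tendsto_const])
      show "(\<lambda>m. 1 / real (Suc m)) \<longlonglongrightarrow> 0" using LIMSEQ_inverse_real_of_nat by (simp add: inverse_eq_divide)
    qed (auto intro!: always_eventually less_imp_le ys(1) less_imp_le[OF ys(2)] simp del: of_nat_Suc)
    from window_pairing_error_tendsto_0[OF trunc[of n] this, of ?r]
    have "(\<lambda>m. norm2 (\<lambda>x. of_real (truncation g n x)) * norm2 (\<lambda>x. ball_shift ?r (ys m) x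
      - ball_shift ?r 0 x)) \<longlonglongrightarrow> 0" .
    moreover have "?P 0 \<le> norm2 (\<lambda>x. of_real (truncation g n x)) * norm2 (\<lambda>x. ball_shift ?r (ys m) x
      - ball_shift ?r 0 x)" for m
      using window_pairing_le[OF trunc[of n] truncation_nonneg, of ?r 0 "ys m"] ys(3)[of m]
      by (simp add: L2.cnorm_minus_commute[of "dunkl_translation k 0 _"])
    ultimately have "?P 0 \<le> 0" by (intro LIMSEQ_le_const) auto
    then have P0: "?P 0 = 0" by simp
    note [measurable] = truncation_measurable[OF g] translation_window_measurable[of ?r 0]
    have "AE x in \<mu>. ennreal (truncation g n x) * translation_window ?r 0 x = 0"
      using P0 by (subst (asm) nn_integral_0_iff_AE) auto
    with translation_0[OF indicator_ball_L2[of ?r]]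
    show "AE x in \<mu>. truncation g n x = 0"
    proof eventually_elim
      fix x
      assume "dunkl_translation k 0 (indicator (dunkl_ball 0 ?r)) x = indicator (dunkl_ball 0 ?r) x"
        and z: "ennreal (truncation g n x) * translation_window ?r 0 x = 0"
      then have w: "translation_window ?r 0 x = ennreal (Re (indicator (dunkl_ball 0 ?r) x))"
        by (simp add: translation_window_def)
      show "truncation g n x = 0"
      proof (cases "x \<in> {- real n..real n}")
        case True
        then have "x \<in> dunkl_ball 0 ?r" by (simp add: dunkl_ball_def)
        then have "ennreal (truncation g n x) = 0" using z w by simp
        then show ?thesis using truncation_nonneg[of g n x] by simp
      qed (simp add: truncation_def)
    qed
  qed
  then have "AE x in \<mu>. \<forall>n. truncation g n x = 0" by (simp add: AE_all_countable)
  then show ?thesis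
    by eventually_elim (simp add: SUP_truncation[of g, symmetric])
qed

lemma dunkl_ball_measurable: "(indicator (dunkl_ball y r) :: real \<Rightarrow> ennreal) \<in> borel_measurable \<mu>"
  unfolding dunkl_ball_def by (rule borel_imp_measurable) measurable

lemma measurable_windows_ball: "measurable_windows \<mu> (\<lambda>y. indicator (dunkl_ball y r))"
proof
  show "(indicator (dunkl_ball y r) :: real \<Rightarrow> ennreal) \<in> borel_measurable \<mu>" for y
    by (rule dunkl_ball_measurable)
  fix g :: "real \<Rightarrow> ennreal" assume [measurable]: "g \<in> borel_measurable \<mu>"
  have [measurable]: "(\<lambda>p. fst p) \<in> borel_measurable (\<mu> \<Otimes>\<^sub>M \<mu>)" "(\<lambda>p. snd p) \<in> borel_measurable (\<mu> \<Otimes>\<^sub>M \<mu>)"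
    using measurable_compose[OF measurable_fst id_measurable_dunkl]
      measurable_compose[OF measurable_snd id_measurable_dunkl] by auto
  have "(\<lambda>p. if fst p = 0 then (if - r < snd p \<and> snd p < r then g (snd p) else 0)
      else if max 0 (\<bar>fst p\<bar> - r) < \<bar>snd p\<bar> \<and> \<bar>snd p\<bar> < \<bar>fst p\<bar> + r then g (snd p) else 0)
      \<in> borel_measurable (\<mu> \<Otimes>\<^sub>M \<mu>)"
    by measurable
  also have "(\<lambda>p. if fst p = 0 then (if - r < snd p \<and> snd p < r then g (snd p) else 0)
      else if max 0 (\<bar>fst p\<bar> - r) < \<bar>snd p\<bar> \<and> \<bar>snd p\<bar> < \<bar>fst p\<bar> + r then g (snd p) else 0) =
      (\<lambda>(y, x). g x * indicator (dunkl_ball y r) x)"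
    by (auto simp: fun_eq_iff dunkl_ball_def indicator_def)
  finally show "(\<lambda>y. \<integral>\<^sup>+x. g x * indicator (dunkl_ball y r) x \<partial>\<mu>) \<in> borel_measurable \<mu>"
    by (rule borel_measurable_nn_integral)
qed

text \<open>For \<open>0 < \<bar>y\<bar> < r\<close> the ball around \<open>y\<close> contains every \<open>x\<close> with \<open>0 < \<bar>x\<bar> < r\<close>.\<close>

lemma ball_window_total:
  assumes g[measurable]: "g \<in> borel_measurable \<mu>"
    and 0: "\<And>r. 0 < r \<Longrightarrow> AE y in \<mu>. (\<integral>\<^sup>+x. g x * indicator (dunkl_ball y r) x \<partial>\<mu>) = 0"
  shows "AE x in \<mu>. g x = 0"
proof -
  have "AE x in \<mu>. 0 < \<bar>x\<bar> \<and> \<bar>x\<bar> < real n + 1 \<longrightarrow> g x = 0" for n :: nat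
  proof -
    have "0 < real n + 1" by simp
    from AE_imp_point_in_interval[OF 0[OF this] this]
    obtain y where y: "0 < y" "y < real n + 1"
      and z: "(\<integral>\<^sup>+x. g x * indicator (dunkl_ball y (real n + 1)) x \<partial>\<mu>) = 0" by blast
    note [measurable] = dunkl_ball_measurable[of y "real n + 1"]
    have "AE x in \<mu>. g x * indicator (dunkl_ball y (real n + 1)) x = 0"
      using z by (subst (asm) nn_integral_0_iff_AE) auto
    then show ?thesis
      by eventually_elim (use y in \<open>auto simp: dunkl_ball_def indicator_def split: if_splits\<close>)
  qed
  then have "AE x in \<mu>. \<forall>n::nat. 0 < \<bar>x\<bar> \<and> \<bar>x\<bar> < real n + 1 \<longrightarrow> g x = 0"
    unfolding AE_all_countable by blast
  moreover have "AE x in \<mu>. x \<noteq> 0"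
    unfolding AE_dunkl_iff by (intro AE_completion AE_lborel_singleton)
  ultimately show ?thesis
  proof eventually_elim
    fix x :: real assume x: "\<forall>n::nat. 0 < \<bar>x\<bar> \<and> \<bar>x\<bar> < real n + 1 \<longrightarrow> g x = 0" "x \<noteq> 0"
    obtain n :: nat where "\<bar>x\<bar> \<le> n" using real_arch_simple by blast
    then have "\<bar>x\<bar> < real n + 1" by simp
    then show "g x = 0" using x by auto
  qed
qed

lemma measure_ball_pos:
  assumes r: "0 < r" shows "0 < measure \<mu> (dunkl_ball 0 r)"
proof -
  have fin: "emeasure \<mu> {-r<..<r} < \<infinity>"
    by (rule le_less_trans[OF emeasure_mono emeasure_interval_finite[of r]]) (auto simp: sets_dunkl)
  have "emeasure \<mu> {-r<..<r} \<noteq> 0"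
  proof
    assume "emeasure \<mu> {-r<..<r} = 0"
    then have "{-r<..<r} \<in> null_sets \<mu>" by (auto simp: sets_dunkl)
    then have ae: "AE y in \<mu>. y \<notin> {-r<..<r}" by (rule AE_not_in)
    have "- r < r" using r by simp
    from AE_imp_point_in_interval[OF ae this] show False by auto
  qed
  then show ?thesis using fin by (simp add: measure_def dunkl_ball_def enn2real_positive_iff zero_less_iff_neq_zero)
qed

definition window :: "ennreal \<Rightarrow> real \<Rightarrow> real \<Rightarrow> real \<Rightarrow> ennreal" where
  "window q r = (if q = \<infinity> then (\<lambda>y. indicator (dunkl_ball y r)) else translation_window r)"

definition window_norm :: "ennreal \<Rightarrow> real \<Rightarrow> (real \<Rightarrow> ennreal) \<Rightarrow> real \<Rightarrow> ennreal" where
  "window_norm q r g y =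
    (if q = \<infinity> then esssup \<mu> (\<lambda>x. g x * indicator (dunkl_ball y r) x)
     else ennreal_powr (\<integral>\<^sup>+x. ennreal_powr (g x) (enn2real q) * translation_window r y x \<partial>\<mu>) (recip q))"

text \<open>\<^const>\<open>fofana_norm\<close> depends on \<open>f\<close> through its modulus only; this is the underlying function of the modulus.\<close>

definition fofana_function_norm ::
  "ennreal \<Rightarrow> ennreal \<Rightarrow> ennreal \<Rightarrow> (real \<Rightarrow> ennreal) \<Rightarrow> ennreal" where
  "fofana_function_norm q p \<alpha> g =
     (SUP r\<in>{0<..}. ennreal (measure \<mu> (dunkl_ball 0 r) powr (recip \<alpha> - recip q - recip p)) *
        Lp_norm \<mu> p (window_norm q r g))"

lemma fofana_norm_eq:
  "fofana_norm k q p \<alpha> f = fofana_function_norm q p \<alpha> (\<lambda>x. ennreal (cmod (f x)))"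
proof -
  have "local_norm k q r f = window_norm q r (\<lambda>x. ennreal (cmod (f x)))" for r
  proof
    fix y
    have "ennreal (cmod (f x * indicator (dunkl_ball y r) x)) = ennreal (cmod (f x)) * indicator (dunkl_ball y r) x" for x
      by (simp add: indicator_def)
    then show "local_norm k q r f y = window_norm q r (\<lambda>x. ennreal (cmod (f x))) y"
      unfolding local_norm_def translated_mass_def translation_window_def window_norm_def
      by (simp only: ennreal_powr_ennreal[OF norm_ge_zero])
  qed
  then show ?thesis
    unfolding fofana_norm_def amalgam_norm_def fofana_function_norm_def by (simp only:)
qed

lemma Lp_norm_window:
  assumes q: "1 \<le> q" and g[measurable]: "g \<in> borel_measurable \<mu>"
  shows "Lp_norm (density \<mu> (window q r y)) q g = window_norm q r g y"
proof (cases "q = \<infinity>")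
  case True
  note [measurable] = dunkl_ball_measurable[of y r]
  have "esssup (density \<mu> (indicator (dunkl_ball y r))) g \<le> c \<longleftrightarrow>
      esssup \<mu> (\<lambda>x. g x * indicator (dunkl_ball y r) x) \<le> c" for c
  proof -
    have "esssup (density \<mu> (indicator (dunkl_ball y r))) g \<le> c \<longleftrightarrow>
        (AE x in \<mu>. 0 < (indicator (dunkl_ball y r) x :: ennreal) \<longrightarrow> g x \<le> c)"
      by (subst esssup_le_iff) (auto simp: AE_density)
    also have "\<dots> \<longleftrightarrow> (AE x in \<mu>. g x * indicator (dunkl_ball y r) x \<le> c)"
      by (intro AE_cong) (auto simp: indicator_def)
    also have "\<dots> \<longleftrightarrow> esssup \<mu> (\<lambda>x. g x * indicator (dunkl_ball y r) x) \<le> c"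
      by (subst esssup_le_iff) auto
    finally show ?thesis .
  qed
  then have "esssup (density \<mu> (indicator (dunkl_ball y r))) g = esssup \<mu> (\<lambda>x. g x * indicator (dunkl_ball y r) x)"
    by (meson antisym order_refl)
  then show ?thesis by (simp add: True window_def window_norm_def Lp_norm_infinity)
next
  case False
  then show ?thesis
    using translation_window_measurable[of r y]
    by (simp add: window_def window_norm_def Lp_norm_def nn_integral_density mult.commute)
qed

text \<open>On measurable functions the norm is a supremum of mixed norms for one of the two families of
  windows.\<close>

lemma function_norm_fofana:
  assumes q: "1 \<le> q" and p: "1 \<le> p"
  shows "function_norm \<mu> (fofana_function_norm q p \<alpha>)"
proof (rule function_norm_cong)
  let ?w = "\<lambda>r. ennreal (measure \<mu> (dunkl_ball 0 r) powr (recip \<alpha> - recip q - recip p))"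
  show "function_norm \<mu> (\<lambda>g. SUP r\<in>{0<..}. ?w r * mixed_norm \<mu> (window q r) q p g)"
  proof (rule function_norm_SUP_mixed_norm[OF _ q p])
    show "measurable_windows \<mu> (window q r)" for r
      using measurable_windows_ball measurable_windows_translation by (simp add: window_def)
    show "?w r \<noteq> 0" if "r \<in> {0<..}" for r
      using measure_ball_pos[of r] that by simp
    fix g :: "real \<Rightarrow> ennreal" assume "g \<in> borel_measurable \<mu>"
      and "\<And>r. r \<in> {0<..} \<Longrightarrow> AE y in \<mu>. (\<integral>\<^sup>+x. g x * window q r y x \<partial>\<mu>) = 0"
    then show "AE x in \<mu>. g x = 0"
      using ball_window_total[of g] translation_window_total[of g]
      by (cases "q = \<infinity>") (auto simp: window_def)
  qed
  fix g :: "real \<Rightarrow> ennreal" assume "g \<in> borel_measurable \<mu>"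
  then show "fofana_function_norm q p \<alpha> g = (SUP r\<in>{0<..}. ?w r * mixed_norm \<mu> (window q r) q p g)"
    unfolding fofana_function_norm_def mixed_norm_def by (simp only: Lp_norm_window[OF q])
qed

lemma complex_banach_space_fofana:
  assumes q: "1 \<le> q" and p: "1 \<le> p"
  shows "complex_banach_space (fofana_space k q p \<alpha>) (\<lambda>F. enn2real (fofana_norm k q p \<alpha> (rep F)))"
proof -
  interpret fofana: function_norm \<mu> "fofana_function_norm q p \<alpha>" by (rule function_norm_fofana[OF q p])
  have "fofana_norm k q p \<alpha> = fofana.cnorm"
    by (simp add: fun_eq_iff fofana_norm_eq fofana.cnorm_def)
  then show ?thesis
    using fofana.complex_banach_space_V by (simp add: fofana_space_def norm_class_space_def Let_def)
qed

end

theorem proposition4p16: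
  fixes k :: real and q p \<alpha> :: ennreal
  assumes "k > - 1 / 2"
    and "1 \<le> q" and "1 \<le> \<alpha>" and "1 \<le> p"
    and "q \<le> \<alpha>" and "\<alpha> \<le> p"
  shows "complex_banach_space (fofana_space k q p \<alpha>)
           (\<lambda>F. enn2real (fofana_norm k q p \<alpha> (rep F)))"
proof -
  interpret dunkl k by standard (fact assms(1))
  show ?thesis by (rule complex_banach_space_fofana[OF assms(2) assms(4)])
qed

end
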